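(* Let $\alpha$ be an irrational number of bounded type, and let $\beta:=2\alpha-1=[2m_0;2m_1,2m_2,\ldots]$ be the even continued fraction expansion of $\beta$. Then the sequence $\{D_N(\alpha)\}_{N\ge 1}$ is equidistributed in $\tfrac12\mathbb Z$ if and only if $$\lim_{n\to\infty}\frac1n\sum_{j=1}^n\bigl[\operatorname{sgn}(m_{2j})-\operatorname{sgn}(m_{2j-1})\bigr]=0 .$$
   Context: $\{x\}\in[0,1)$ denotes the fractional part of $x$. For irrational $\alpha$, $D_N(\alpha):=\#\{0\le j\le N-1:\{j\alpha\}\in[0,\tfrac12)\}-\tfrac12N\in\tfrac12\mathbb Z$. An irrational number is of bounded type if the partial quotients $a_i$ of its regular continued fraction expansion $[a_0;a_1,a_2,\ldots]$ ($a_0\in\mathbb Z$, $a_i\in\mathbb N$ for $i\ge1$) are bounded. Here $[a_0;a_1,\ldots]:=\lim_n[a_0;a_1,\ldots,a_n]$ with $[a_0;a_1,\ldots,a_n]=a_0+\cfrac{1}{a_1+\cfrac{1}{\cdots+\cfrac1{a_n}}}$. Every irrational $\beta$ has a unique even continued fraction expansion $\beta=[2m_0;2m_1,2m_2,\ldots]$ with $m_0\in\mathbb Z$ and $m_i\in\mathbb Z\setminus\{0\}$ for $i\ge1$. A sequence $\{D_N\}$ in $\tfrac12\mathbb Z$ is equidistributed in $\tfrac12\mathbb Z$ if for all $\xi_1,\xi_2\in\tfrac12\mathbb Z$, $\lim_{n\to\infty}\frac{\#\{1\le N\le n:D_N=\xi_1\}}{\#\{1\le N\le n:D_N=\xi_2\}}=1$.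 *)

theory Defs
  imports "HOL-Analysis.Analysis"
begin

text \<open>
  The value \<open>[a\<^sub>0; a\<^sub>1, \<dots>, a\<^sub>n]\<close> of a finite continued fraction. For the two kinds of expansions
  below the tail denominators are nonzero, so the convention \<open>x / 0 = 0\<close> plays no role.
\<close>
fun cfrac :: "(nat \<Rightarrow> int) \<Rightarrow> nat \<Rightarrow> real" where
  "cfrac a 0 = of_int (a 0)"
| "cfrac a (Suc n) = of_int (a 0) + 1 / cfrac (\<lambda>i. a (Suc i)) n"

definition regular_cf_expansion :: "(nat \<Rightarrow> int) \<Rightarrow> real \<Rightarrow> bool" where
  "regular_cf_expansion a x \<longleftrightarrow> (\<forall>i\<ge>1. a i \<ge> 1) \<and> cfrac a \<longlonglongrightarrow> x"

definition even_cf_expansion :: "(nat \<Rightarrow> int) \<Rightarrow> real \<Rightarrow> bool" where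
  "even_cf_expansion m x \<longleftrightarrow> (\<forall>i\<ge>1. m i \<noteq> 0) \<and> cfrac (\<lambda>i. 2 * m i) \<longlonglongrightarrow> x"

text \<open>
  The regular expansion of an irrational number exists and is unique, so the existential
  quantifier over \<open>a\<close> refers to that expansion.
\<close>
definition bounded_type :: "real \<Rightarrow> bool" where
  "bounded_type x \<longleftrightarrow>
     x \<notin> \<rat> \<and> (\<exists>a. regular_cf_expansion a x \<and> (\<exists>B. \<forall>i. \<bar>a i\<bar> \<le> B))"

definition discrepancy :: "real \<Rightarrow> nat \<Rightarrow> real" where
  "discrepancy \<alpha> N =
     real (card {j. j < N \<and> frac (real j * \<alpha>) \<in> {0..<1/2}}) - 1/2 * real N"

definition half_ints :: "real set" where
  "half_ints = range (\<lambda>k::int. of_int k / 2)"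

text \<open>
  If the denominator of the quotient vanished for infinitely many \<open>n\<close>, then the quotient would be
  \<open>0\<close> for these \<open>n\<close>, so a limit of \<open>1\<close> forces the denominators to be eventually positive.
\<close>
definition equidistributed_half_ints :: "(nat \<Rightarrow> real) \<Rightarrow> bool" where
  "equidistributed_half_ints D \<longleftrightarrow>
     (\<forall>N\<ge>1. D N \<in> half_ints) \<and>
     (\<forall>\<xi>\<^sub>1\<in>half_ints. \<forall>\<xi>\<^sub>2\<in>half_ints.
        (\<lambda>n. real (card {N\<in>{1..n}. D N = \<xi>\<^sub>1}) / real (card {N\<in>{1..n}. D N = \<xi>\<^sub>2}))
          \<longlonglongrightarrow> 1)"

end

theory Submission
  imports Defs
begin

text \<open>
  Twice the discrepancy is a simple walk: \<open>D_N = (1 + T_{N-1}) / 2\<close>, where \<open>T\<close> has the steps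
  \<open>(-1)^(j + \<lfloor>j \<beta>\<rfloor>)\<close>. For a convergent \<open>P/Q\<close> of the even expansion, \<open>P + Q\<close> is odd, so the steps
  change sign under translation by \<open>Q\<close>; moreover they form a palindrome on \<open>{1..<Q}\<close>. Hence the
  walk up to the next denominator \<open>2\<bar>m\<bar>Q + \<sigma>Q'\<close> is made of reflected copies of the
  walk up to \<open>Q\<close>, and the occupation counts up to \<open>Q_n\<close>, recentred at \<open>\<tau>_n / 2\<close>, are the
  coefficients of \<open>H_n (w + 1/w)\<close> with \<open>H_{n+1} (x) = \<bar>m\<bar> x H_n (x) + \<sigma> H_{n-1} (x)\<close>. The centre satisfies
  \<open>\<tau>_{2n+1} = \<Sum>_{j\<le>n} (sgn m_{2j} - sgn m_{2j-1})\<close>.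

  Bounded type makes the \<open>m_i\<close> bounded and bounds the length of the runs with \<open>\<bar>m\<bar> = 1\<close> and \<open>\<sigma> = -1\<close>.
  Therefore \<open>H_n (w + 1/w)\<close> is, up to an exponentially small part, a nonnegative combination of
  shifted binomials \<open>(w + 1/w)^j\<close> with \<open>j\<close> proportional to \<open>n\<close>, read off near their centres. So
  neighbouring levels are visited almost equally often, up to an error \<open>\<theta>^n Q_n\<close> with \<open>\<theta> < 1\<close>,
  and this passes to all times \<open>N\<close>. On the other hand, a level at distance at least \<open>\<eta> n\<close> from
  \<open>\<tau>_n / 2\<close> receives at most \<open>\<kappa>^n Q_n\<close> visits with \<open>\<kappa> < 1\<close>. If \<open>\<tau>_n = o(n)\<close>, a fixed level receives at
  least \<open>\<kappa>^n Q_n\<close> visits for every \<open>\<kappa> < 1\<close>, so the error term is negligible. Conversely, equidistribution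
  forces the visits to level 0 to obey the recurrence of \<open>Q_n\<close> asymptotically, which is incompatible
  with exponentially few visits, so \<open>\<tau>_n = o(n)\<close>.
\<close>

section \<open>Coefficients of \<open>(w + 1/w)\<^sup>j\<close>\<close>

text \<open>The coefficient of \<open>w\<^sup>i\<close> in \<open>(w + 1/w)\<^sup>j\<close>.\<close>
fun bico :: "nat \<Rightarrow> int \<Rightarrow> real" where
  "bico 0 i = (if i = 0 then 1 else 0)"
| "bico (Suc j) i = bico j (i - 1) + bico j (i + 1)"

lemma bico_nonneg: "0 \<le> bico j i"
  by (induction j arbitrary: i) auto

lemma bico_eq_0: "int j < \<bar>i\<bar> \<Longrightarrow> bico j i = 0"
  by (induction j arbitrary: i) auto

text \<open>\<open>bico j i\<close> is the binomial coefficient of \<open>j\<close> over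
  \<open>(j + i) / 2\<close>, zero if the parities of \<open>j\<close> and \<open>i\<close> differ.
  The ratio of consecutive binomials is cross-multiplied, so vanishing coefficients need no separate
  treatment.\<close>

lemma bico_ratio: "(of_nat j - of_int i) * bico j i = (of_nat j + of_int i + 2) * bico j (i + 2)"
proof (induction j arbitrary: i)
  case (Suc j)
  have 1: "(of_nat j - of_int i + 1) * bico j (i - 1) = (of_nat j + of_int i + 1) * bico j (i + 1)"
    using Suc.IH[of "i - 1"] by (simp add: algebra_simps)
  have 2: "(of_nat j - of_int i - 1) * bico j (i + 1) = (of_nat j + of_int i + 3) * bico j (i + 3)"
    using Suc.IH[of "i + 1"] by (simp add: algebra_simps)
  show ?case using 1 2 by (simp add: algebra_simps)
qed auto

text \<open>A single nonnegative term is at most the whole Laurent polynomial at \<open>w\<close>;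
  this is the source of the Chernoff bound below.\<close>

lemma bico_le_power:
  assumes "0 < w"
  shows "bico j i * w powi i \<le> (w + 1 / w) ^ j"
proof (induction j arbitrary: i)
  case (Suc j)
  have "bico (Suc j) i * w powi i
      = bico j (i - 1) * w powi (i - 1) * w + bico j (i + 1) * w powi (i + 1) * (1 / w)"
    using assms by (simp add: algebra_simps power_int_diff power_int_add)
  also have "\<dots> \<le> (w + 1 / w) ^ j * w + (w + 1 / w) ^ j * (1 / w)"
    using assms by (intro add_mono mult_right_mono Suc.IH) auto
  finally show ?case by (simp add: algebra_simps)
qed auto

lemma bico_le: "bico j i \<le> 2 ^ j"
  using bico_le_power[of 1 j i] by simp

lemma bico_tail:
  assumes z: "0 < \<zeta>" "\<zeta> \<le> 1" and j: "j \<le> n" and i: "\<zeta> * real n < of_int i"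
  shows "bico j i \<le> 2 ^ j * exp (- \<zeta>\<^sup>2 / 8) ^ n"
proof -
  \<comment> \<open>Chernoff bound at \<open>w = 1 + s\<close>. Per unit of \<open>n\<close> the
    exponents are \<open>s^2 / 2 = \<zeta>^2 / 8\<close> for the cost and
    \<open>s \<zeta> / 2 = \<zeta>^2 / 4\<close> for the gain.\<close>
  define s where "s = \<zeta> / 2"
  have s: "0 < s" "s \<le> 1/2" using z by (auto simp: s_def)
  have i0: "0 \<le> i" using i z by (smt (verit) mult_nonneg_nonneg of_int_0_le_iff of_nat_0_le_iff)
  have w: "(1 + s) + 1 / (1 + s) \<le> 2 * exp (s\<^sup>2 / 2)"
  proof -
    have "(1 + s) + 1 / (1 + s) = 2 + s\<^sup>2 / (1 + s)"
      using s by (simp add: field_simps power2_eq_square)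
    also have "\<dots> \<le> 2 + s\<^sup>2" using s by (simp add: field_simps)
    also have "\<dots> \<le> 2 * exp (s\<^sup>2 / 2)" using exp_ge_add_one_self[of "s\<^sup>2 / 2"] by linarith
    finally show ?thesis .
  qed
  have l: "s / 2 \<le> ln (1 + s)"
  proof -
    have "s - s\<^sup>2 \<le> ln (1 + s)" using ln_one_plus_pos_lower_bound[of s] s by auto
    moreover have "s\<^sup>2 \<le> s / 2" using s by (simp add: power2_eq_square)
    ultimately show ?thesis by linarith
  qed
  have "bico j i * (1 + s) powi i \<le> ((1 + s) + 1 / (1 + s)) ^ j"
    using bico_le_power[of "1 + s"] s by simp
  also have "\<dots> \<le> (2 * exp (s\<^sup>2 / 2)) ^ j"
    using w s by (intro power_mono) auto
  also have "\<dots> = 2 ^ j * exp (s\<^sup>2 / 2) ^ j" by (simp add: power_mult_distrib)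
  also have "\<dots> \<le> 2 ^ j * exp (s\<^sup>2 / 2) ^ n"
    using j by (intro mult_left_mono power_increasing) auto
  finally have 1: "bico j i * (1 + s) powi i \<le> 2 ^ j * exp (s\<^sup>2 / 2) ^ n" .
  have "exp (s / 2 * (\<zeta> * n)) \<le> exp (ln (1 + s) * of_int i)"
    using l i s z by (intro iffD2[OF exp_le_cancel_iff] mult_mono) auto
  also have "\<dots> = (1 + s) powi i"
    using s by (simp add: powr_real_of_int' powr_def mult.commute flip: powr_real_of_int')
  finally have 2: "exp (s / 2 * (\<zeta> * n)) \<le> (1 + s) powi i" .
  have "bico j i * exp (s / 2 * (\<zeta> * n)) \<le> 2 ^ j * exp (s\<^sup>2 / 2) ^ n"
    using 1 2 bico_nonneg[of j i] by (meson mult_left_mono order_trans)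
  then have "bico j i \<le> 2 ^ j * (exp (s\<^sup>2 / 2) ^ n / exp (s / 2 * (\<zeta> * n)))"
    by (simp add: field_simps)
  also have "exp (s\<^sup>2 / 2) ^ n / exp (s / 2 * (\<zeta> * n)) = exp (- \<zeta>\<^sup>2 / 8) ^ n"
    by (simp add: s_def power2_eq_square field_simps flip: exp_of_nat_mult exp_diff)
  finally show ?thesis .
qed

text \<open>The two exceptional terms collect the binomial coefficients with few trials and those far
  from the centre; elsewhere neighbouring coefficients have ratio close to 1.\<close>
lemma bico_flat:
  assumes "0 < \<epsilon>" "\<epsilon> \<le> 1" "0 < \<delta>" "\<delta> \<le> 1" and j: "j \<le> n" and n: "4 \<le> \<epsilon> * \<delta> * real n"
  shows "(1 - \<epsilon>) * bico j i
    \<le> bico j (i + 2) + (2 powr \<delta>) ^ n + 2 ^ j * exp (- (\<epsilon> * \<delta> / 4)\<^sup>2 / 8) ^ n"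
proof -
  have nn: "0 \<le> bico j (i + 2)" "0 \<le> (2 powr \<delta>) ^ n"
      "0 \<le> 2 ^ j * exp (- (\<epsilon> * \<delta> / 4)\<^sup>2 / 8) ^ n"
    using bico_nonneg by auto
  have le1: "(1 - \<epsilon>) * bico j i \<le> bico j i"
    using assms bico_nonneg[of j i] by (simp add: mult_left_le_one_le)
  \<comment> \<open>The exceptional terms absorb \<open>few\<close> and \<open>far\<close>, and in
    \<open>out\<close> the left side vanishes. In \<open>neg\<close> the coefficients still increase
    to the right; in \<open>pos\<close> the ratio \<open>(j - i) / (j + i + 2)\<close> is at least
    \<open>1 - \<epsilon>\<close>.\<close>
  consider (few) "real j \<le> \<delta> * n" | (far) "\<epsilon> * \<delta> / 4 * n < i"
    | (out) "int j < - i" | (neg) "\<delta> * n < j" "- int j \<le> i" "i < 0"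
    | (pos) "\<delta> * n < j" "0 \<le> i" "i \<le> \<epsilon> * \<delta> / 4 * n"
    by linarith
  then show ?thesis
  proof cases
    case few
    have "bico j i \<le> 2 powr (real j)" using bico_le by (simp add: powr_realpow)
    also have "\<dots> \<le> 2 powr (\<delta> * n)" using few by simp
    also have "\<dots> = (2 powr \<delta>) ^ n" by (simp add: powr_powr flip: powr_realpow)
    finally show ?thesis using nn le1 by linarith
  next
    case far
    have "\<epsilon> * \<delta> \<le> 1 * 1" using assms by (intro mult_mono) auto
    then have "bico j i \<le> 2 ^ j * exp (- (\<epsilon> * \<delta> / 4)\<^sup>2 / 8) ^ n"
      using far assms by (intro bico_tail) auto
    then show ?thesis using nn le1 by linarith
  next
    case out
    then show ?thesis using nn bico_eq_0[of j i] by simp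
  next
    case neg
    have "bico j i \<le> bico j (i + 2)"
    proof -
      have "(real j + of_int i + 2) * bico j i \<le> (real j - of_int i) * bico j i"
        using neg bico_nonneg[of j i] by (intro mult_right_mono) linarith+
      also have "\<dots> = (real j + of_int i + 2) * bico j (i + 2)" by (rule bico_ratio)
      finally show ?thesis
        using neg by (simp add: mult_le_cancel_left)
    qed
    then show ?thesis using nn le1 by linarith
  next
    case pos
    have p: "0 < real j + of_int i + 2" using pos by linarith
    have "\<epsilon> * (\<delta> * n) \<le> \<epsilon> * j" using pos assms by (intro mult_left_mono) auto
    then have "2 * of_int i + 2 \<le> \<epsilon> * j" using pos n by (simp add: field_simps)
    moreover have "(0::real) \<le> \<epsilon> * (of_int i + 2)" using pos assms by simp
    ultimately have "(1 - \<epsilon>) * (real j + of_int i + 2) \<le> real j - of_int i"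
      by (simp add: algebra_simps)
    then have "(1 - \<epsilon>) * (real j + of_int i + 2) * bico j i \<le> (real j - of_int i) * bico j i"
      using bico_nonneg by (intro mult_right_mono)
    also have "\<dots> = (real j + of_int i + 2) * bico j (i + 2)" by (rule bico_ratio)
    finally have "(real j + of_int i + 2) * ((1 - \<epsilon>) * bico j i) \<le> (real j + of_int i + 2) * bico j (i + 2)"
      by (simp add: algebra_simps)
    then have "(1 - \<epsilon>) * bico j i \<le> bico j (i + 2)"
      using p by (simp only: mult_le_cancel_left_pos)
    then show ?thesis using nn by linarith
  qed
qed

section \<open>Binomial mixtures\<close>

text \<open>A list of triples \<open>(c, j, l)\<close> stands for the Laurent polynomial
  \<open>\<Sum> c (w + 1/w)\<^sup>j w\<^sup>l\<close>.\<close>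

type_synonym mixture = "(real \<times> nat \<times> int) list"

definition mix_coeff :: "mixture \<Rightarrow> int \<Rightarrow> real" where
  "mix_coeff xs k = (\<Sum>(c, j, l)\<leftarrow>xs. c * bico j (k - l))"

text \<open>For \<open>y = 2\<close> this is the value at \<open>w = 1\<close>, the sum of all
  coefficients. For \<open>y = 1\<close> each factor \<open>w + 1/w\<close> counts only once, which
  favours products with few factors.\<close>

definition mix_weight :: "mixture \<Rightarrow> real \<Rightarrow> real" where
  "mix_weight xs y = (\<Sum>(c, j, l)\<leftarrow>xs. c * y ^ j)"

text \<open>The common bound \<open>n\<close> on the exponents keeps the errors of
  \<open>bico_flat\<close> uniform over the mixture.\<close>

definition mix_ok :: "nat \<Rightarrow> mixture \<Rightarrow> bool" where
  "mix_ok n xs \<longleftrightarrow> (\<forall>x\<in>set xs. 0 \<le> fst x \<and> fst (snd x) \<le> n)"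

definition scale :: "real \<Rightarrow> mixture \<Rightarrow> mixture" where
  "scale a = map (\<lambda>(c, j, l). (a * c, j, l))"

text \<open>Multiplication by \<open>w + 1/w\<close>.\<close>

definition mark :: "mixture \<Rightarrow> mixture" where
  "mark = map (\<lambda>(c, j, l). (c, Suc j, l))"

text \<open>Multiplication by \<open>w^s\<close>.\<close>

definition shift :: "int \<Rightarrow> mixture \<Rightarrow> mixture" where
  "shift s = map (\<lambda>(c, j, l). (c, j, l + s))"

lemma mix_coeff_simps [simp]:
  "mix_coeff [] k = 0"
  "mix_coeff (xs @ ys) k = mix_coeff xs k + mix_coeff ys k"
  "mix_coeff (scale a xs) k = a * mix_coeff xs k"
  "mix_coeff (mark xs) k = mix_coeff xs (k - 1) + mix_coeff xs (k + 1)"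
  "mix_coeff (shift s xs) k = mix_coeff xs (k - s)"
  subgoal by (simp add: mix_coeff_def)
  subgoal by (simp add: mix_coeff_def)
  subgoal by (induction xs) (auto simp: mix_coeff_def scale_def algebra_simps)
  subgoal by (induction xs) (auto simp: mix_coeff_def mark_def algebra_simps)
  subgoal by (induction xs) (auto simp: mix_coeff_def shift_def algebra_simps)
  done

lemma mix_weight_simps [simp]:
  "mix_weight [] y = 0"
  "mix_weight (xs @ ys) y = mix_weight xs y + mix_weight ys y"
  "mix_weight (scale a xs) y = a * mix_weight xs y"
  "mix_weight (mark xs) y = y * mix_weight xs y"
  "mix_weight (shift s xs) y = mix_weight xs y"
  subgoal by (simp add: mix_weight_def)
  subgoal by (simp add: mix_weight_def)
  subgoal by (induction xs) (auto simp: mix_weight_def scale_def algebra_simps)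
  subgoal by (induction xs) (auto simp: mix_weight_def mark_def algebra_simps)
  subgoal by (induction xs) (auto simp: mix_weight_def shift_def algebra_simps)
  done

lemma mix_ok_simps [simp]:
  "mix_ok n []"
  "mix_ok n (xs @ ys) \<longleftrightarrow> mix_ok n xs \<and> mix_ok n ys"
  "mix_ok (Suc n) (mark xs) \<longleftrightarrow> mix_ok n xs"
  "mix_ok n (shift s xs) \<longleftrightarrow> mix_ok n xs"
  by (auto simp: mix_ok_def mark_def shift_def)

lemma mix_ok_scale: "0 \<le> a \<Longrightarrow> mix_ok n xs \<Longrightarrow> mix_ok n (scale a xs)"
  by (auto simp: mix_ok_def scale_def)

lemma mix_ok_mono: "mix_ok n xs \<Longrightarrow> n \<le> m \<Longrightarrow> mix_ok m xs"
  by (auto simp: mix_ok_def intro: order_trans)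

lemma mix_coeff_nonneg: "mix_ok n xs \<Longrightarrow> 0 \<le> mix_coeff xs k"
  unfolding mix_coeff_def by (intro sum_list_nonneg) (auto simp: mix_ok_def bico_nonneg)

text \<open>\<open>bico_flat\<close> is summed with the nonnegative weights \<open>c\<close>; its
  exceptional terms add up to the weights at 1 and at 2.\<close>

lemma mix_coeff_flat:
  assumes "0 < \<epsilon>" "\<epsilon> \<le> 1" "0 < \<delta>" "\<delta> \<le> 1" "mix_ok n xs" "4 \<le> \<epsilon> * \<delta> * real n"
  shows "(1 - \<epsilon>) * mix_coeff xs k \<le> mix_coeff xs (k + 2) + (2 powr \<delta>) ^ n * mix_weight xs 1
    + exp (- (\<epsilon> * \<delta> / 4)\<^sup>2 / 8) ^ n * mix_weight xs 2"
  using \<open>mix_ok n xs\<close>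
proof (induction xs)
  case (Cons x xs)
  obtain c j l where x: "x = (c, j, l)" by (cases x) auto
  have c: "0 \<le> c" "j \<le> n" "mix_ok n xs" using Cons.prems by (auto simp: x mix_ok_def)
  have "c * ((1 - \<epsilon>) * bico j (k - l)) \<le> c * (bico j (k - l + 2) + (2 powr \<delta>) ^ n
      + 2 ^ j * exp (- (\<epsilon> * \<delta> / 4)\<^sup>2 / 8) ^ n)"
    using assms c by (intro mult_left_mono bico_flat) auto
  then show ?case using Cons.IH[OF c(3)]
    by (simp add: x mix_coeff_def mix_weight_def algebra_simps)
qed (simp add: mix_coeff_def)

section \<open>Polynomials of a recurrence with bounded coefficients and bounded runs of slow
  steps\<close>

locale cf_recurrence =
  fixes \<mu> \<sigma> :: "nat \<Rightarrow> real" and B :: real and K :: nat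
  assumes mu_ge: "1 \<le> \<mu> n" and mu_le: "\<mu> n \<le> B"
    and sigma: "\<sigma> n = 1 \<or> \<sigma> n = -1"
    and window: "\<exists>i<K. 2 \<le> \<mu> (n + i) \<or> \<sigma> (n + i) = 1"
begin

text \<open>The argument stands for \<open>w + 1/w\<close>. At 2, that is at \<open>w = 1\<close>,
  the recurrence becomes that of the convergent denominators.\<close>

fun H :: "nat \<Rightarrow> real \<Rightarrow> real" where
  "H 0 x = 0"
| "H (Suc 0) x = 1"
| "H (Suc (Suc n)) x = \<mu> n * x * H (Suc n) x + \<sigma> n * H n x"

text \<open>The coefficient of \<open>w^k\<close> in \<open>H n (w + 1/w)\<close>, given by its own
  recursion; \<open>coef_has_sum\<close> makes the connection.\<close>

fun coef :: "nat \<Rightarrow> int \<Rightarrow> real" where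
  "coef 0 k = 0"
| "coef (Suc 0) k = (if k = 0 then 1 else 0)"
| "coef (Suc (Suc n)) k = \<mu> n * (coef (Suc n) (k - 1) + coef (Suc n) (k + 1)) + \<sigma> n * coef n k"

abbreviation Q where "Q n \<equiv> H n 2"

text \<open>The three components represent \<open>H n\<close>, \<open>H (n + 1)\<close> and \<open>H (n + 1) - w H n\<close>; the third
  makes the recurrence free of subtractions when \<open>\<sigma> n = -1\<close>.\<close>
primrec mixes :: "nat \<Rightarrow> mixture \<times> mixture \<times> mixture" where
  "mixes 0 = ([], [(1, 0, 0)], [(1, 0, 0)])"
| "mixes (Suc n) = (case mixes n of (h0, h1, d1) \<Rightarrow>
     if \<sigma> n = 1 then (h1, scale (\<mu> n) (mark h1) @ h0,
                     scale (\<mu> n - 1) (mark h1) @ shift (- 1) h1 @ h0)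
     else (h1, (scale (\<mu> n - 1) (mark h1) @ shift (- 1) d1) @ shift 1 h1,
           scale (\<mu> n - 1) (mark h1) @ shift (- 1) d1))"

definition hmix where "hmix n = fst (mixes n)"
definition dmix where "dmix n = snd (snd (mixes n))"

lemma hmix_Suc_eq: "fst (snd (mixes n)) = hmix (Suc n)"
  by (auto simp: hmix_def split: prod.splits)

lemma hmix_simps:
  "hmix 0 = []" "hmix (Suc 0) = [(1, 0, 0)]"
  "hmix (Suc (Suc n)) = (if \<sigma> n = 1 then scale (\<mu> n) (mark (hmix (Suc n))) @ hmix n
     else dmix (Suc n) @ shift 1 (hmix (Suc n)))"
  subgoal by (simp add: hmix_def)
  subgoal by (simp add: hmix_def)
  subgoal by (subst hmix_Suc_eq [symmetric], simp only: dmix_def)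
    (auto simp: hmix_def split: prod.splits)
  done

lemma dmix_simps:
  "dmix 0 = [(1, 0, 0)]"
  "dmix (Suc n) = (if \<sigma> n = 1
     then scale (\<mu> n - 1) (mark (hmix (Suc n))) @ shift (- 1) (hmix (Suc n)) @ hmix n
     else scale (\<mu> n - 1) (mark (hmix (Suc n))) @ shift (- 1) (dmix n))"
  by (auto simp: dmix_def hmix_def split: prod.splits)

text \<open>For \<open>\<sigma> n = -1\<close> the subtraction is hidden in
  \<open>(H (n+1) - w H n) / w = H (n+1) / w - H n\<close>: adding
  \<open>(\<mu> n - 1) (w + 1/w) H (n+1)\<close> and \<open>w H (n+1)\<close> to it gives
  \<open>H (n+2)\<close>.\<close>

lemma mix_coeff_mixes:
  "mix_coeff (hmix n) k = coef n k \<and> mix_coeff (hmix (Suc n)) k = coef (Suc n) k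
   \<and> mix_coeff (dmix n) k = coef (Suc n) k - coef n (k - 1)"
proof (induction n arbitrary: k)
  case 0
  then show ?case by (simp add: hmix_simps dmix_simps) (simp add: mix_coeff_def)
next
  case (Suc n)
  have d: "mix_coeff (dmix n) k = coef (Suc n) k - coef n (k - 1)" for k using Suc by simp
  show ?case using sigma[of n] Suc d[of "k + 1"]
    by (auto simp: hmix_simps(3) dmix_simps) (auto simp: algebra_simps)
qed

lemma mix_weight_2:
  "mix_weight (hmix n) 2 = Q n \<and> mix_weight (hmix (Suc n)) 2 = Q (Suc n)
   \<and> mix_weight (dmix n) 2 = Q (Suc n) - Q n"
proof (induction n)
  case 0
  then show ?case by (simp add: hmix_simps dmix_simps) (simp add: mix_weight_def)
next
  case (Suc n)
  then show ?case using sigma[of n]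
    by (auto simp: hmix_simps(3) dmix_simps algebra_simps)
qed

lemma mix_ok_mixes: "mix_ok n (hmix n) \<and> mix_ok n (hmix (Suc n)) \<and> mix_ok n (dmix n)"
proof (induction n)
  case 0
  then show ?case by (simp add: hmix_simps dmix_simps) (simp add: mix_ok_def)
next
  case (Suc n)
  then show ?case using mu_ge[of n]
    by (auto simp: hmix_simps(3) dmix_simps intro!: mix_ok_scale intro: mix_ok_mono)
qed

text \<open>The recurrence does not show this when \<open>\<sigma> n = -1\<close>; the mixtures
  do.\<close>

lemma coef_nonneg: "0 \<le> coef n k"
  using mix_coeff_nonneg mix_ok_mixes mix_coeff_mixes by metis

text \<open>\<open>w + 1/w\<close> is invariant under exchanging \<open>w\<close> and
  \<open>1/w\<close>.\<close>

lemma coef_minus: "coef n (- k) = coef n k"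
proof (induction n k rule: coef.induct)
  case (3 n k)
  have e: "- k - 1 = - (k + 1)" "- k + 1 = - (k - 1)" by simp_all
  show ?case unfolding coef.simps e "3.IH" by (simp add: algebra_simps)
qed auto

text \<open>As \<open>\<mu> n * x \<ge> 2\<close>, even the worst case
  \<open>\<sigma> n = -1\<close> gives \<open>H (n+2) - H (n+1) \<ge> H (n+1) - H n\<close>.\<close>

lemma H_mono:
  assumes "2 \<le> x" shows "0 \<le> H n x \<and> H n x \<le> H (Suc n) x \<and> 1 \<le> H (Suc n) x"
proof (induction n)
  case (Suc n)
  have "H (Suc n) x + H (Suc n) x \<le> \<mu> n * x * H (Suc n) x"
    using Suc mu_ge[of n] assms mult_mono[of 1 "\<mu> n" 2 x] mult_right_mono[of 2 "\<mu> n * x" "H (Suc n) x"] by simp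
  then have "H (Suc n) x \<le> H (Suc (Suc n)) x" 
    using Suc sigma[of n] unfolding H.simps(3) by (elim disjE; simp only: mult_1 mult_minus_left; linarith)
  then show ?case using Suc by linarith
qed auto

lemma Q_mono: "i \<le> j \<Longrightarrow> Q i \<le> Q j"
  by (rule lift_Suc_mono_le[of Q]) (use H_mono[of 2] in auto)

lemma Q_pos: "0 < Q (Suc n)" and Q_nonneg: "0 \<le> Q n"
  using H_mono[of 2 n] by auto

lemma B_ge: "1 \<le> B" using mu_ge[of 0] mu_le[of 0] by linarith

lemma Q_Suc_le: "Q (Suc n) \<le> (2 * B + 1) * Q n" if "0 < n"
proof (cases n)
  case (Suc i)
  have "\<mu> i * Q (Suc i) \<le> B * Q (Suc i)" using mu_le H_mono[of 2] by (intro mult_right_mono) auto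
  moreover have "\<sigma> i * Q i \<le> Q (Suc i)" using sigma[of i] H_mono[of 2 i] by auto
  ultimately show ?thesis unfolding Suc H.simps(3) by (simp only: algebra_simps)
qed (use that in auto)

section \<open>Exponential decay of the weights at 1 relative to the weights at 2\<close>

definition u where "u n = mix_weight (hmix n) 1"
definition v where "v n = mix_weight (dmix n) 1"

lemma u_v_rec:
  "\<sigma> n = 1 \<Longrightarrow> u (Suc (Suc n)) = \<mu> n * u (Suc n) + u n"
  "\<sigma> n = 1 \<Longrightarrow> v (Suc n) = \<mu> n * u (Suc n) + u n"
  "\<sigma> n = -1 \<Longrightarrow> u (Suc (Suc n)) = \<mu> n * u (Suc n) + v n"
  "\<sigma> n = -1 \<Longrightarrow> v (Suc n) = (\<mu> n - 1) * u (Suc n) + v n"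
  by (auto simp: u_def v_def hmix_simps(3) dmix_simps algebra_simps)

text \<open>Counting each factor \<open>w + 1/w\<close> as 1 (in \<open>u\<close> and \<open>v\<close>) instead of 2 (in \<open>Q\<close>) loses an exponential
  factor; this is what bounds the weight of the products with few such factors.\<close>
definition bounded_ratio :: "real \<Rightarrow> nat \<Rightarrow> bool" where
  "bounded_ratio r n \<longleftrightarrow> u n \<le> r * Q n \<and> u (Suc n) \<le> r * Q (Suc n) \<and> v n \<le> r * (Q (Suc n) - Q n)"

text \<open>A lower bound for \<open>Q n / Q (Suc n)\<close> with \<open>n > 0\<close>: the share of
  a relative gain that survives one step.\<close>

definition q where "q = 1 / (2 * B + 1)"

lemma q_bounds: "0 < q" "q \<le> 1/3"
  using B_ge by (auto simp: q_def field_simps)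

lemma q_Q_le: "q * Q (Suc (Suc n)) \<le> Q (Suc n)"
  using Q_Suc_le[of "Suc n"] B_ge by (simp add: q_def field_simps)

text \<open>A relative gain \<open>\<kappa>\<close> at \<open>n + 1\<close> is worth at least
  \<open>\<kappa> r Q (n+1)\<close>, hence at least \<open>\<kappa> q r Q (n+2)\<close> at the next
  index.\<close>

lemma u_step:
  assumes b: "bounded_ratio r n" and r: "0 \<le> r" and k: "0 \<le> \<kappa>" "\<kappa> \<le> 1"
    and u: "u (Suc n) \<le> (1 - \<kappa>) * r * Q (Suc n)"
  shows "u (Suc (Suc n)) \<le> (1 - \<kappa> * q) * r * Q (Suc (Suc n))"
proof -
  note Q = Q_pos[of n] Q_nonneg[of n] Q_mono[of n "Suc n"] and m = mu_ge[of n]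
  have 1: "\<mu> n * u (Suc n) \<le> \<mu> n * ((1 - \<kappa>) * r * Q (Suc n))"
    using m u by (intro mult_left_mono) auto
  have 2: "\<kappa> * r * (q * Q (Suc (Suc n))) \<le> \<kappa> * r * Q (Suc n)"
    using q_Q_le k r by (intro mult_left_mono) auto
  have 3: "0 \<le> r * Q (Suc n) * (\<mu> n - \<kappa> + \<kappa> * \<mu> n)" "0 \<le> r * Q (Suc n) * ((\<mu> n - 1) * (1 + \<kappa>))"
    using m k r Q by (auto intro!: mult_nonneg_nonneg add_nonneg_nonneg)
  have Q2: "r * Q (Suc (Suc n)) = 2 * (r * \<mu> n * Q (Suc n)) + \<sigma> n * (r * Q n)"
    by (simp add: algebra_simps)
  have goal: "(1 - \<kappa> * q) * r * Q (Suc (Suc n)) = r * Q (Suc (Suc n)) - \<kappa> * r * (q * Q (Suc (Suc n)))"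
    by (simp only: algebra_simps)
  from sigma[of n] show ?thesis
  proof
    assume s: "\<sigma> n = 1"
    show ?thesis using 1 2 3 b unfolding goal Q2 u_v_rec(1)[OF s] bounded_ratio_def s
      by (simp add: algebra_simps)
  next
    assume s: "\<sigma> n = -1"
    show ?thesis using 1 2 3 b unfolding goal Q2 u_v_rec(3)[OF s] bounded_ratio_def s
      by (simp add: algebra_simps)
  qed
qed

text \<open>When \<open>\<sigma> n = -1\<close>, \<open>u\<close> enters \<open>v\<close> with the
  factor \<open>\<mu> n - 1\<close>, which may vanish. So at a slow step \<open>v\<close> can only
  pass on a gain of its own; at a good step the gain of \<open>u\<close> suffices.\<close>

lemma v_step:
  assumes b: "bounded_ratio r n" and r: "0 \<le> r" and k: "0 \<le> \<kappa>" "\<kappa> \<le> 1"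
    and u: "u (Suc n) \<le> (1 - \<kappa>) * r * Q (Suc n)"
    and good: "2 \<le> \<mu> n \<or> \<sigma> n = 1 \<or> v n \<le> (1 - \<kappa>) * r * (Q (Suc n) - Q n)"
  shows "v (Suc n) \<le> (1 - \<kappa> * q) * r * (Q (Suc (Suc n)) - Q (Suc n))"
proof -
  note Q = Q_pos[of n] Q_nonneg[of n] Q_mono[of n "Suc n"] and m = mu_ge[of n]
  have 1: "\<mu> n * u (Suc n) \<le> \<mu> n * ((1 - \<kappa>) * r * Q (Suc n))"
    "(\<mu> n - 1) * u (Suc n) \<le> (\<mu> n - 1) * ((1 - \<kappa>) * r * Q (Suc n))"
    using m u by (auto intro!: mult_left_mono)
  have 2: "\<kappa> * r * (q * Q (Suc (Suc n))) \<le> \<kappa> * r * Q (Suc n)"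
    "0 \<le> \<kappa> * r * (q * Q (Suc n))"
    using q_Q_le k r q_bounds(1) Q by (auto intro!: mult_left_mono mult_nonneg_nonneg)
  have Q2: "r * Q (Suc (Suc n)) = 2 * (r * \<mu> n * Q (Suc n)) + \<sigma> n * (r * Q n)"
    by (simp add: algebra_simps)
  have goal: "(1 - \<kappa> * q) * r * (Q (Suc (Suc n)) - Q (Suc n))
      = r * Q (Suc (Suc n)) - \<kappa> * r * (q * Q (Suc (Suc n))) - r * Q (Suc n) + \<kappa> * r * (q * Q (Suc n))"
    by (simp only: algebra_simps)
  consider (p) "\<sigma> n = 1" | (m) "\<sigma> n = -1" "2 \<le> \<mu> n"
    | (v) "\<sigma> n = -1" "v n \<le> (1 - \<kappa>) * r * (Q (Suc n) - Q n)"
    using sigma[of n] good by fastforce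
  then show ?thesis
  proof cases
    case p
    have "0 \<le> r * Q (Suc n) * ((\<mu> n - 1) * (1 + \<kappa>))"
      using m k r Q by (auto intro!: mult_nonneg_nonneg add_nonneg_nonneg)
    then show ?thesis using 1 2 b unfolding goal Q2 u_v_rec(2)[OF p] bounded_ratio_def p
      by (simp add: algebra_simps)
  next
    case m
    have "0 \<le> r * Q (Suc n) * (\<mu> n - 1 - \<kappa> + \<kappa> * (\<mu> n - 1))"
      using m k r Q by (auto intro!: mult_nonneg_nonneg add_nonneg_nonneg)
    then show ?thesis using 1 2 b unfolding goal Q2 u_v_rec(4)[OF m(1)] bounded_ratio_def m(1)
      by (simp add: algebra_simps)
  next
    case v
    have "Q (Suc (Suc n)) - Q (Suc n) = 2 * (\<mu> n - 1) * Q (Suc n) + (Q (Suc n) - Q n)"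
      using v(1) by (simp add: algebra_simps)
    have e: "(1 - \<kappa>) * r * (Q (Suc (Suc n)) - Q (Suc n))
      = 2 * ((\<mu> n - 1) * ((1 - \<kappa>) * r * Q (Suc n))) + (1 - \<kappa>) * r * (Q (Suc n) - Q n)"
      unfolding \<open>Q (Suc (Suc n)) - Q (Suc n) = _\<close> by (simp add: algebra_simps)
    have "0 \<le> (\<mu> n - 1) * ((1 - \<kappa>) * r * Q (Suc n))"
      using m k r Q by (auto intro!: mult_nonneg_nonneg)
    then have "v (Suc n) \<le> (1 - \<kappa>) * r * (Q (Suc (Suc n)) - Q (Suc n))"
      using e 1 v unfolding u_v_rec(4)[OF v(1)] by linarith
    also have "\<dots> \<le> (1 - \<kappa> * q) * r * (Q (Suc (Suc n)) - Q (Suc n))"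
      using k r q_bounds Q_mono[of "Suc n" "Suc (Suc n)"] mult_left_le[of q \<kappa>]
      by (intro mult_right_mono) auto
    finally show ?thesis .
  qed
qed

text \<open>At a good step the factor \<open>w + 1/w\<close>, counted once instead of twice, creates
  a gain without any previous one. The share 1/4 is what \<open>\<mu> n = 2\<close> and
  \<open>\<sigma> n = -1\<close> guarantee.\<close>

lemma u_good:
  assumes b: "bounded_ratio r n" and r: "0 \<le> r" and good: "2 \<le> \<mu> n \<or> \<sigma> n = 1"
  shows "u (Suc (Suc n)) \<le> (1 - 1/4) * r * Q (Suc (Suc n))"
proof -
  note Q = Q_pos[of n] Q_nonneg[of n] Q_mono[of n "Suc n"] and m = mu_ge[of n]
  have 1: "\<mu> n * u (Suc n) \<le> \<mu> n * (r * Q (Suc n))"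
    using m b by (intro mult_left_mono) (auto simp: bounded_ratio_def)
  have Q2: "(1 - 1/4) * r * Q (Suc (Suc n)) = 3/2 * (r * \<mu> n * Q (Suc n)) + 3/4 * \<sigma> n * (r * Q n)"
    by (simp add: algebra_simps)
  consider (p) "\<sigma> n = 1" | (m) "\<sigma> n = -1" "2 \<le> \<mu> n"
    using sigma[of n] good by fastforce
  then show ?thesis
  proof cases
    case p
    have "0 \<le> r * (2 * (\<mu> n - 1) * Q (Suc n) + 1 * (Q (Suc n) - Q n) + Q (Suc n))"
      using m r Q by (intro mult_nonneg_nonneg add_nonneg_nonneg) auto
    then show ?thesis using 1 b unfolding Q2 u_v_rec(1)[OF p] bounded_ratio_def p
      by (simp add: algebra_simps)
  next
    case m
    have "0 \<le> r * (2 * (\<mu> n - 2) * Q (Suc n) + Q n)"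
      using m r Q by (intro mult_nonneg_nonneg add_nonneg_nonneg) auto
    then show ?thesis using 1 b unfolding Q2 u_v_rec(3)[OF m(1)] bounded_ratio_def m(1)
      by (simp add: algebra_simps)
  qed
qed

lemma u_le_Q: "u n \<le> Q n" "v n \<le> Q (Suc n) - Q n"
proof -
  have *: "mix_weight xs 1 \<le> mix_weight xs 2" if "mix_ok n xs" for xs
    using that
  proof (induction xs)
    case (Cons x xs)
    obtain c j l where x: "x = (c, j, l)" by (cases x) auto
    have "c * 1 ^ j \<le> c * 2 ^ j" using Cons.prems
      by (intro mult_left_mono power_mono) (auto simp: x mix_ok_def)
    then show ?case using Cons by (auto simp: x mix_ok_def mix_weight_def)
  qed (simp add: mix_weight_def)
  show "u n \<le> Q n" "v n \<le> Q (Suc n) - Q n"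
    using *[of "hmix n"] *[of "dmix n"] mix_ok_mixes[of n] mix_weight_2[of n] by (auto simp: u_def v_def)
qed

lemma bounded_ratio_1: "bounded_ratio 1 n"
  using u_le_Q by (auto simp: bounded_ratio_def)

text \<open>The case \<open>\<kappa> = 0\<close> of the two step lemmas.\<close>

lemma bounded_ratio_Suc:
  assumes "bounded_ratio r n" "0 \<le> r" shows "bounded_ratio r (Suc n)"
  using u_step[OF assms, of 0] v_step[OF assms, of 0] assms by (auto simp: bounded_ratio_def)

lemma bounded_ratio_add:
  assumes "bounded_ratio r n" "0 \<le> r" shows "bounded_ratio r (n + i)"
  using assms by (induction i) (auto intro: bounded_ratio_Suc)

text \<open>The gain 1/4 of a good step after \<open>i\<close> further losses of the factor
  \<open>q\<close>.\<close>

definition kap where "kap i = q ^ i / 4"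

lemma kap: "0 < kap i" "kap i \<le> 1/4" "kap (Suc i) = kap i * q"
  using q_bounds power_le_one[of q i] by (auto simp: kap_def)

lemma kap_antimono: "i \<le> j \<Longrightarrow> kap j \<le> kap i"
  using q_bounds by (auto simp: kap_def intro!: power_decreasing)

text \<open>A good step in the first window gives \<open>u\<close> a gain, which later steps
  preserve up to \<open>q\<close>. A good step in the second window then transfers it to
  \<open>v\<close>. Afterwards all three ratios are improved together.\<close>

lemma contraction:
  assumes b: "bounded_ratio r n" and r: "0 \<le> r"
  shows "bounded_ratio ((1 - kap (2 * K + 3)) * r) (n + 2 * K + 3)"
proof -
  note bi = bounded_ratio_add[OF b r]
  obtain i0 where i0: "i0 < K" "2 \<le> \<mu> (n + i0) \<or> \<sigma> (n + i0) = 1"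
    using window[of n] by blast
  have U: "u (Suc (n + i)) \<le> (1 - kap i) * r * Q (Suc (n + i))" if "Suc i0 \<le> i" for i
    using that
  proof (induction i rule: dec_induct)
    case base
    have "(1 - 1/4) * (r * Q (Suc (Suc (n + i0)))) \<le> (1 - kap (Suc i0)) * (r * Q (Suc (Suc (n + i0))))"
      using kap(2)[of "Suc i0"] r Q_pos by (intro mult_right_mono) (auto intro!: mult_nonneg_nonneg less_imp_le[OF Q_pos] simp del: H.simps)
    then show ?case using u_good[OF bi[of i0] r i0(2)] by (simp add: mult.assoc del: H.simps)
  next
    case (step i)
    show ?case using u_step[OF bi[of i] r _ _ step.IH] kap(1,2)[of i] kap(3)[of i]
      by (simp del: H.simps)
  qed
  \<comment> \<open>This window starts at \<open>n + K\<close>, when \<open>u\<close> already has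
    the gain that \<open>v_step\<close> requires.\<close>
  obtain i1 where i1: "i1 < K" "2 \<le> \<mu> (n + K + i1) \<or> \<sigma> (n + K + i1) = 1"
    using window[of "n + K"] by blast
  have V: "v (n + i) \<le> (1 - kap i) * r * (Q (Suc (n + i)) - Q (n + i))" if "Suc (K + i1) \<le> i" for i
    using that
  proof (induction i rule: dec_induct)
    case base
    have "2 \<le> \<mu> (n + (K + i1)) \<or> \<sigma> (n + (K + i1)) = 1
        \<or> v (n + (K + i1)) \<le> (1 - kap (K + i1)) * r * (Q (Suc (n + (K + i1))) - Q (n + (K + i1)))"
      using i1(2) by (auto simp: add.assoc)
    from v_step[OF bi[of "K + i1"] r _ _ U[of "K + i1"] this]
    show ?case using i1 i0 kap(1,2)[of "K + i1"] kap(3)[of "K + i1"]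
      by (simp add: add.assoc del: H.simps)
  next
    case (step i)
    show ?case using v_step[OF bi[of i] r _ _ U[of i]] step i0 kap(1,2)[of i] kap(3)[of i]
      by (simp del: H.simps)
  qed
  have 1: "(1 - kap (2 * K + 2)) * r * Q (n + 2 * K + 3) \<le> (1 - kap (2 * K + 3)) * r * Q (n + 2 * K + 3)"
    using r kap_antimono[of "2 * K + 2" "2 * K + 3"] Q_nonneg by (intro mult_right_mono) auto
  show ?thesis unfolding bounded_ratio_def
    using U[of "2 * K + 3"] U[of "2 * K + 2"] V[of "2 * K + 3"] i0 i1 1
    by (simp add: add_ac numeral_eq_Suc del: H.simps)
qed

text \<open>The contraction over \<open>L\<close> steps is turned into a rate per step by an
  \<open>L\<close>-th root; the constant \<open>1 / k\<close> pays for an incomplete last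
  block.\<close>

lemma u_decay: "\<exists>\<rho>. 0 < \<rho> \<and> \<rho> < 1 \<and> (\<exists>C>0. \<forall>n. u n \<le> C * \<rho> ^ n * Q n)"
proof -
  define L where "L = 2 * K + 3"
  define k where "k = 1 - kap L"
  define \<rho> where "\<rho> = root L k"
  have k: "0 < k" "k < 1" using kap[of L] by (auto simp: k_def)
  have L: "0 < L" by (simp add: L_def)
  have rho: "0 < \<rho>" "\<rho> < 1" "\<rho> ^ L = k"
    using k L by (auto simp: \<rho>_def)
  have it: "bounded_ratio (k ^ i) (L * i)" for i
  proof (induction i)
    case (Suc i)
    then show ?case using contraction[OF Suc] k by (simp add: k_def L_def algebra_simps)
  qed (use bounded_ratio_1 in auto)
  have "u n \<le> (1 / k) * \<rho> ^ n * Q n" for n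
  proof -
    define i where "i = n div L"
    have "bounded_ratio (k ^ i) n"
      using bounded_ratio_add[OF it[of i], of "n mod L"] k by (simp add: i_def)
    then have "u n \<le> k ^ i * Q n" by (simp add: bounded_ratio_def)
    also have "k ^ i = \<rho> ^ (L * i + L) / k" using k by (simp add: power_add power_mult rho)
    also have "\<dots> \<le> \<rho> ^ n / k"
    proof -
      have "n = L * i + n mod L" by (simp add: i_def)
      then have "n \<le> L * i + L" using mod_less_divisor[OF L, of n] by linarith
      then show ?thesis using rho k by (intro divide_right_mono power_decreasing) auto
    qed
    finally show ?thesis using Q_nonneg by (simp add: mult_right_mono)
  qed
  then show ?thesis using rho k by (intro exI[of _ \<rho>] conjI exI[of _ "1 / k"]) auto
qed

section \<open>Neighbouring coefficients are almost equal\<close>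

lemma coef_flat_right:
  assumes e: "0 < \<epsilon>" "\<epsilon> < 1"
  shows "\<exists>\<theta>. 0 < \<theta> \<and> \<theta> < 1 \<and> (\<exists>C>0. \<forall>n k. (1 - \<epsilon>) * coef n k \<le> coef n (k + 2) + C * \<theta> ^ n * Q n)"
proof -
  obtain \<rho> C where rho: "0 < \<rho>" "\<rho> < 1" and C: "0 < C" "\<And>n. u n \<le> C * \<rho> ^ n * Q n"
    using u_decay by blast
  \<comment> \<open>Chosen so that \<open>2 powr \<delta>\<close>, the price of the products with
    few factors in \<open>mix_coeff_flat\<close>, stays below \<open>1 / \<rho>\<close> and is
    beaten by the decay of \<open>u\<close>.\<close>
  define \<delta> where "\<delta> = min 1 (log 2 (1 / \<rho>) / 2)"
  have l: "0 < log 2 (1 / \<rho>)" using rho by simp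
  then have d: "0 < \<delta>" "\<delta> \<le> 1" by (auto simp: \<delta>_def)
  define a where "a = 2 powr \<delta> * \<rho>"
  have "2 powr \<delta> < 2 powr (log 2 (1 / \<rho>))" using l by (intro powr_less_mono) (auto simp: \<delta>_def)
  also have "\<dots> = 1 / \<rho>" using rho by simp
  finally have a: "0 < a" "a < 1" using rho by (auto simp: a_def field_simps)
  define b where "b = exp (- (\<epsilon> * \<delta> / 4)\<^sup>2 / 8)"
  have b: "0 < b" "b < 1" using e d by (auto simp: b_def)
  define \<theta> where "\<theta> = max a b"
  have t: "0 < \<theta>" "\<theta> < 1" using a b by (auto simp: \<theta>_def)
  define N where "N = nat \<lceil>4 / (\<epsilon> * \<delta>)\<rceil>"
  \<comment> \<open>The last summand serves the indices below \<open>N\<close>, where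
    \<open>mix_coeff_flat\<close> does not apply: it makes \<open>D * \<theta> ^ n \<ge> 1\<close>,
    and \<open>coef n k \<le> Q n\<close> is enough.\<close>
  define D where "D = C + 1 + (2 * B + 1) ^ N / \<theta> ^ N"
  have D: "0 < D" using C t B_ge by (auto simp: D_def add_pos_nonneg)
  have coefQ: "coef n k \<le> Q n" for n k
  proof -
    have "c * bico j i \<le> c * 2 ^ j" if "0 \<le> c" for c j i
      using that bico_le by (intro mult_left_mono)
    then have "mix_coeff xs k \<le> mix_weight xs 2" if "mix_ok n xs" for xs
      using that unfolding mix_coeff_def mix_weight_def
      by (intro sum_list_mono) (auto simp: mix_ok_def)
    then show ?thesis using mix_ok_mixes[of n] mix_coeff_mixes[of n k] mix_weight_2[of n] by metis
  qed
  have "(1 - \<epsilon>) * coef n k \<le> coef n (k + 2) + D * \<theta> ^ n * Q n" for n k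
  proof (cases "N \<le> n")
    case True
    have "4 / (\<epsilon> * \<delta>) \<le> real n" using True by (simp add: N_def)
    then have "4 \<le> \<epsilon> * \<delta> * n" using e d by (simp add: field_simps)
    from mix_coeff_flat[OF _ _ d, of \<epsilon> n "hmix n" k] this e
    have "(1 - \<epsilon>) * coef n k \<le> coef n (k + 2) + (2 powr \<delta>) ^ n * u n + b ^ n * Q n"
      using mix_ok_mixes[of n] mix_coeff_mixes[of n] mix_weight_2[of n] by (simp add: u_def b_def)
    also have "(2 powr \<delta>) ^ n * u n \<le> (2 powr \<delta>) ^ n * (C * \<rho> ^ n * Q n)"
      using C by (intro mult_left_mono) auto
    also have "\<dots> = C * Q n * a ^ n" by (simp add: a_def power_mult_distrib)
    also have "\<dots> \<le> C * Q n * \<theta> ^ n"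
      using C Q_nonneg[of n] a by (intro mult_left_mono power_mono) (auto simp: \<theta>_def)
    also have "b ^ n * Q n \<le> \<theta> ^ n * Q n"
      using Q_nonneg[of n] b by (intro mult_right_mono power_mono) (auto simp: \<theta>_def)
    also have "coef n (k + 2) + C * Q n * \<theta> ^ n + \<theta> ^ n * Q n = coef n (k + 2) + (C + 1) * \<theta> ^ n * Q n"
      by (simp add: algebra_simps)
    also have "\<dots> \<le> coef n (k + 2) + D * \<theta> ^ n * Q n"
      using t Q_nonneg[of n] B_ge by (intro add_left_mono mult_right_mono) (auto simp: D_def)
    finally show ?thesis by simp
  next
    case False
    have "1 \<le> D * \<theta> ^ n"
    proof -
      have "1 \<le> (2 * B + 1) ^ N" using B_ge by (intro one_le_power) auto
      also have "\<dots> = (2 * B + 1) ^ N / \<theta> ^ N * \<theta> ^ N" using t by simp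
      also have "\<dots> \<le> D * \<theta> ^ N"
        using t C by (intro mult_right_mono) (auto simp: D_def)
      also have "\<dots> \<le> D * \<theta> ^ n" using False t D by (intro mult_left_mono power_decreasing) auto
      finally show ?thesis .
    qed
    have "(1 - \<epsilon>) * coef n k \<le> 1 * coef n k" using e coef_nonneg by (intro mult_right_mono) auto
    also have "\<dots> \<le> 1 * Q n" using coefQ by simp
    also have "\<dots> \<le> D * \<theta> ^ n * Q n" using \<open>1 \<le> D * \<theta> ^ n\<close> Q_nonneg by (intro mult_right_mono) auto
    finally show ?thesis using coef_nonneg[of n "k + 2"] by linarith
  qed
  then show ?thesis using t D by blast
qed

lemma coef_flat:
  assumes "0 < \<epsilon>" "\<epsilon> < 1"
  shows "\<exists>\<theta>. 0 < \<theta> \<and> \<theta> < 1 \<and> (\<exists>C>0. \<forall>n k. (1 - \<epsilon>) * coef n k \<le> coef n (k + 2) + C * \<theta> ^ n * Q n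
    \<and> (1 - \<epsilon>) * coef n k \<le> coef n (k - 2) + C * \<theta> ^ n * Q n)"
proof -
  obtain \<theta> C where *: "0 < \<theta>" "\<theta> < 1" "0 < C"
    "\<And>n k. (1 - \<epsilon>) * coef n k \<le> coef n (k + 2) + C * \<theta> ^ n * Q n"
    using coef_flat_right[OF assms] by blast
  have "(1 - \<epsilon>) * coef n k \<le> coef n (k - 2) + C * \<theta> ^ n * Q n" for n k
    using *(4)[of n "- k"] coef_minus[of n k] coef_minus[of n "k - 2"] by simp
  then show ?thesis using * by blast
qed

text \<open>A step with \<open>\<mu> n \<ge> 2\<close> or \<open>\<sigma> n = 1\<close> at least doubles \<open>Q\<close>; the other steps keep the
  increments of \<open>Q\<close> from decreasing.\<close>
lemma Q_growth: "\<exists>\<rho>>1. \<forall>n. \<rho> * Q n \<le> Q (Suc n)"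
proof -
  \<comment> \<open>The increment of \<open>Q\<close> relative to its new value; a good step makes
    it at least 1/2, any other step loses at most the factor \<open>q\<close>.\<close>
  define g where "g n k \<longleftrightarrow> k * Q (Suc n) \<le> Q (Suc n) - Q n" for n and k :: real
  have mono: "g n k" if "g n k'" "k \<le> k'" for n k k'
  proof -
    have "k * Q (Suc n) \<le> k' * Q (Suc n)" using that Q_pos[of n] by (intro mult_right_mono) auto
    then show ?thesis using that by (simp add: g_def del: H.simps)
  qed
  have good: "g (Suc n) (1/2)" if "2 \<le> \<mu> n \<or> \<sigma> n = 1" for n
  proof -
    note Q = Q_pos[of n] Q_nonneg[of n] Q_mono[of n "Suc n"]
    have "1 * Q (Suc n) \<le> \<mu> n * Q (Suc n)" using mu_ge Q by (intro mult_right_mono) auto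
    moreover have "2 * Q (Suc n) \<le> \<mu> n * Q (Suc n)" if "2 \<le> \<mu> n" using that Q by (intro mult_right_mono) auto
    moreover have "Q (Suc (Suc n)) = 2 * (\<mu> n * Q (Suc n)) + \<sigma> n * Q n" by simp
    moreover have "\<sigma> n = 1 \<or> \<sigma> n = -1 \<and> 2 \<le> \<mu> n" using sigma that by blast
    ultimately have "2 * Q (Suc n) \<le> Q (Suc (Suc n))" using Q by (elim disjE conjE; simp only: mult_1 mult_minus_left; linarith)
    then show ?thesis by (simp add: g_def)
  qed
  have step: "g (Suc n) (k * q)" if "g n k" "0 \<le> k" "k \<le> 1/2" for n k
  proof (cases "2 \<le> \<mu> n \<or> \<sigma> n = 1")
    case True
    have "k * q \<le> k * 1" using q_bounds that by (intro mult_left_mono) auto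
    then show ?thesis using mono[OF good[OF True], of "k * q"] that by simp
  next
    case False
    then have s: "\<sigma> n = -1" using sigma by auto
    note Q = Q_pos[of n] Q_nonneg[of n] Q_mono[of n "Suc n"]
    have "k * (q * Q (Suc (Suc n))) \<le> k * Q (Suc n)" using q_Q_le that by (intro mult_left_mono)
    also have "\<dots> \<le> Q (Suc n) - Q n" using that by (simp add: g_def)
    also have "\<dots> \<le> Q (Suc (Suc n)) - Q (Suc n)"
      using mult_right_mono[OF mu_ge[of n], of "Q (Suc n)"] Q s by simp
    finally show ?thesis by (simp add: g_def mult.assoc del: H.simps)
  qed
  have steps: "g (n + i) (1/2 * q ^ i)" if "g n (1/2)" for n i
  proof (induction i)
    case (Suc i)
    show ?case using step[OF Suc] q_bounds power_le_one[of q i] by (simp add: mult_ac)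
  qed (use that in simp)
  define k where "k = 1/2 * q ^ K"
  have k: "0 < k" "k \<le> 1/2" using q_bounds power_le_one[of q K] by (auto simp: k_def)
  have km: "k \<le> 1/2 * q ^ i" if "i \<le> K" for i
    using q_bounds that by (auto simp: k_def intro!: power_decreasing)
  have all: "g n k" for n
  proof (cases "n \<le> K")
    case True
    \<comment> \<open>Index 0 acts like a good step because \<open>Q 0 = 0\<close>.\<close>
    have "g 0 (1/2)" by (simp add: g_def)
    from steps[OF this, of n] show ?thesis using mono km True by auto
  next
    case False
    \<comment> \<open>The window is placed so that a good step produces a relative increment at most
      \<open>K\<close> steps before \<open>n\<close>.\<close>
    obtain i where i: "i < K" "2 \<le> \<mu> (n - Suc K + i) \<or> \<sigma> (n - Suc K + i) = 1"
      using window by blast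
    have "n = Suc (n - Suc K + i) + (K - i)" using i False by auto
    with steps[OF good[OF i(2)], of "K - i"] show ?thesis using mono km[of "K - i"] by auto
  qed
  have "(1 + k) * Q n \<le> Q (Suc n)" for n
  proof -
    have "k * Q n \<le> k * Q (Suc n)" using k Q_mono[of n "Suc n"] by (intro mult_left_mono) auto
    then show ?thesis using all[of n] by (simp add: g_def algebra_simps)
  qed
  then show ?thesis using k by (intro exI[of _ "1 + k"]) auto
qed

section \<open>Chernoff bounds for the coefficients\<close>

lemma H_le_exp: "\<exists>C>0. \<forall>n x. 2 \<le> x \<longrightarrow> H n x \<le> exp (C * (x - 2) * real n) * Q n"
proof -
  obtain \<rho> where rho: "1 < \<rho>" "\<And>n. \<rho> * Q n \<le> Q (Suc n)" using Q_growth by blast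
  \<comment> \<open>The solution of \<open>C = B + C / \<rho>\<close>, so that the bound
    \<open>C * (x - 2)\<close> below reproduces itself.\<close>
  define C where "C = B * \<rho> / (\<rho> - 1)"
  have C: "0 < C" using rho B_ge by (simp add: C_def)
  have CB: "B + C / \<rho> = C" using rho by (simp add: C_def field_simps)
  \<comment> \<open>Ratios of consecutive values follow
    \<open>r \<mapsto> \<mu> n * x + \<sigma> n / r\<close>. The ratios \<open>r\<close> at
    \<open>x\<close> and \<open>s\<close> at 2 approach each other by the factor
    \<open>1 / (r * s) \<le> 1 / \<rho>\<close>, up to a new error of at most
    \<open>B * (x - 2)\<close>.\<close>
  have R: "\<bar>H (Suc (Suc n)) x / H (Suc n) x - Q (Suc (Suc n)) / Q (Suc n)\<bar> \<le> C * (x - 2)"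
    if x: "2 \<le> x" for n x
  proof (induction n)
    case 0
    have "\<mu> 0 * (x - 2) \<le> C * (x - 2)"
    proof (intro mult_right_mono)
      have "0 < C / \<rho>" using C rho by simp
      then show "\<mu> 0 \<le> C" using mu_le[of 0] CB by linarith
    qed (use x in simp)
    then show ?case using x mu_ge[of 0] by (simp add: algebra_simps abs_mult)
  next
    case (Suc n)
    define r s where "r = H (Suc (Suc n)) x / H (Suc n) x" and "s = Q (Suc (Suc n)) / Q (Suc n)"
    note p = H_mono[OF x, of n] H_mono[OF x, of "Suc n"] Q_pos[of n] Q_pos[of "Suc n"]
    have r: "1 \<le> r" using p by (simp add: r_def del: H.simps)
    have s: "\<rho> \<le> s" using rho(2)[of "Suc n"] p by (simp add: s_def field_simps del: H.simps)
    have s0: "0 < s" "0 < r" using s r rho by auto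
    have e: "H (Suc (Suc (Suc n))) x / H (Suc (Suc n)) x = \<mu> (Suc n) * x + \<sigma> (Suc n) / r"
      if "2 \<le> x" "r = H (Suc (Suc n)) x / H (Suc n) x" for x r :: real
      using H_mono[OF that(1), of n] H_mono[OF that(1), of "Suc n"] that(2)
      by (simp only: H.simps(3)[of "Suc n"]) (simp add: field_simps del: H.simps)
    have "H (Suc (Suc (Suc n))) x / H (Suc (Suc n)) x - Q (Suc (Suc (Suc n))) / Q (Suc (Suc n))
      = \<mu> (Suc n) * (x - 2) - \<sigma> (Suc n) * ((r - s) / (r * s))"
      unfolding e[OF x r_def] e[OF order_refl s_def] using s0 by (simp add: field_simps)
    also have "\<bar>\<dots>\<bar> \<le> \<bar>\<mu> (Suc n) * (x - 2)\<bar> + \<bar>\<sigma> (Suc n) * ((r - s) / (r * s))\<bar>"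
      by (rule abs_triangle_ineq4)
    also have "\<bar>\<mu> (Suc n) * (x - 2)\<bar> \<le> B * (x - 2)"
      using mu_ge[of "Suc n"] mu_le[of "Suc n"] x by (simp add: abs_mult mult_right_mono)
    also have "\<bar>\<sigma> (Suc n) * ((r - s) / (r * s))\<bar> = \<bar>r - s\<bar> / (r * s)"
      using sigma[of "Suc n"] s0 by (auto simp: abs_mult)
    also have "\<dots> \<le> \<bar>r - s\<bar> / (1 * \<rho>)"
      using r s rho s0 by (intro divide_left_mono mult_mono) auto
    also have "\<dots> \<le> C * (x - 2) / \<rho>"
      using Suc rho by (simp add: r_def s_def divide_right_mono del: H.simps)
    also have "B * (x - 2) + C * (x - 2) / \<rho> = (B + C / \<rho>) * (x - 2)"
      by (simp add: field_simps)
    finally show ?case by (simp only: CB)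
  qed
  \<comment> \<open>The ratios are multiplied. Since the ratios of \<open>Q\<close> are at least 1,
    the additive error \<open>C * (x - 2)\<close> costs at most the factor
    \<open>1 + C * (x - 2)\<close> each time.\<close>
  have main: "H (Suc n) x \<le> exp (C * (x - 2) * real n) * Q (Suc n)" if x: "2 \<le> x" for n x
  proof (induction n)
    case (Suc n)
    note p = H_mono[OF x, of n] H_mono[OF x, of "Suc n"] Q_pos[of n] Q_pos[of "Suc n"] Q_mono[of "Suc n" "Suc (Suc n)"]
    define s where "s = Q (Suc (Suc n)) / Q (Suc n)"
    have s: "1 \<le> s" using p by (simp add: s_def del: H.simps)
    have "H (Suc (Suc n)) x / H (Suc n) x \<le> s + C * (x - 2)"
      using R[OF x, of n] by (simp only: s_def)
    also have "\<dots> \<le> s + s * (C * (x - 2))"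
      using s C x mult_right_mono[of 1 s "C * (x - 2)"] by simp
    also have "\<dots> = s * (1 + C * (x - 2))" by (simp add: algebra_simps)
    also have "\<dots> \<le> s * exp (C * (x - 2))"
      using s by (intro mult_left_mono) auto
    finally have "H (Suc (Suc n)) x \<le> s * exp (C * (x - 2)) * H (Suc n) x"
      using p by (simp add: field_simps del: H.simps)
    also have "\<dots> \<le> s * exp (C * (x - 2)) * (exp (C * (x - 2) * real n) * Q (Suc n))"
      using s Suc by (intro mult_left_mono) auto
    also have "\<dots> = exp (C * (x - 2) * real (Suc n)) * (s * Q (Suc n))"
      by (simp add: algebra_simps flip: exp_add)
    also have "s * Q (Suc n) = Q (Suc (Suc n))" using p by (simp add: s_def del: H.simps)
    finally show ?case .
  qed auto
  have "H n x \<le> exp (C * (x - 2) * real n) * Q n" if x: "2 \<le> x" for n x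
  proof (cases n)
    case (Suc i)
    have "exp (C * (x - 2) * real i) \<le> exp (C * (x - 2) * real n)"
      using C x by (auto simp: Suc intro!: mult_left_mono)
    then show ?thesis using main[OF x, of i] Q_pos[of i] Suc
      by (meson less_imp_le mult_right_mono order_trans)
  qed auto
  then show ?thesis using C by blast
qed

text \<open>Summing over all integers avoids tracking the finite support and turns the index shifts
  of the recurrence into reindexing by bijections.\<close>

lemma coef_has_sum:
  assumes "0 < w"
  shows "((\<lambda>k. coef n k * w powi k) has_sum H n (w + 1 / w)) UNIV"
proof (induction n rule: induct_nat_012)
  case 1
  have "((\<lambda>k::int. if k = 0 then 1 else 0 :: real) has_sum 1) UNIV"
    by (rule has_sum_finite_neutralI[of "{0}"]) auto
  then show ?case by (subst has_sum_cong[where g = "\<lambda>k. if k = 0 then 1 else 0"]) auto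
next
  case (ge2 n)
  have sh: "((\<lambda>k. coef (Suc n) (k + s) * w powi k) has_sum (w powi (- s) * H (Suc n) (w + 1 / w))) UNIV" for s
  proof -
    have "((\<lambda>k. coef (Suc n) (k + s) * w powi (k + s)) has_sum H (Suc n) (w + 1 / w)) UNIV"
      using has_sum_reindex_bij_betw[of "\<lambda>k. k + s" UNIV UNIV "\<lambda>k. coef (Suc n) k * w powi k"] ge2(2)
      by (simp add: bij_plus_right)
    from has_sum_cmult_right[OF this, of "w powi (- s)"] show ?thesis
      using assms by (simp add: power_int_add power_int_minus field_simps)
  qed
  have "((\<lambda>k. \<mu> n * (coef (Suc n) (k + (-1)) * w powi k + coef (Suc n) (k + 1) * w powi k)
      + \<sigma> n * (coef n k * w powi k)) has_sum
     (\<mu> n * (w powi (- (-1)) * H (Suc n) (w + 1 / w) + w powi (- 1) * H (Suc n) (w + 1 / w))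
      + \<sigma> n * H n (w + 1 / w))) UNIV"
    by (intro has_sum_add has_sum_cmult_right sh ge2(1))
  then show ?case using assms by (simp add: algebra_simps power_int_minus field_simps)
qed auto

text \<open>One term of a nonnegative sum; \<open>coef_minus\<close> supplies the negative
  \<open>k\<close>.\<close>

lemma coef_chernoff:
  assumes "1 \<le> w" shows "coef n k * w powi \<bar>k\<bar> \<le> H n (w + 1 / w)"
proof -
  have *: "coef n k * w powi k \<le> H n (w + 1 / w)" for k
    using finite_sum_le_has_sum[OF coef_has_sum[of w n], of "{k}"] assms coef_nonneg by auto
  show ?thesis using *[of k] *[of "- k"] coef_minus[of n k] by (cases "0 \<le> k") auto
qed

end

section \<open>The walk between consecutive convergents\<close>

text \<open>For \<open>\<beta> = 2 \<alpha> - 1\<close> the tested number is the floor of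
  \<open>2 j \<alpha>\<close>, which is even iff the fractional part of \<open>j \<alpha>\<close> is
  below 1/2.\<close>

definition sg :: "real \<Rightarrow> int \<Rightarrow> int" where
  "sg \<beta> j = (if even (j + \<lfloor>of_int j * \<beta>\<rfloor>) then 1 else -1)"

text \<open>Times are integers and the walk is 0 at negative ones, so that the position at
  \<open>Q - 1\<close> makes sense even for \<open>Q = 0\<close>.\<close>

definition walk :: "real \<Rightarrow> int \<Rightarrow> int" where
  "walk \<beta> r = (\<Sum>j\<in>{1..r}. sg \<beta> j)"

definition occ :: "real \<Rightarrow> int \<Rightarrow> int \<Rightarrow> nat" where
  "occ \<beta> N t = card {r. 0 \<le> r \<and> r < N \<and> walk \<beta> r = t}"

lemma sg_eq: "sg \<beta> j = 1 \<or> sg \<beta> j = -1"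
  by (simp add: sg_def)

lemma walk_0 [simp]: "walk \<beta> 0 = 0"
  by (simp add: walk_def)

lemma walk_Suc: "0 \<le> r \<Longrightarrow> walk \<beta> (r + 1) = walk \<beta> r + sg \<beta> (r + 1)"
proof -
  assume "0 \<le> r"
  then have "{1..r + 1} = insert (r + 1) {1..r}" by auto
  then show ?thesis by (simp add: walk_def)
qed

lemma occ_finite: "finite {r. 0 \<le> r \<and> r < (N::int) \<and> P r}"
  by (rule finite_subset[of _ "{0..<N}"]) auto

lemma occ_0 [simp]: "occ \<beta> 0 t = 0"
proof -
  have "{r. 0 \<le> r \<and> r < (0::int) \<and> walk \<beta> r = t} = {}" by auto
  then show ?thesis by (simp only: occ_def card.empty)
qed

lemma occ_mono: "N \<le> N' \<Longrightarrow> occ \<beta> N t \<le> occ \<beta> N' t"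
  unfolding occ_def by (intro card_mono occ_finite) auto

lemma occ_1: "occ \<beta> 1 t = (if t = 0 then 1 else 0)"
proof -
  have "{r. 0 \<le> r \<and> r < (1::int) \<and> walk \<beta> r = t} = (if t = 0 then {0} else {})"
    using walk_0[of \<beta>] by (auto simp: order_le_less)
  then show ?thesis by (simp add: occ_def)
qed

text \<open>Cramer's rule; a determinant of 1 or -1 is its own inverse.\<close>

lemma unimodular_coordinates:
  fixes P0 Q0 P1 Q1 :: int
  assumes "P0 * Q1 - P1 * Q0 = 1 \<or> P0 * Q1 - P1 * Q0 = -1"
  obtains a b where "r = a * Q1 + b * Q0" "p = a * P1 + b * P0"
proof -
  define D where "D = P0 * Q1 - P1 * Q0"
  define a where "a = D * (P0 * r - Q0 * p)"
  define b where "b = D * (Q1 * p - P1 * r)"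
  have D: "D * D = 1" using assms by (auto simp: D_def)
  have "a * Q1 + b * Q0 = D * D * r" "a * P1 + b * P0 = D * D * p"
    by (simp_all add: a_def b_def D_def algebra_simps)
  then show ?thesis by (intro that[of a b]) (simp_all add: D)
qed

text \<open>Two consecutive convergents of the even expansion together with the next one. Here
  \<open>\<bar>d0\<bar> > \<bar>d1\<bar>\<close> are the approximation errors, of opposite sign iff \<open>\<sigma> = 1\<close>.\<close>
locale convergents =
  fixes \<beta> :: real and P0 Q0 P1 Q1 M \<sigma> :: int and d0 d1 :: real
  assumes irr: "\<beta> \<notin> \<rat>"
    and d0_def: "d0 = of_int Q0 * \<beta> - of_int P0"
    and d1_def: "d1 = of_int Q1 * \<beta> - of_int P1"
    and det: "P0 * Q1 - P1 * Q0 = 1 \<or> P0 * Q1 - P1 * Q0 = -1"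
    and Q: "0 \<le> Q0" "Q0 < Q1"
    and M: "1 \<le> M"
    and sigma: "\<sigma> = 1 \<or> \<sigma> = -1"
    and signs: "of_int \<sigma> * d0 * d1 < 0"
    and d_less: "\<bar>d1\<bar> < \<bar>d0\<bar>" "\<bar>2 * of_int M * d1 + of_int \<sigma> * d0\<bar> < \<bar>d1\<bar>"
    and odd: "odd (P1 + Q1)"
begin

definition Q2 where "Q2 = 2 * M * Q1 + \<sigma> * Q0"

definition \<eta> :: int where "\<eta> = (if 0 < d1 then 1 else -1)"

lemma Q1_pos: "0 < Q1" using Q by linarith

lemma d1_ne: "d1 \<noteq> 0" using signs by auto

lemma d1_eq: "d1 = of_int \<eta> * \<bar>d1\<bar>"
  using d1_ne by (auto simp: \<eta>_def)

lemma d0_eq: "d0 = - of_int (\<sigma> * \<eta>) * \<bar>d0\<bar>"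
  using signs sigma d1_ne by (auto simp: \<eta>_def mult_less_0_iff zero_less_mult_iff abs_if)

text \<open>By the sign condition the next error has absolute value
  \<open>|2 M |d1| - |d0||\<close>, and it is smaller than \<open>|d1|\<close>.\<close>

lemma d0_bound: "(2 * of_int M - 1) * \<bar>d1\<bar> < \<bar>d0\<bar>"
proof -
  have "\<bar>2 * of_int M * d1 + of_int \<sigma> * d0\<bar> = \<bar>2 * of_int M * \<bar>d1\<bar> - \<bar>d0\<bar>\<bar>"
    by (subst (1) d1_eq, subst d0_eq) (use sigma d1_ne in \<open>auto simp: \<eta>_def\<close>)
  then show ?thesis using d_less by (simp add: algebra_simps abs_if split: if_splits)
qed

text \<open>Two consecutive convergents form a basis of the integer lattice, so every error
  \<open>r \<beta> - p\<close> is an integer combination of \<open>d0\<close> and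
  \<open>d1\<close>.\<close>

lemma lattice:
  obtains a b where "r = a * Q1 + b * Q0"
    "of_int r * \<beta> - of_int p = of_int a * d1 + of_int b * d0"
proof -
  obtain a b where e: "r = a * Q1 + b * Q0" "p = a * P1 + b * P0"
    using unimodular_coordinates[OF det] by blast
  then show ?thesis by (intro that[of a b]) (simp_all add: d0_def d1_def algebra_simps)
qed

text \<open>If \<open>p\<close> were crossed, \<open>lattice\<close> would give
  \<open>a |d1| < c |d0| < (a + i) |d1|\<close> with \<open>b = \<sigma> c\<close>. For
  \<open>c \<ge> 1\<close>, \<open>d0_bound\<close> forces \<open>i Q1 + r \<ge> Q2\<close>; for
  \<open>c \<le> 0\<close> one gets \<open>a < c\<close> and then \<open>r < 0\<close>.\<close>

lemma no_crossing:
  assumes r: "0 \<le> r" "r < Q1" and i: "0 \<le> i" "i * Q1 + r < Q2"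
    and x: "of_int \<eta> * (of_int r * \<beta> - of_int p) < 0"
  shows "of_int \<eta> * (of_int r * \<beta> + of_int i * d1 - of_int p) \<le> 0"
proof (rule ccontr)
  assume y: "\<not> ?thesis"
  obtain a b where ab: "r = a * Q1 + b * Q0" "of_int r * \<beta> - of_int p = of_int a * d1 + of_int b * d0"
    by (rule lattice)
  define c where "c = \<sigma> * b"
  have b: "b = \<sigma> * c" using sigma by (auto simp: c_def)
  have e: "of_int \<eta> * (of_int a * d1 + of_int b * d0) = of_int a * \<bar>d1\<bar> - of_int c * \<bar>d0\<bar>"
    by (subst d1_eq, subst d0_eq) (use sigma in \<open>auto simp: \<eta>_def b\<close>)
  have e2: "of_int \<eta> * (of_int i * d1) = of_int i * \<bar>d1\<bar>"
    by (subst d1_eq) (auto simp: \<eta>_def)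
  have 1: "of_int a * \<bar>d1\<bar> < of_int c * \<bar>d0\<bar>" using x unfolding ab(2) e by simp
  have 2: "of_int c * \<bar>d0\<bar> < of_int (a + i) * \<bar>d1\<bar>" 
  proof -
    have "of_int \<eta> * (of_int r * \<beta> + of_int i * d1 - of_int p)
        = of_int \<eta> * (of_int r * \<beta> - of_int p) + of_int \<eta> * (of_int i * d1)"
      by (simp add: algebra_simps)
    then show ?thesis using y unfolding ab(2) e e2 by (simp add: algebra_simps)
  qed
  show False
  proof (cases "1 \<le> c")
    case True
    have "of_int (c * (2 * M - 1)) * \<bar>d1\<bar> < of_int c * \<bar>d0\<bar>"
      using mult_strict_left_mono[OF d0_bound, of "of_int c"] True by (simp add: mult_ac)
    also note 2
    finally have "c * (2 * M - 1) < a + i"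
      using d1_ne by (smt (verit) mult_less_cancel_right_disj of_int_less_iff)
    then have "(c - 1) * (2 * M - 1) \<le> a + i - 2 * M" by (simp add: algebra_simps)
    moreover have "(c - 1) * 1 \<le> (c - 1) * (2 * M - 1)" using True M by (intro mult_left_mono) auto
    ultimately have "(c - 1) * Q1 \<le> (a + i - 2 * M) * Q1" using Q by (intro mult_right_mono) auto
    moreover have "(c - 1) * Q0 \<le> (c - 1) * Q1" "0 \<le> (c - 1) * Q0" using True Q by (auto intro: mult_left_mono)
    moreover have "(a + i - 2 * M) * Q1 + \<sigma> * ((c - 1) * Q0) < 0"
      using i(2) ab(1) b by (simp add: Q2_def algebra_simps)
    ultimately show False using sigma by auto
  next
    case False
    then have c: "c \<le> 0" by simp
    have "of_int c * \<bar>d0\<bar> \<le> of_int c * \<bar>d1\<bar>"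
      using c d_less by (intro mult_left_mono_neg) auto
    with 1 have "a < c" using d1_ne by (smt (verit) mult_less_cancel_right_disj of_int_less_iff)
    then have "a * Q1 \<le> (c - 1) * Q1" using Q by (intro mult_right_mono) auto
    moreover have "c * Q1 \<le> c * Q0" "c * Q0 \<le> 0"
      using c Q by (auto intro: mult_left_mono_neg mult_nonpos_nonneg)
    ultimately show False using r ab(1) b sigma Q1_pos by (auto simp: algebra_simps)
  qed
qed

lemma not_int: "j \<noteq> 0 \<Longrightarrow> of_int j * \<beta> \<noteq> of_int p"
proof
  assume "j \<noteq> 0" "of_int j * \<beta> = of_int p"
  then have "\<beta> = of_int p / of_int j" by (simp add: field_simps)
  then show False using irr by auto
qed

text \<open>Translation by \<open>i Q1\<close> adds the integer \<open>i P1\<close> and a drift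
  \<open>i d1\<close>, which crosses no integer.\<close>

lemma floor_block:
  assumes r: "0 < r" "r < Q1" and i: "0 \<le> i" "i * Q1 + r < Q2"
  shows "\<lfloor>of_int (i * Q1 + r) * \<beta>\<rfloor> = i * P1 + \<lfloor>of_int r * \<beta>\<rfloor>"
proof -
  define x where "x = of_int r * \<beta>"
  have e: "of_int (i * Q1 + r) * \<beta> = of_int (i * P1) + (x + of_int i * d1)"
    by (simp add: x_def d1_def algebra_simps)
  have ne: "x + of_int i * d1 \<noteq> of_int p" "x \<noteq> of_int p" for p
  proof -
    have "0 < i * Q1 + r" using r i Q by (simp add: add_nonneg_pos)
    then show "x + of_int i * d1 \<noteq> of_int p"
      using e not_int[of "i * Q1 + r" "i * P1 + p"] by auto
    show "x \<noteq> of_int p" using r not_int by (simp add: x_def)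
  qed
  have i1: "0 \<le> of_int i * \<bar>d1\<bar>" using i by simp
  have "\<lfloor>x + of_int i * d1\<rfloor> = \<lfloor>x\<rfloor>"
  proof (cases "0 < d1")
    case True
    have "x + of_int i * d1 - of_int (\<lfloor>x\<rfloor> + 1) \<le> 0"
      using no_crossing[of r i "\<lfloor>x\<rfloor> + 1"] r i True by (simp add: \<eta>_def x_def)
    then show ?thesis using ne(1)[of "\<lfloor>x\<rfloor> + 1"] i1 True by (intro floor_unique) (auto simp: algebra_simps, linarith+)
  next
    case False
    have "of_int \<lfloor>x\<rfloor> < x" using ne(2)[of "\<lfloor>x\<rfloor>"] of_int_floor_le[of x] by linarith
    then have "of_int \<lfloor>x\<rfloor> \<le> x + of_int i * d1"
      using no_crossing[of r i "\<lfloor>x\<rfloor>"] r i False by (simp add: \<eta>_def x_def)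
    moreover have "of_int i * d1 \<le> 0" using i False by (intro mult_nonneg_nonpos) auto
    ultimately show ?thesis by (intro floor_unique) linarith+
  qed
  then show ?thesis by (simp only: e x_def flip: int_add_floor)
qed

text \<open>Here the drift starts at an integer, so its sign decides the floor.\<close>

lemma floor_multiple:
  assumes i: "0 < i" "i * Q1 < Q2"
  shows "\<lfloor>of_int (i * Q1) * \<beta>\<rfloor> = i * P1 + (if 0 < d1 then 0 else -1)"
proof -
  have e: "of_int (i * Q1) * \<beta> = of_int (i * P1) + of_int i * d1"
    by (simp add: d1_def algebra_simps)
  have ne: "of_int i * d1 \<noteq> of_int p" for p
  proof -
    have "0 < i * Q1" using i Q by simp
    then have "of_int (i * Q1) * \<beta> \<noteq> of_int (i * P1 + p)" by (intro not_int) linarith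
    then show ?thesis unfolding e by simp
  qed
  have "\<lfloor>of_int i * d1\<rfloor> = (if 0 < d1 then 0 else -1)"
  proof (cases "0 < d1")
    case True
    have "of_int i * d1 \<le> 1"
      using no_crossing[of 0 i 1] i True Q1_pos by (simp add: \<eta>_def)
    then show ?thesis using ne[of 1] i True by (intro floor_unique) auto
  next
    case False
    have "-1 \<le> of_int i * d1"
      using no_crossing[of 0 i "-1"] i False Q1_pos by (simp add: \<eta>_def)
    moreover have "of_int i * d1 < 0" using i False d1_ne by (simp add: mult_less_0_iff)
    ultimately show ?thesis using False by (intro floor_unique) auto
  qed
  then show ?thesis by (simp only: e flip: int_add_floor)
qed

text \<open>The sign \<open>(-1)^i\<close> for an integer exponent.\<close>

definition par :: "int \<Rightarrow> int" where "par i = (if even i then 1 else -1)"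

text \<open>Each translation by \<open>Q1\<close> changes the tested parity by the odd number
  \<open>P1 + Q1\<close>.\<close>

lemma sg_block:
  assumes "0 < r" "r < Q1" "0 \<le> i" "i * Q1 + r < Q2"
  shows "sg \<beta> (i * Q1 + r) = par i * sg \<beta> r"
  using floor_block[OF assms] odd by (auto simp: sg_def par_def)

lemma sg_multiple:
  assumes "0 < i" "i * Q1 < Q2"
  shows "sg \<beta> (i * Q1) = par i * \<eta>"
  using floor_multiple[OF assms] odd by (auto simp: sg_def par_def \<eta>_def)

text \<open>\<open>(Q1 - j) \<beta> = P1 - j \<beta> + d1\<close>, and adding \<open>d1\<close>
  crosses no integer. So the floor is \<open>P1 - 1\<close> minus that of \<open>j \<beta>\<close>,
  and the parity is preserved because \<open>P1 + Q1 - 1\<close> is even.\<close>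

lemma sg_reflect:
  assumes j: "0 < j" "j < Q1"
  shows "sg \<beta> (Q1 - j) = sg \<beta> j"
proof -
  define x where "x = - of_int j * \<beta>"
  have e: "of_int (Q1 - j) * \<beta> = of_int P1 + (x + d1)"
    by (simp add: x_def d1_def algebra_simps)
  have ne: "x + d1 \<noteq> of_int p" "x \<noteq> of_int p" for p
    using e not_int[of "Q1 - j" "P1 + p"] not_int[of "-j" p] j by (auto simp: x_def)
  \<comment> \<open>The argument of \<open>no_crossing\<close> with drift \<open>d1\<close> only,
    repeated because the starting index \<open>- j\<close> is negative.\<close>
  have cross: "\<not> (of_int \<eta> * (x - of_int p) < 0 \<and> 0 < of_int \<eta> * (x + d1 - of_int p))" for p
  proof
    assume H: "of_int \<eta> * (x - of_int p) < 0 \<and> 0 < of_int \<eta> * (x + d1 - of_int p)"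
    obtain a b where ab: "- j = a * Q1 + b * Q0" "of_int (- j) * \<beta> - of_int p = of_int a * d1 + of_int b * d0"
      by (rule lattice)
    define c where "c = \<sigma> * b"
    have b: "b = \<sigma> * c" using sigma by (auto simp: c_def)
    have e: "of_int \<eta> * (of_int a * d1 + of_int b * d0) = of_int a * \<bar>d1\<bar> - of_int c * \<bar>d0\<bar>"
      by (subst d1_eq, subst d0_eq) (use sigma in \<open>auto simp: \<eta>_def b\<close>)
    have e2: "of_int \<eta> * d1 = \<bar>d1\<bar>" by (subst d1_eq) (auto simp: \<eta>_def)
    have xp: "x - of_int p = of_int (- j) * \<beta> - of_int p" by (simp add: x_def)
    have 1: "of_int a * \<bar>d1\<bar> < of_int c * \<bar>d0\<bar>" using H[THEN conjunct1] unfolding xp ab(2) e by simp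
    have 2: "of_int c * \<bar>d0\<bar> < of_int (a + 1) * \<bar>d1\<bar>"
    proof -
      have "of_int \<eta> * (x + d1 - of_int p) = of_int \<eta> * (x - of_int p) + of_int \<eta> * d1"
        by (simp add: algebra_simps)
      then show ?thesis using H[THEN conjunct2] unfolding xp ab(2) e e2 by (simp add: algebra_simps)
    qed
    consider "1 \<le> c" | "c = 0" | "c \<le> -1" by linarith
    then show False
    proof cases
      assume c: "1 \<le> c"
      have "of_int c * \<bar>d1\<bar> \<le> of_int c * \<bar>d0\<bar>" using c d_less by (intro mult_left_mono) auto
      with 2 have "c < a + 1" using d1_ne by (smt (verit) mult_less_cancel_right_disj of_int_less_iff)
      then have "c * Q1 \<le> a * Q1" using Q by (intro mult_right_mono) auto
      moreover have "c * Q0 \<le> c * Q1" "0 \<le> c * Q0" using c Q by (auto intro: mult_left_mono)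
      moreover have "- j = a * Q1 + \<sigma> * (c * Q0)" using ab(1) b by simp
      ultimately show False using j sigma by (elim disjE; simp only: mult_1 mult_minus_left; linarith)
    next
      assume c: "c = 0"
      then show False using 1 2 d1_ne by (auto simp: mult_less_0_iff zero_less_mult_iff)
    next
      assume c: "c \<le> -1"
      have "of_int c * \<bar>d0\<bar> \<le> of_int c * \<bar>d1\<bar>" using c d_less by (intro mult_left_mono_neg) auto
      with 1 have "a < c" using d1_ne by (smt (verit) mult_less_cancel_right_disj of_int_less_iff)
      then have "a * Q1 \<le> (c - 1) * Q1" using Q by (intro mult_right_mono) auto
      moreover have "c * Q1 \<le> c * Q0" "c * Q0 \<le> 0"
        using c Q by (auto intro: mult_left_mono_neg mult_nonpos_nonneg)
      ultimately show False using ab(1) b j sigma by (auto simp: algebra_simps)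
    qed
  qed
  have "\<lfloor>x + d1\<rfloor> = \<lfloor>x\<rfloor>"
  proof (cases "0 < d1")
    case True
    have "x + d1 \<le> of_int (\<lfloor>x\<rfloor> + 1)"
      using cross[of "\<lfloor>x\<rfloor> + 1"] True by (simp add: \<eta>_def)
    then show ?thesis using ne(1)[of "\<lfloor>x\<rfloor> + 1"] True by (intro floor_unique) (auto simp: algebra_simps, linarith+)
  next
    case False
    have "of_int \<lfloor>x\<rfloor> < x" using ne(2)[of "\<lfloor>x\<rfloor>"] of_int_floor_le[of x] by linarith
    then have "of_int \<lfloor>x\<rfloor> \<le> x + d1" using cross[of "\<lfloor>x\<rfloor>"] False by (simp add: \<eta>_def)
    then show ?thesis using False by (intro floor_unique) linarith+
  qed
  moreover have "\<lfloor>x\<rfloor> = - \<lfloor>of_int j * \<beta>\<rfloor> - 1"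
    using not_int[of j "\<lfloor>of_int j * \<beta>\<rfloor>"] j by (intro floor_unique) (auto simp: x_def, linarith+)
  ultimately have "\<lfloor>of_int (Q1 - j) * \<beta>\<rfloor> = P1 - 1 - \<lfloor>of_int j * \<beta>\<rfloor>" by (simp only: e flip: int_add_floor)
  then show ?thesis using odd by (auto simp: sg_def)
qed

end

text \<open>\<open>\<epsilon>\<close> is a relative and \<open>b\<close> an absolute error. Both
  neighbours occur so that reflections preserve the property.\<close>

definition flat :: "real \<Rightarrow> real \<Rightarrow> (int \<Rightarrow> real) \<Rightarrow> bool" where
  "flat \<epsilon> b f \<longleftrightarrow> (\<forall>t. (1 - \<epsilon>) * f t \<le> f (t + 1) + b \<and> (1 - \<epsilon>) * f t \<le> f (t - 1) + b)"

lemma flat_add: "flat \<epsilon> a f \<Longrightarrow> flat \<epsilon> b g \<Longrightarrow> flat \<epsilon> (a + b) (\<lambda>t. f t + g t)"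
  unfolding flat_def by (smt (verit) distrib_left)

lemma flat_reflect:
  assumes "flat \<epsilon> b f" "p = 1 \<or> p = -1"
  shows "flat \<epsilon> b (\<lambda>t. f (p * (t - s)))"
proof -
  have e: "t + 1 - s = t - s + 1" "t - 1 - s = t - s - 1" "- 1 * (t - s + 1) = - (t - s) - 1"
    "- 1 * (t - s - 1) = - (t - s) + 1" "-1 * (t - s) = - (t - s)" for t by auto
  show ?thesis using assms unfolding flat_def
    by (elim disjE) (simp_all only: e mult_1, auto)
qed

lemma flat_mono: "flat \<epsilon> a f \<Longrightarrow> a \<le> b \<Longrightarrow> flat \<epsilon> b f"
  unfolding flat_def by (meson add_left_mono order_trans)

section \<open>Block structure of the walk up to the next denominator\<close>

context convergents
begin

text \<open>Twice the centre of symmetry of the positions at the times below \<open>Q1\<close>, see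
  \<open>walk_reflect\<close>.\<close>

definition \<tau> where "\<tau> = walk \<beta> (Q1 - 1)"
definition c where "c = sg \<beta> Q1"

lemma Q1_less: "Q1 < Q2"
proof -
  have "2 * 1 * Q1 \<le> 2 * M * Q1" using M Q by (intro mult_right_mono) auto
  moreover have "- Q0 \<le> \<sigma> * Q0" using sigma Q by auto
  ultimately show ?thesis using Q unfolding Q2_def by linarith
qed

lemma c_eq: "c = - \<eta>"
  using sg_multiple[of 1] Q1_less by (simp add: c_def par_def)

lemma par_eq: "par i = 1 \<or> par i = -1" by (simp add: par_def)

lemma walk_block:
  assumes i: "0 \<le> i" and r: "0 \<le> r"
  shows "r < Q1 \<Longrightarrow> i * Q1 + r < Q2 \<Longrightarrow> walk \<beta> (i * Q1 + r) = walk \<beta> (i * Q1) + par i * walk \<beta> r"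
  using r
proof (induction r rule: int_ge_induct)
  case (step r)
  have "0 \<le> i * Q1 + r" using i Q1_pos step by simp
  then have "walk \<beta> (i * Q1 + r + 1) = walk \<beta> (i * Q1 + r) + sg \<beta> (i * Q1 + (r + 1))"
    using walk_Suc[of "i * Q1 + r"] by (simp add: add.assoc)
  also have "sg \<beta> (i * Q1 + (r + 1)) = par i * sg \<beta> (r + 1)"
    using step i by (intro sg_block) auto
  finally show ?case using step walk_Suc[of r \<beta>] by (simp add: algebra_simps)
qed simp

text \<open>Block \<open>i\<close> together with the step after it contributes
  \<open>par i * (\<tau> + c)\<close>, so consecutive blocks cancel. That step has the right sign
  because \<open>c = - \<eta>\<close>.\<close>

lemma walk_multiple:
  assumes "0 \<le> i"
  shows "i * Q1 < Q2 \<Longrightarrow> walk \<beta> (i * Q1) = (if even i then 0 else \<tau> + c)"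
  using assms
proof (induction i rule: int_ge_induct)
  case (step i)
  have nn: "0 \<le> i * Q1" using step Q1_pos by simp
  have lt: "i * Q1 + (Q1 - 1) < Q2" using step by (simp add: algebra_simps)
  have "walk \<beta> ((i + 1) * Q1) = walk \<beta> (i * Q1 + (Q1 - 1)) + sg \<beta> ((i + 1) * Q1)"
    using walk_Suc[of "i * Q1 + (Q1 - 1)" \<beta>] nn Q1_pos by (simp add: algebra_simps)
  also have "walk \<beta> (i * Q1 + (Q1 - 1)) = walk \<beta> (i * Q1) + par i * \<tau>"
    using walk_block[of i "Q1 - 1"] step lt Q1_pos by (simp add: \<tau>_def)
  also have "sg \<beta> ((i + 1) * Q1) = par i * c"
    using sg_multiple[of "i + 1"] step c_eq by (simp add: par_def)
  finally show ?case using step lt Q1_pos by (simp add: par_def)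
qed simp

text \<open>By the palindrome \<open>sg_reflect\<close>, the last \<open>r\<close> of the
  \<open>Q1 - 1\<close> steps add up to the first \<open>r\<close> steps.\<close>

lemma walk_reflect:
  assumes "0 \<le> r" shows "r < Q1 \<Longrightarrow> walk \<beta> (Q1 - 1 - r) = \<tau> - walk \<beta> r"
  using assms
proof (induction r rule: int_ge_induct)
  case base
  then show ?case by (simp add: \<tau>_def)
next
  case (step r)
  have "walk \<beta> (Q1 - 1 - r) = walk \<beta> (Q1 - 1 - (r + 1)) + sg \<beta> (Q1 - (r + 1))"
    using walk_Suc[of "Q1 - 1 - (r + 1)" \<beta>] step by (simp add: algebra_simps)
  also have "sg \<beta> (Q1 - (r + 1)) = sg \<beta> (r + 1)" using step by (intro sg_reflect) auto
  finally show ?case using step walk_Suc[of r \<beta>] by simp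
qed

text \<open>In block \<open>i\<close> the walk is a translated and possibly reflected copy of its
  beginning; solving \<open>walk_block\<close> for the local position uses that \<open>par i\<close>
  is its own inverse.\<close>

lemma occ_block:
  assumes i: "0 \<le> i" and L: "0 \<le> L" "L \<le> Q1" "i * Q1 + L \<le> Q2"
  shows "occ \<beta> (i * Q1 + L) t = occ \<beta> (i * Q1) t + occ \<beta> L (par i * (t - walk \<beta> (i * Q1)))"
proof -
  define A where "A = {r. 0 \<le> r \<and> r < i * Q1 \<and> walk \<beta> r = t}"
  define C where "C = {r. 0 \<le> r \<and> r < L \<and> walk \<beta> r = par i * (t - walk \<beta> (i * Q1))}"
  have nn: "0 \<le> i * Q1" using i Q1_pos by simp
  have "{r. 0 \<le> r \<and> r < i * Q1 + L \<and> walk \<beta> r = t} = A \<union> (\<lambda>r. i * Q1 + r) ` C"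
  proof (intro set_eqI iffI)
    fix x assume x: "x \<in> {r. 0 \<le> r \<and> r < i * Q1 + L \<and> walk \<beta> r = t}"
    show "x \<in> A \<union> (\<lambda>r. i * Q1 + r) ` C"
    proof (cases "x < i * Q1")
      case True
      then show ?thesis using x by (auto simp: A_def)
    next
      case False
      define r where "r = x - i * Q1"
      have "walk \<beta> x = walk \<beta> (i * Q1) + par i * walk \<beta> r"
        using walk_block[of i r] x False i L by (simp add: r_def)
      then have "r \<in> C" using x False par_eq[of i] by (auto simp: C_def r_def)
      then have "x \<in> (\<lambda>r. i * Q1 + r) ` C" by (intro image_eqI[of _ _ r]) (simp_all add: r_def)
      then show ?thesis by blast
    qed
  next
    fix x assume "x \<in> A \<union> (\<lambda>r. i * Q1 + r) ` C"
    then show "x \<in> {r. 0 \<le> r \<and> r < i * Q1 + L \<and> walk \<beta> r = t}"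
    proof
      assume "x \<in> (\<lambda>r. i * Q1 + r) ` C"
      then obtain r where r: "x = i * Q1 + r" "r \<in> C" by auto
      have "walk \<beta> x = walk \<beta> (i * Q1) + par i * walk \<beta> r"
        using walk_block[of i r] r i L by (simp add: C_def)
      then show ?thesis using r nn par_eq[of i] by (auto simp: C_def)
    qed (use L in \<open>auto simp: A_def\<close>)
  qed
  moreover have "finite A" "finite C" by (auto simp: A_def C_def intro: occ_finite)
  moreover have "A \<inter> (\<lambda>r. i * Q1 + r) ` C = {}" by (auto simp: A_def C_def)
  ultimately show ?thesis
    unfolding occ_def A_def[symmetric] C_def[symmetric]
    by (simp add: card_Un_disjoint card_image)
qed

text \<open>The last \<open>L\<close> times below \<open>Q1\<close> are the mirror images of the
  first \<open>L\<close>.\<close>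

lemma occ_reflect_part:
  assumes L: "0 \<le> L" "L \<le> Q1"
  shows "occ \<beta> Q1 t = occ \<beta> (Q1 - L) t + occ \<beta> L (\<tau> - t)"
proof -
  define A where "A = {r. 0 \<le> r \<and> r < Q1 - L \<and> walk \<beta> r = t}"
  define C where "C = {r. 0 \<le> r \<and> r < L \<and> walk \<beta> r = \<tau> - t}"
  have "{r. 0 \<le> r \<and> r < Q1 \<and> walk \<beta> r = t} = A \<union> (\<lambda>r. Q1 - 1 - r) ` C"
  proof (intro set_eqI iffI)
    fix x assume x: "x \<in> {r. 0 \<le> r \<and> r < Q1 \<and> walk \<beta> r = t}"
    show "x \<in> A \<union> (\<lambda>r. Q1 - 1 - r) ` C"
    proof (cases "x < Q1 - L")
      case True
      then show ?thesis using x by (auto simp: A_def)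
    next
      case False
      have "walk \<beta> (Q1 - 1 - x) = \<tau> - t" using walk_reflect[of x] x by simp
      then have "Q1 - 1 - x \<in> C" using x False by (auto simp: C_def)
      then have "x \<in> (\<lambda>r. Q1 - 1 - r) ` C" by (intro image_eqI[of _ _ "Q1 - 1 - x"]) simp_all
      then show ?thesis by blast
    qed
  next
    fix x assume "x \<in> A \<union> (\<lambda>r. Q1 - 1 - r) ` C"
    then show "x \<in> {r. 0 \<le> r \<and> r < Q1 \<and> walk \<beta> r = t}"
    proof
      assume "x \<in> (\<lambda>r. Q1 - 1 - r) ` C"
      then obtain r where r: "x = Q1 - 1 - r" "r \<in> C" by auto
      then show ?thesis using walk_reflect[of r] L by (simp add: C_def)
    qed (use L in \<open>auto simp: A_def\<close>)
  qed
  moreover have "finite A" "finite C" by (auto simp: A_def C_def intro: occ_finite)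
  moreover have "A \<inter> (\<lambda>r. Q1 - 1 - r) ` C = {}" by (auto simp: A_def C_def)
  moreover have "inj_on (\<lambda>r. Q1 - 1 - r) C" by (auto simp: inj_on_def)
  ultimately show ?thesis
    unfolding occ_def A_def[symmetric] C_def[symmetric]
    by (simp add: card_Un_disjoint card_image)
qed

lemma occ_reflect: "occ \<beta> Q1 (\<tau> - t) = occ \<beta> Q1 t"
  using occ_reflect_part[of Q1 t] Q1_pos by simp

text \<open>An even block starts at 0 and gives the count at \<open>t\<close>. An odd block starts
  at \<open>\<tau> + c\<close> and is reflected, which by symmetry gives the count at
  \<open>t - c\<close>.\<close>

lemma occ_even:
  assumes "0 \<le> j"
  shows "2 * j * Q1 \<le> Q2 \<Longrightarrow> int (occ \<beta> (2 * j * Q1) t) = j * (int (occ \<beta> Q1 t) + int (occ \<beta> Q1 (t - c)))"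
  using assms
proof (induction j rule: int_ge_induct)
  case (step j)
  have le: "2 * j * Q1 + Q1 + Q1 \<le> Q2" using step by (simp add: algebra_simps)
  have "occ \<beta> (2 * j * Q1 + Q1) t = occ \<beta> (2 * j * Q1) t + occ \<beta> Q1 t"
    using occ_block[of "2 * j" Q1 t] walk_multiple[of "2 * j"] step le Q1_pos by (simp add: par_def)
  moreover have "occ \<beta> ((2 * j + 1) * Q1 + Q1) t = occ \<beta> ((2 * j + 1) * Q1) t + occ \<beta> Q1 (\<tau> - (t - c))"
    using occ_block[of "2 * j + 1" Q1 t] walk_multiple[of "2 * j + 1"] step le Q1_pos
    by (simp add: par_def algebra_simps)
  ultimately show ?case using occ_reflect[of "t - c"] step le Q1_pos
    by (simp add: algebra_simps)
qed simp

text \<open>For \<open>\<sigma> = 1\<close> there are \<open>2 M\<close> full blocks and an initial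
  piece of length \<open>Q0\<close>. For \<open>\<sigma> = -1\<close> the last odd block lacks its
  final \<open>Q0\<close> times, which are mirror images of an initial piece.\<close>

lemma occ_next:
  "int (occ \<beta> Q2 t) = M * (int (occ \<beta> Q1 t) + int (occ \<beta> Q1 (t - c)))
    + \<sigma> * int (occ \<beta> Q0 (if \<sigma> = 1 then t else t - c))"
  using sigma
proof
  assume s: "\<sigma> = 1"
  have e: "Q2 = 2 * M * Q1 + Q0" unfolding Q2_def using s by simp
  have "occ \<beta> Q2 t = occ \<beta> (2 * M * Q1) t + occ \<beta> Q0 t"
  proof (cases "Q0 = 0")
    case False
    then show ?thesis using occ_block[of "2 * M" Q0 t] walk_multiple[of "2 * M"] Q M e
      by (simp add: par_def)
  qed (use e in simp)
  moreover have "int (occ \<beta> (2 * M * Q1) t) = M * (int (occ \<beta> Q1 t) + int (occ \<beta> Q1 (t - c)))"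
    using occ_even[of M t] M Q e by simp
  ultimately show ?thesis by (simp only: s) simp
next
  assume s: "\<sigma> = -1"
  have e: "Q2 = (2 * M - 1) * Q1 + (Q1 - Q0)" using s unfolding Q2_def by (simp add: algebra_simps)
  have e2: "(2 * M - 1) * Q1 = 2 * (M - 1) * Q1 + Q1" by (simp add: algebra_simps)
  have lt: "(2 * M - 1) * Q1 < Q2" "2 * (M - 1) * Q1 < Q2" using e e2 Q by linarith+
  have "occ \<beta> Q2 t = occ \<beta> ((2 * M - 1) * Q1) t + occ \<beta> (Q1 - Q0) (\<tau> - (t - c))"
    using occ_block[of "2 * M - 1" "Q1 - Q0" t] walk_multiple[of "2 * M - 1"] lt M Q
    unfolding e[symmetric] by (simp add: par_def algebra_simps)
  moreover have "occ \<beta> Q1 (\<tau> - (t - c)) = occ \<beta> (Q1 - Q0) (\<tau> - (t - c)) + occ \<beta> Q0 (t - c)"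
    using occ_reflect_part[of Q0 "\<tau> - (t - c)"] Q by simp
  moreover have "occ \<beta> ((2 * M - 1) * Q1) t = occ \<beta> (2 * (M - 1) * Q1) t + occ \<beta> Q1 t"
    using occ_block[of "2 * (M - 1)" Q1 t] walk_multiple[of "2 * (M - 1)"] lt M Q
    unfolding e2 by (simp add: par_def)
  ultimately show ?thesis using occ_reflect[of "t - c"] occ_even[of "M - 1" t] lt M s
    by (simp add: algebra_simps)
qed

lemma walk_next_pos:
  assumes "\<sigma> = 1" "0 < Q0" shows "walk \<beta> (Q2 - 1) = walk \<beta> (Q0 - 1)"
proof -
  have e: "Q2 = 2 * M * Q1 + Q0" unfolding Q2_def using assms by simp
  then have e2: "Q2 - 1 = 2 * M * Q1 + (Q0 - 1)" by simp
  show ?thesis unfolding e2 using e walk_block[of "2 * M" "Q0 - 1"] walk_multiple[of "2 * M"] assms(2) M Q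
    by (simp add: par_def)
qed

text \<open>The alternative \<open>Q0 = 0\<close> covers the first step of the expansion, where the
  value of \<open>\<sigma>\<close> does not affect \<open>Q2\<close>.\<close>

lemma walk_next_neg:
  assumes "\<sigma> = -1 \<or> Q0 = 0" shows "walk \<beta> (Q2 - 1) = c + walk \<beta> Q0"
proof -
  have e: "Q2 = (2 * M - 1) * Q1 + (Q1 - Q0)" using assms by (auto simp: Q2_def algebra_simps)
  have e2: "Q2 - 1 = (2 * M - 1) * Q1 + (Q1 - 1 - Q0)" using e by simp
  have "walk \<beta> (Q2 - 1) = walk \<beta> ((2 * M - 1) * Q1) - walk \<beta> (Q1 - 1 - Q0)"
    unfolding e2 using walk_block[of "2 * M - 1" "Q1 - 1 - Q0"] e M Q by (simp add: par_def)
  also have "walk \<beta> ((2 * M - 1) * Q1) = \<tau> + c"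
    using walk_multiple[of "2 * M - 1"] e M Q by simp
  also have "walk \<beta> (Q1 - 1 - Q0) = \<tau> - walk \<beta> Q0" using walk_reflect[of Q0] Q by simp
  finally show ?thesis by simp
qed

text \<open>Time \<open>N\<close> splits into at most \<open>2 M\<close> full blocks, each with
  error \<open>b\<close>, and a remainder with error \<open>b'\<close>. There are no more blocks
  because \<open>Q2 < (2 M + 1) Q1\<close>.\<close>

lemma flat_occ:
  assumes b: "flat \<epsilon> b (\<lambda>t. occ \<beta> Q1 t)" "0 \<le> b"
    and b': "\<And>r. 0 \<le> r \<Longrightarrow> r < Q1 \<Longrightarrow> flat \<epsilon> b' (\<lambda>t. occ \<beta> r t)"
    and N: "0 \<le> N" "N \<le> Q2"
  shows "flat \<epsilon> (of_int (2 * M) * b + b') (\<lambda>t. occ \<beta> N t)"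
proof -
  have m: "flat \<epsilon> (of_int i * b) (\<lambda>t. occ \<beta> (i * Q1) t)" if "0 \<le> i" "i * Q1 \<le> Q2" for i
    using that
  proof (induction i rule: int_ge_induct)
    case (step i)
    have le: "i * Q1 + Q1 \<le> Q2" using step by (simp add: algebra_simps)
    have e: "occ \<beta> ((i + 1) * Q1) t = occ \<beta> (i * Q1) t + occ \<beta> Q1 (par i * (t - walk \<beta> (i * Q1)))" for t
      using occ_block[of i Q1 t] step le Q1_pos by (simp add: algebra_simps)
    have "flat \<epsilon> (of_int i * b + b) (\<lambda>t. real (occ \<beta> (i * Q1) t)
        + real (occ \<beta> Q1 (par i * (t - walk \<beta> (i * Q1)))))"
      using step le Q1_pos by (intro flat_add flat_reflect[OF b(1) par_eq]) auto
    then show ?case unfolding e by (simp add: distrib_right)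
  qed (simp add: flat_def)
  define i where "i = N div Q1"
  define r where "r = N mod Q1"
  have ir: "N = i * Q1 + r" "0 \<le> r" "r < Q1" "0 \<le> i"
    using Q1_pos N by (auto simp: i_def r_def pos_imp_zdiv_nonneg_iff)
  have e: "occ \<beta> N t = occ \<beta> (i * Q1) t + occ \<beta> r (par i * (t - walk \<beta> (i * Q1)))" for t
    using occ_block[of i r t] ir N by simp
  have "\<sigma> * Q0 \<le> Q0" using sigma Q by auto
  then have "i * Q1 < (2 * M + 1) * Q1" using ir N Q by (simp add: Q2_def algebra_simps)
  then have "i \<le> 2 * M" using Q1_pos by (simp add: mult_less_cancel_right)
  then have le: "of_int i * b + b' \<le> of_int (2 * M) * b + b'"
    using b(2) by (intro add_right_mono mult_right_mono) (auto simp only: of_int_le_iff)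
  have "flat \<epsilon> (of_int i * b + b') (\<lambda>t. occ \<beta> N t)"
    unfolding e of_nat_add using ir N by (intro flat_add m flat_reflect[OF b' par_eq]) auto
  then show ?thesis by (rule flat_mono[OF _ le])
qed

end

section \<open>Continued fraction expansions\<close>

lemma cfrac_tail:
  assumes lim: "cfrac k \<longlonglongrightarrow> x" and x: "x \<notin> \<rat>"
  shows "cfrac (\<lambda>i. k (Suc i)) \<longlonglongrightarrow> 1 / (x - of_int (k 0))" "1 / (x - of_int (k 0)) \<notin> \<rat>"
proof -
  have ne: "x - of_int (k 0) \<noteq> 0" using x by auto
  have "(\<lambda>n. 1 / (cfrac k (Suc n) - of_int (k 0))) \<longlonglongrightarrow> 1 / (x - of_int (k 0))"
    using LIMSEQ_Suc[OF lim] ne by (intro tendsto_intros)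
  then show "cfrac (\<lambda>i. k (Suc i)) \<longlonglongrightarrow> 1 / (x - of_int (k 0))" by simp
  show "1 / (x - of_int (k 0)) \<notin> \<rat>"
  proof
    assume "1 / (x - of_int (k 0)) \<in> \<rat>"
    from Rats_divide[OF Rats_1 this] have "x - of_int (k 0) \<in> \<rat>" by simp
    from Rats_add[OF this Rats_of_int[of "k 0"]] show False using x by simp
  qed
qed

text \<open>These are the complete quotients. The bound on the finite fractions passes to the limit,
  and irrationality makes it strict.\<close>

lemma tails_exist:
  assumes lim: "cfrac k \<longlonglongrightarrow> x" and x: "x \<notin> \<rat>"
    and ge: "\<And>n j. 1 \<le> \<bar>cfrac (\<lambda>i. k (i + Suc n)) j\<bar>"
  shows "\<exists>b. b 0 = x \<and> (\<forall>n. b n = of_int (k n) + 1 / b (Suc n) \<and> 1 < \<bar>b (Suc n)\<bar>)"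
proof -
  define b where "b = rec_nat x (\<lambda>n y. 1 / (y - of_int (k n)))"
  have b: "b 0 = x" "b (Suc n) = 1 / (b n - of_int (k n))" for n by (auto simp: b_def)
  have bl: "cfrac (\<lambda>i. k (i + n)) \<longlonglongrightarrow> b n \<and> b n \<notin> \<rat>" for n
  proof (induction n)
    case (Suc n)
    then show ?case using cfrac_tail[of "\<lambda>i. k (i + n)" "b n"] by (simp add: b)
  qed (use lim x in \<open>simp add: b\<close>)
  have "1 < \<bar>b (Suc n)\<bar>" for n
  proof -
    have "(\<lambda>j. \<bar>cfrac (\<lambda>i. k (i + Suc n)) j\<bar>) \<longlonglongrightarrow> \<bar>b (Suc n)\<bar>"
      using bl by (intro tendsto_intros) blast
    then have "1 \<le> \<bar>b (Suc n)\<bar>" using ge by (intro LIMSEQ_le_const) auto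
    moreover have "\<bar>b (Suc n)\<bar> \<noteq> 1" using bl[of "Suc n"] by (auto simp: abs_if split: if_splits)
    ultimately show ?thesis by linarith
  qed
  moreover have "b n = of_int (k n) + 1 / b (Suc n)" for n by (simp add: b)
  ultimately show ?thesis using b by blast
qed

text \<open>Covers regular and even expansions alike; \<open>b\<close> is the sequence of complete
  quotients.\<close>

locale expansion =
  fixes k :: "nat \<Rightarrow> int" and b :: "nat \<Rightarrow> real" and x :: real
  assumes x_irr: "x \<notin> \<rat>" and b_0: "b 0 = x"
    and b_eq: "b n = of_int (k n) + 1 / b (Suc n)" and b_gt: "1 < \<bar>b (Suc n)\<bar>"
    and k_ne: "k (Suc n) \<noteq> 0"
begin

text \<open>The value 1 at 0 normalises the start of the recurrences below; \<open>k 0\<close> may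
  have any sign.\<close>

definition s :: "nat \<Rightarrow> int" where "s n = (if n = 0 then 1 else sgn (k n))"

text \<open>Up to the common sign \<open>s 1 * ... * s n\<close>, \<open>p (Suc n)\<close> and
  \<open>q (Suc n)\<close> are the usual numerator and denominator of the convergent with index
  \<open>n\<close>.\<close>

fun p :: "nat \<Rightarrow> int" where
  "p 0 = 1" | "p (Suc 0) = k 0" | "p (Suc (Suc n)) = \<bar>k (Suc n)\<bar> * p (Suc n) + s n * s (Suc n) * p n"

fun q :: "nat \<Rightarrow> int" where
  "q 0 = 0" | "q (Suc 0) = 1" | "q (Suc (Suc n)) = \<bar>k (Suc n)\<bar> * q (Suc n) + s n * s (Suc n) * q n"

definition d :: "nat \<Rightarrow> real" where "d n = of_int (q n) * x - of_int (p n)"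

lemma s_cases: "s n = 1 \<or> s n = -1"
  using k_ne[of "n - 1"] by (cases n) (auto simp: s_def sgn_if)

lemma s_square: "s n * s n = 1" using s_cases[of n] by auto

text \<open>\<open>b\<close> differs from the nonzero integer \<open>k\<close> by less than
  1.\<close>

lemma sgn_b: "sgn (b (Suc n)) = of_int (s (Suc n))"
proof -
  have "\<bar>1 / b (Suc (Suc n))\<bar> < 1" using b_gt[of "Suc n"] by simp
  then have *: "-1 < 1 / b (Suc (Suc n))" "1 / b (Suc (Suc n)) < 1" by linarith+
  show ?thesis
  proof (cases "0 < k (Suc n)")
    case True
    then have "1 \<le> real_of_int (k (Suc n))" by simp
    then have "0 < b (Suc n)" using * unfolding b_eq[of "Suc n"] by linarith
    then show ?thesis using True by (simp add: s_def)
  next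
    case False
    then have k: "k (Suc n) < 0" using k_ne[of n] by linarith
    then have "k (Suc n) \<le> -1" by linarith
    then have "real_of_int (k (Suc n)) \<le> real_of_int (-1)" by (simp only: of_int_le_iff)
    then have "b (Suc n) < 0" using * unfolding b_eq[of "Suc n"] by simp
    then show ?thesis using k by (simp add: s_def)
  qed
qed

lemma d_rec: "d (Suc (Suc n)) = of_int \<bar>k (Suc n)\<bar> * d (Suc n) + of_int (s n * s (Suc n)) * d n"
  by (simp add: d_def algebra_simps)

text \<open>The classical relation between approximation errors and complete quotients; it yields
  both the decrease and the signs of the errors.\<close>

lemma d_Suc: "d (Suc n) = - of_int (s n) * d n / b (Suc n)"
proof (induction n)
  case 0
  have "x - of_int (k 0) = 1 / b (Suc 0)" using b_eq[of 0] unfolding b_0 by linarith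
  then show ?case by (simp add: d_def s_def)
next
  case (Suc n)
  have b0: "b (Suc n) \<noteq> 0" "b (Suc (Suc n)) \<noteq> 0" using b_gt[of n] b_gt[of "Suc n"] by auto
  have "of_int (s n) * d n = - b (Suc n) * d (Suc n)" using Suc b0 by (simp add: field_simps)
  then have "d (Suc (Suc n)) = (of_int \<bar>k (Suc n)\<bar> - of_int (s (Suc n)) * b (Suc n)) * d (Suc n)"
    unfolding d_rec of_int_mult by algebra
  also have "\<bar>k (Suc n)\<bar> = s (Suc n) * k (Suc n)" by (simp add: s_def abs_sgn mult.commute)
  then have "real_of_int \<bar>k (Suc n)\<bar> = of_int (s (Suc n)) * of_int (k (Suc n))"
    by (simp only: of_int_mult)
  also have "of_int (s (Suc n)) * of_int (k (Suc n)) - of_int (s (Suc n)) * b (Suc n)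
      = - of_int (s (Suc n)) / b (Suc (Suc n))"
    unfolding b_eq[of "Suc n"] by (simp add: algebra_simps)
  finally show ?case by simp
qed

lemma d_ne: "d n \<noteq> 0"
proof (induction n)
  case (Suc n)
  then show ?case using s_cases[of n] b_gt[of n] by (auto simp: d_Suc)
qed (simp add: d_def)

lemma d_less: "\<bar>d (Suc n)\<bar> < \<bar>d n\<bar>"
proof -
  have "\<bar>d (Suc n)\<bar> = \<bar>d n\<bar> / \<bar>b (Suc n)\<bar>"
    using s_cases[of n] by (auto simp: d_Suc abs_mult)
  also have "\<dots> < \<bar>d n\<bar>"
    using b_gt[of n] d_ne[of n] divide_strict_left_mono[of 1 "\<bar>b (Suc n)\<bar>" "\<bar>d n\<bar>"] by simp
  finally show ?thesis .
qed

lemma sgn_d: "sgn (d n) = - of_int ((-1) ^ n * s n)"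
proof (induction n)
  case (Suc n)
  have "sgn (d (Suc n)) = - of_int (s n) * sgn (d n) * of_int (s (Suc n))"
    using s_cases[of n] s_cases[of "Suc n"] sgn_b[of n]
    by (auto simp: d_Suc sgn_mult sgn_divide)
  then show ?case using Suc s_square[of n] by (auto simp: algebra_simps simp flip: of_int_mult)
qed (simp add: d_def s_def)

lemma d_signs: "of_int (s n * s (Suc n)) * d n * d (Suc n) < 0"
proof -
  have "sgn (of_int (s n * s (Suc n)) * d n * d (Suc n)) = -1"
    using s_cases[of n] s_cases[of "Suc n"] by (auto simp: sgn_mult sgn_d)
  then show ?thesis by (metis sgn_1_neg)
qed

lemma det: "p n * q (Suc n) - p (Suc n) * q n = 1 \<or> p n * q (Suc n) - p (Suc n) * q n = -1"
proof (induction n)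
  case (Suc n)
  have "p (Suc n) * q (Suc (Suc n)) - p (Suc (Suc n)) * q (Suc n)
      = - (s n * s (Suc n)) * (p n * q (Suc n) - p (Suc n) * q n)"
    by (simp add: algebra_simps)
  then show ?case using Suc s_cases[of n] s_cases[of "Suc n"] by auto
qed simp

lemma det_real: "\<bar>of_int (q (Suc n)) * d n - of_int (q n) * d (Suc n)\<bar> = 1"
proof -
  have "of_int (q (Suc n)) * d n - of_int (q n) * d (Suc n) = - of_int (p n * q (Suc n) - p (Suc n) * q n)"
    by (simp add: d_def algebra_simps)
  moreover have "\<bar>p n * q (Suc n) - p (Suc n) * q n\<bar> = 1" using det[of n] by linarith
  ultimately show ?thesis by (simp only: abs_minus_cancel of_int_abs[symmetric] of_int_1)
qed

end

text \<open>Law of best approximation: for \<open>q n \<le> r < q (Suc n)\<close> no error at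
  \<open>r\<close> is below \<open>|d n|\<close>. The determinant identity and bounded growth of
  \<open>q\<close> bound \<open>q n |d n|\<close> from below.\<close>

lemma badly_approximable_regular:
  assumes "expansion k b x" and pos: "\<And>n. 1 \<le> k (Suc n)" and le: "\<And>n. k (Suc n) \<le> B"
  shows "\<exists>c>0. \<forall>r\<ge>1. \<forall>t. c \<le> of_int r * \<bar>of_int r * x - of_int t\<bar>"
proof -
  interpret expansion k b x by fact
  have s: "s n = 1" for n using pos[of "n - 1"] by (cases n) (auto simp: s_def)
  have rec: "q (Suc (Suc n)) = k (Suc n) * q (Suc n) + q n" for n using pos[of n] s by simp
  have q: "0 \<le> q n \<and> q n \<le> q (Suc n) \<and> 1 \<le> q (Suc n)" for n
  proof (induction n)
    case (Suc n)
    have "1 * q (Suc n) \<le> k (Suc n) * q (Suc n)" using pos Suc by (intro mult_right_mono) auto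
    then show ?case using Suc unfolding rec[of n] by linarith
  qed simp
  have grow: "int n \<le> q (Suc n)" for n
  proof (induction n)
    case (Suc n)
    show ?case
    proof (cases n)
      case 0
      then show ?thesis using q[of 1] by simp
    next
      case m: (Suc m)
      have "1 * q (Suc n) \<le> k (Suc n) * q (Suc n)" using pos q[of n] by (intro mult_right_mono) auto
      moreover have "1 \<le> q n" using q[of m] m by simp
      ultimately show ?thesis using Suc unfolding rec[of n] by linarith
    qed
  qed simp
  \<comment> \<open>\<open>B + 2\<close> combines \<open>q (Suc n) \<le> (B + 1) q n\<close> with
    the second term \<open>q n |d (Suc n)| \<le> q n |d n|\<close>.\<close>
  define c where "c = 1 / (of_int B + 2 :: real)"
  have B: "1 \<le> B" using pos[of 0] le[of 0] by linarith
  then have c: "0 < c" by (simp add: c_def)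
  have "c \<le> of_int r * \<bar>of_int r * x - of_int t\<bar>" if r: "1 \<le> r" for r t
  proof -
    define n where "n = (LEAST n. r < q (Suc n))"
    have "r < q (Suc (nat r + 1))" using grow[of "nat r + 1"] r by linarith
    then have n1: "r < q (Suc n)" unfolding n_def by (rule LeastI)
    then have n0: "n \<noteq> 0" using r by (cases n) auto
    have n2: "q n \<le> r"
    proof (cases n)
      case (Suc m)
      have "\<not> r < q (Suc m)" using not_less_Least[of m "\<lambda>n. r < q (Suc n)"] Suc by (simp add: n_def)
      then show ?thesis using Suc by simp
    qed (use n0 in simp)
    obtain a e where ae: "r = a * q (Suc n) + e * q n" "t = a * p (Suc n) + e * p n"
      using unimodular_coordinates[OF det[of n]] by blast
    have dd: "of_int r * x - of_int t = of_int a * d (Suc n) + of_int e * d n"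
      by (simp add: ae d_def algebra_simps)
    have opp: "d n * d (Suc n) < 0" using d_signs[of n] s by simp
    have qn: "0 < q (Suc n)" "0 \<le> q n" using q[of n] by auto
    \<comment> \<open>The range of \<open>r\<close> makes the coordinates differ in sign unless
      \<open>a = 0\<close>. As consecutive errors also differ in sign, the two terms of
      \<open>r x - t\<close> cannot cancel.\<close>
    have ae2: "1 \<le> e \<and> a \<le> 0 \<or> e \<le> -1 \<and> 1 \<le> a"
    proof -
      have "e \<noteq> 0"
      proof
        assume "e = 0"
        then have "a * q (Suc n) < 1 * q (Suc n)" "0 < a * q (Suc n)" using ae(1) n1 r by auto
        then show False using qn by (simp only: mult_less_cancel_right zero_less_mult_iff) auto
      qed
      moreover have "a \<le> 0" if "1 \<le> e"
      proof (rule ccontr)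
        assume "\<not> a \<le> 0"
        then have "1 * q (Suc n) \<le> a * q (Suc n)" using qn by (intro mult_right_mono) auto
        moreover have "0 \<le> e * q n" using that qn by simp
        ultimately show False using ae(1) n1 by linarith
      qed
      moreover have "1 \<le> a" if "e \<le> -1"
      proof (rule ccontr)
        assume "\<not> 1 \<le> a"
        then have "a * q (Suc n) \<le> 0" using qn by (simp add: mult_nonpos_nonneg)
        moreover have "e * q n \<le> 0" using that qn by (simp add: mult_nonpos_nonneg)
        ultimately show False using ae(1) r by linarith
      qed
      ultimately show ?thesis by linarith
    qed
    have "\<bar>d n\<bar> \<le> \<bar>of_int a * d (Suc n) + of_int e * d n\<bar>"
    proof -
      have 1: "\<bar>of_int a * d (Suc n) + of_int e * d n\<bar> = \<bar>of_int a * d (Suc n)\<bar> + \<bar>of_int e * d n\<bar>"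
      proof -
        have "0 \<le> (of_int a * d (Suc n)) * (of_int e * d n)"
        proof -
          have "(of_int a * d (Suc n)) * (of_int e * d n) = of_int (a * e) * (d n * d (Suc n))" by simp
          moreover have "a * e \<le> 0" using ae2 by (auto simp: mult_le_0_iff)
          moreover have "0 \<le> real_of_int (a * e) * (d n * d (Suc n))"
            using \<open>a * e \<le> 0\<close> opp by (intro mult_nonpos_nonpos) (simp_all only: of_int_le_0_iff less_imp_le)
          ultimately show ?thesis by (simp only:)
        qed
        moreover have "\<bar>u + v\<bar> = \<bar>u\<bar> + \<bar>v\<bar>" if "0 \<le> u * v" for u v :: real
          using that by (auto simp: zero_le_mult_iff)
        ultimately show ?thesis by blast
      qed
      have "1 \<le> \<bar>real_of_int e\<bar>" using ae2 by linarith
      then have "1 * \<bar>d n\<bar> \<le> \<bar>real_of_int e\<bar> * \<bar>d n\<bar>" by (intro mult_right_mono) auto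
      then have "\<bar>d n\<bar> \<le> \<bar>of_int e * d n\<bar>" by (simp only: abs_mult mult_1)
      then show ?thesis unfolding 1 by (rule order_trans) simp
    qed
    then have dn: "\<bar>d n\<bar> \<le> \<bar>of_int r * x - of_int t\<bar>" by (simp only: dd)
    have "1 \<le> of_int (q (Suc n)) * \<bar>d n\<bar> + of_int (q n) * \<bar>d (Suc n)\<bar>"
    proof -
      have "\<bar>of_int (q (Suc n)) * d n\<bar> = of_int (q (Suc n)) * \<bar>d n\<bar>"
        "\<bar>of_int (q n) * d (Suc n)\<bar> = of_int (q n) * \<bar>d (Suc n)\<bar>"
        using qn by (simp_all add: abs_mult)
      then show ?thesis
        using det_real[of n] abs_triangle_ineq4[of "of_int (q (Suc n)) * d n" "of_int (q n) * d (Suc n)"]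
        by linarith
    qed
    also have "\<dots> \<le> of_int ((B + 1) * q n) * \<bar>d n\<bar> + of_int (q n) * \<bar>d n\<bar>"
    proof -
      obtain m where m: "n = Suc m" using n0 by (cases n) auto
      have "k (Suc m) * q (Suc m) \<le> B * q (Suc m)" using le q[of m] by (intro mult_right_mono) auto
      then have "q (Suc n) \<le> (B + 1) * q n"
        using q[of m] unfolding m rec[of m] distrib_right by linarith
      then have "real_of_int (q (Suc n)) \<le> of_int ((B + 1) * q n)" by (simp only: of_int_le_iff)
      then show ?thesis using less_imp_le[OF d_less[of n]] qn(2)
        by (intro add_mono mult_right_mono mult_left_mono) (simp_all only: abs_ge_zero of_int_0_le_iff)
    qed
    also have "\<dots> = (of_int B + 2) * (of_int (q n) * \<bar>d n\<bar>)"
      by (simp only: of_int_mult of_int_add of_int_1) (simp only: algebra_simps one_add_one[symmetric])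
    also have "\<dots> \<le> (of_int B + 2) * (of_int r * \<bar>of_int r * x - of_int t\<bar>)"
    proof (intro mult_left_mono mult_mono dn)
      show "real_of_int (q n) \<le> of_int r" using n2 by (simp only: of_int_le_iff)
    qed (use B r in simp_all)
    finally have "1 \<le> (of_int B + 2) * (of_int r * \<bar>of_int r * x - of_int t\<bar>)" .
    moreover have "0 < real_of_int B + 2" using B by simp
    ultimately show ?thesis unfolding c_def by (simp only: pos_divide_le_eq mult.commute)
  qed
  then show ?thesis using c by blast
qed

lemma abs_cfrac_ge_1:
  assumes "\<And>n. 2 \<le> \<bar>k n\<bar>" shows "1 \<le> \<bar>cfrac k n\<bar>"
  using assms
proof (induction n arbitrary: k)
  case 0
  have "2 \<le> \<bar>k 0\<bar>" by (rule 0)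
  then have "2 \<le> \<bar>real_of_int (k 0)\<bar>" by linarith
  then show ?case unfolding cfrac.simps by linarith
next
  case (Suc n)
  have "1 \<le> \<bar>cfrac (\<lambda>i. k (Suc i)) n\<bar>" by (rule Suc.IH) (rule Suc.prems)
  then have "\<bar>1 / cfrac (\<lambda>i. k (Suc i)) n\<bar> \<le> 1" by (simp add: divide_le_eq_1)
  moreover have "2 \<le> \<bar>real_of_int (k 0)\<bar>" using Suc.prems[of 0] by linarith
  ultimately show ?case unfolding cfrac.simps by linarith
qed

lemma cfrac_ge_1:
  assumes "\<And>n. 1 \<le> k n" shows "1 \<le> cfrac k n"
  using assms
proof (induction n arbitrary: k)
  case 0
  have "1 \<le> k 0" by (rule 0)
  then show ?case by simp
next
  case (Suc n)
  have "1 \<le> cfrac (\<lambda>i. k (Suc i)) n" by (rule Suc.IH) (rule Suc.prems)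
  then have "0 \<le> 1 / cfrac (\<lambda>i. k (Suc i)) n" by simp
  moreover have "1 \<le> real_of_int (k 0)" using Suc.prems[of 0] by linarith
  ultimately show ?case unfolding cfrac.simps by linarith
qed

lemma bounded_type_badly_approximable:
  assumes "bounded_type x"
  shows "\<exists>c>0. \<forall>r\<ge>1. \<forall>t. c \<le> of_int r * \<bar>of_int r * x - of_int t\<bar>"
proof -
  obtain a B where x: "x \<notin> \<rat>" and a: "\<And>i. 1 \<le> i \<Longrightarrow> 1 \<le> a i" "cfrac a \<longlonglongrightarrow> x" "\<And>i. \<bar>a i\<bar> \<le> B"
    using assms unfolding bounded_type_def regular_cf_expansion_def by blast
  have "1 \<le> \<bar>cfrac (\<lambda>i. a (i + Suc n)) j\<bar>" for n j
    using cfrac_ge_1[of "\<lambda>i. a (i + Suc n)" j] a(1) by simp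
  from tails_exist[OF a(2) x this] obtain b where
    b: "b 0 = x" "\<And>n. b n = of_int (a n) + 1 / b (Suc n)" "\<And>n. 1 < \<bar>b (Suc n)\<bar>" by blast
  have "expansion a b x"
  proof
    show "a (Suc n) \<noteq> 0" for n using a(1)[of "Suc n"] by simp
  qed (rule x b)+
  then show ?thesis
  proof (rule badly_approximable_regular)
    show "1 \<le> a (Suc n)" "a (Suc n) \<le> B" for n using a(1)[of "Suc n"] a(3)[of "Suc n"] by auto
  qed
qed

lemma even_expansion_exists:
  assumes "even_cf_expansion m x" "x \<notin> \<rat>"
  shows "\<exists>b. expansion (\<lambda>i. 2 * m i) b x"
proof -
  have m: "\<And>i. 1 \<le> i \<Longrightarrow> m i \<noteq> 0" "cfrac (\<lambda>i. 2 * m i) \<longlonglongrightarrow> x"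
    using assms by (auto simp: even_cf_expansion_def)
  have "1 \<le> \<bar>cfrac (\<lambda>i. 2 * m (i + Suc n)) j\<bar>" for n j
  proof (rule abs_cfrac_ge_1)
    show "2 \<le> \<bar>2 * m (i + Suc n)\<bar>" for i using m(1)[of "i + Suc n"] by simp
  qed
  from tails_exist[OF m(2) assms(2) this] obtain b where
    b: "b 0 = x" "\<And>n. b n = of_int (2 * m n) + 1 / b (Suc n)" "\<And>n. 1 < \<bar>b (Suc n)\<bar>" by blast
  have "expansion (\<lambda>i. 2 * m i) b x"
  proof
    show "2 * m (Suc n) \<noteq> 0" for n using m(1)[of "Suc n"] by simp
  qed (rule assms b)+
  then show ?thesis by blast
qed

section \<open>Occupation counts at convergent denominators\<close>

text \<open>Bounded type enters only through the constant \<open>c0\<close> of bad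
  approximability.\<close>

locale even_expansion = expansion "\<lambda>i. 2 * m i" b \<beta>
  for m :: "nat \<Rightarrow> int" and b :: "nat \<Rightarrow> real" and \<beta> :: real +
  fixes c0 :: real
  assumes c0: "0 < c0"
    and badly_approximable: "1 \<le> r \<Longrightarrow> c0 \<le> of_int r * \<bar>of_int r * \<beta> - of_int t\<bar>"
begin

lemma m_ge: "1 \<le> \<bar>m (Suc n)\<bar>"
  using k_ne[of n] by auto

lemma q_rec: "q (Suc (Suc n)) = 2 * \<bar>m (Suc n)\<bar> * q (Suc n) + s n * s (Suc n) * q n"
  by (simp add: abs_mult)

lemma p_rec: "p (Suc (Suc n)) = 2 * \<bar>m (Suc n)\<bar> * p (Suc n) + s n * s (Suc n) * p n"
  by (simp add: abs_mult)

lemma q_less: "0 \<le> q n \<and> q n < q (Suc n)"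
proof (induction n)
  case (Suc n)
  have "2 * 1 * q (Suc n) \<le> 2 * \<bar>m (Suc n)\<bar> * q (Suc n)"
    using m_ge Suc by (intro mult_right_mono mult_left_mono) auto
  moreover have "- q n \<le> s n * s (Suc n) * q n" using s_cases[of n] s_cases[of "Suc n"] Suc by auto
  ultimately show ?case using Suc unfolding q_rec by linarith
qed simp

lemma q_mono: "i \<le> j \<Longrightarrow> q i \<le> q j"
  by (rule lift_Suc_mono_le[of q]) (use q_less less_imp_le in blast)

lemma q_ge: "int n \<le> q n"
proof (induction n)
  case (Suc n)
  then show ?case using q_less[of n] by simp
qed simp

text \<open>Since the partial quotients are even, \<open>p + q\<close> keeps its parity over two
  steps, and it starts with odd values.\<close>

lemma odd_p_q: "odd (p n + q n)"
proof -
  have "odd (p n + q n) \<and> odd (p (Suc n) + q (Suc n))"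
  proof (induction n)
    case (Suc n)
    have "p (Suc (Suc n)) + q (Suc (Suc n))
        = 2 * (\<bar>m (Suc n)\<bar> * (p (Suc n) + q (Suc n))) + s n * s (Suc n) * (p n + q n)"
      unfolding p_rec q_rec by algebra
    moreover have "odd (s n * s (Suc n))" using s_cases[of n] s_cases[of "Suc n"] by auto
    ultimately show ?case using Suc by (simp only: even_add even_mult_iff) auto
  qed simp
  then show ?thesis ..
qed

lemma convergents: "convergents \<beta> (p n) (q n) (p (Suc n)) (q (Suc n)) \<bar>m (Suc n)\<bar> (s n * s (Suc n)) (d n) (d (Suc n))"
proof
  show "\<bar>2 * real_of_int \<bar>m (Suc n)\<bar> * d (Suc n) + of_int (s n * s (Suc n)) * d n\<bar> < \<bar>d (Suc n)\<bar>"
    using d_less[of "Suc n"] d_rec[of n] by (simp add: abs_mult)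
  show "s n * s (Suc n) = 1 \<or> s n * s (Suc n) = -1" using s_cases[of n] s_cases[of "Suc n"] by auto
qed (use x_irr det d_signs d_less odd_p_q q_less m_ge in \<open>simp_all add: d_def del: p.simps q.simps\<close>)

lemma Q2_eq: "convergents.Q2 (q n) (q (Suc n)) \<bar>m (Suc n)\<bar> (s n * s (Suc n)) = q (Suc (Suc n))"
  unfolding convergents.Q2_def[OF convergents] q_rec ..

definition \<tau> where "\<tau> n = walk \<beta> (q n - 1)"
definition c where "c n = sg \<beta> (q n)"

lemma c_eq: "c (Suc n) = (-1) ^ Suc n * s (Suc n)"
proof -
  interpret C: convergents \<beta> "p n" "q n" "p (Suc n)" "q (Suc n)" "\<bar>m (Suc n)\<bar>" "s n * s (Suc n)" "d n" "d (Suc n)"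
    by (rule convergents)
  have "real_of_int C.\<eta> = sgn (d (Suc n))" using C.d1_ne by (simp add: C.\<eta>_def)
  also have "\<dots> = of_int (- ((-1) ^ Suc n * s (Suc n)))" unfolding sgn_d by simp
  finally have "C.\<eta> = - ((-1) ^ Suc n * s (Suc n))" by (simp only: of_int_eq_iff)
  then show ?thesis using C.c_eq unfolding c_def C.c_def by simp
qed

lemma walk_q: "0 < n \<Longrightarrow> walk \<beta> (q n) = \<tau> n + c n"
  using walk_Suc[of "q n - 1" \<beta>] q_less[of "n - 1"] by (cases n) (simp_all add: \<tau>_def c_def del: q.simps)

text \<open>For equal signs \<open>s\<close>, \<open>walk_next_pos\<close> undoes the previous
  increment, in accordance with \<open>c\<close> changing sign. For opposite signs,
  \<open>walk_next_neg\<close> continues from the position at \<open>q (Suc n)\<close>.\<close>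

lemma \<tau>_Suc_Suc: "\<tau> (Suc (Suc n)) = \<tau> (Suc n) + c (Suc n)"
proof (induction n)
  case 0
  interpret C: convergents \<beta> "p 0" "q 0" "p (Suc 0)" "q (Suc 0)" "\<bar>m (Suc 0)\<bar>" "s 0 * s (Suc 0)" "d 0" "d (Suc 0)"
    by (rule convergents)
  have "\<tau> (Suc (Suc 0)) = C.c + walk \<beta> (q 0)"
    using C.walk_next_neg unfolding \<tau>_def Q2_eq by simp
  then show ?case unfolding c_def C.c_def by (simp add: \<tau>_def)
next
  case (Suc n)
  interpret C: convergents \<beta> "p (Suc n)" "q (Suc n)" "p (Suc (Suc n))" "q (Suc (Suc n))" "\<bar>m (Suc (Suc n))\<bar>"
      "s (Suc n) * s (Suc (Suc n))" "d (Suc n)" "d (Suc (Suc n))"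
    by (rule convergents)
  show ?case
  proof (cases "s (Suc n) * s (Suc (Suc n)) = 1")
    case True
    have "\<tau> (Suc (Suc (Suc n))) = \<tau> (Suc n)"
      using C.walk_next_pos[OF True] q_less[of n] unfolding \<tau>_def Q2_eq by simp
    moreover have "c (Suc (Suc n)) = - c (Suc n)"
      unfolding c_eq using True s_cases[of "Suc n"] by auto
    ultimately show ?thesis using Suc by simp
  next
    case False
    have "\<tau> (Suc (Suc (Suc n))) = C.c + walk \<beta> (q (Suc n))"
      using C.walk_next_neg C.sigma False unfolding \<tau>_def Q2_eq by blast
    then show ?thesis using walk_q[of "Suc n"] Suc unfolding c_def C.c_def by simp
  qed
qed

text \<open>By \<open>c_eq\<close> two consecutive increments of the centre are one summand; this
  brings in the sign sums of the theorem.\<close>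

lemma \<tau>_sum: "\<tau> (Suc (2 * n)) = (\<Sum>j=1..n. s (2 * j) - s (2 * j - 1))"
proof (induction n)
  case 0
  then show ?case by (simp add: \<tau>_def)
next
  case (Suc n)
  have "\<tau> (Suc (2 * Suc n)) = \<tau> (Suc (2 * n)) + c (Suc (2 * n)) + c (Suc (Suc (2 * n)))"
    using \<tau>_Suc_Suc[of "Suc (2 * n)"] \<tau>_Suc_Suc[of "2 * n"] by simp
  then show ?case using Suc unfolding c_eq by simp
qed

definition mu where "mu n = real_of_int \<bar>m (Suc n)\<bar>"
definition sig where "sig n = real_of_int (s n * s (Suc n))"
definition B where "B = 1 / (2 * c0) + 1"
definition K where "K = nat \<lceil>1 / c0\<rceil> + 1"

text \<open>The determinant identity, with \<open>|d (Suc n)|\<close> replaced by the larger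
  \<open>|d n|\<close>.\<close>

lemma gap_le: "of_int (q (Suc n) - q n) * \<bar>d n\<bar> \<le> 1"
proof -
  have a: "\<bar>of_int (q (Suc n)) * d n\<bar> = of_int (q (Suc n)) * \<bar>d n\<bar>" "\<bar>of_int (q n) * d (Suc n)\<bar> = of_int (q n) * \<bar>d (Suc n)\<bar>"
    using q_less[of n] by (simp_all add: abs_mult)
  have "of_int (q n) * \<bar>d (Suc n)\<bar> \<le> of_int (q n) * \<bar>d n\<bar>"
    using q_less[of n] d_less[of n] by (intro mult_left_mono) auto
  then show ?thesis
    using det_real[of n] abs_triangle_ineq2[of "of_int (q (Suc n)) * d n" "of_int (q n) * d (Suc n)"] a
    unfolding of_int_diff left_diff_distrib by linarith
qed

text \<open>A large \<open>|m|\<close> makes the gap after \<open>q (Suc n)\<close> a large multiple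
  of \<open>q (Suc n)\<close>; then \<open>gap_le\<close> would make
  \<open>q (Suc n) |d (Suc n)|\<close> smaller than \<open>c0\<close>.\<close>

lemma mu_le_B: "mu n \<le> B"
proof -
  have q1: "1 \<le> q (Suc n)" using q_ge[of "Suc n"] by linarith
  have "q (Suc (Suc n)) - q (Suc n) \<ge> (2 * \<bar>m (Suc n)\<bar> - 2) * q (Suc n)"
  proof -
    have "- q n \<le> s n * s (Suc n) * q n" using s_cases[of n] s_cases[of "Suc n"] q_less[of n] by auto
    then show ?thesis using q_less[of n] unfolding q_rec left_diff_distrib by linarith
  qed
  then have "real_of_int ((2 * \<bar>m (Suc n)\<bar> - 2) * q (Suc n)) \<le> of_int (q (Suc (Suc n)) - q (Suc n))"
    by (simp only: of_int_le_iff)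
  then have "real_of_int ((2 * \<bar>m (Suc n)\<bar> - 2) * q (Suc n)) * \<bar>d (Suc n)\<bar> \<le> 1"
    using gap_le[of "Suc n"] by (meson abs_ge_zero mult_right_mono order_trans)
  then have "(2 * mu n - 2) * (of_int (q (Suc n)) * \<bar>d (Suc n)\<bar>) \<le> 1"
    by (simp add: mu_def mult.assoc del: q.simps)
  moreover have "(2 * mu n - 2) * c0 \<le> (2 * mu n - 2) * (of_int (q (Suc n)) * \<bar>d (Suc n)\<bar>)"
    using badly_approximable[OF q1, of "p (Suc n)"] m_ge[of n] by (intro mult_left_mono) (auto simp: mu_def d_def)
  ultimately have "(2 * mu n - 2) * c0 \<le> 1" by linarith
  then show ?thesis using c0 by (simp add: B_def field_simps)
qed

text \<open>In a run with \<open>|m| = 1\<close> and \<open>\<sigma> = -1\<close> the errors form an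
  arithmetic progression of constant sign with difference \<open>\<Delta>\<close>, itself the error
  at the integer \<open>D\<close>. After \<open>K\<close> steps
  \<open>K |\<Delta>| \<le> |d n|\<close>, so bad approximability and \<open>gap_le\<close> give
  \<open>K c0 \<le> 1\<close>.\<close>

lemma window: "\<exists>i<K. 2 \<le> mu (n + i) \<or> sig (n + i) = 1"
proof (rule ccontr)
  assume neg: "\<not> ?thesis"
  have bad: "\<bar>m (Suc (n + i))\<bar> = 1 \<and> s (n + i) * s (Suc (n + i)) = -1" if "i < K" for i
  proof -
    have "\<not> 2 \<le> mu (n + i)" "sig (n + i) \<noteq> 1" using neg that by auto
    then show ?thesis using m_ge[of "n + i"] s_cases[of "n + i"] s_cases[of "Suc (n + i)"]
      by (auto simp: mu_def sig_def)
  qed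
  define D where "D = q (Suc n) - q n"
  define T where "T = p (Suc n) - p n"
  define \<Delta> where "\<Delta> = d (Suc n) - d n"
  have diff: "d (Suc (n + i)) - d (n + i) = \<Delta>" if "i < K" for i
    using that
  proof (induction i)
    case (Suc i)
    have "d (Suc (Suc (n + i))) = 2 * d (Suc (n + i)) - d (n + i)"
      unfolding d_rec abs_mult using bad[of i] Suc.prems by simp
    then show ?case using Suc by simp
  qed (simp add: \<Delta>_def)
  have dabs: "\<bar>d (n + i)\<bar> = \<bar>d n\<bar> - real i * \<bar>\<Delta>\<bar>" if "i \<le> K" for i
    using that
  proof (induction i)
    case (Suc i)
    have "of_int (s (n + i) * s (Suc (n + i))) * d (n + i) * d (Suc (n + i)) < 0" by (rule d_signs)
    then have "0 < d (n + i) * d (Suc (n + i))" using bad[of i] Suc.prems by simp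
    then have "\<bar>d (Suc (n + i))\<bar> = \<bar>d (n + i)\<bar> - \<bar>d (Suc (n + i)) - d (n + i)\<bar>"
      using d_less[of "n + i"] by (auto simp: zero_less_mult_iff)
    then show ?case using Suc diff[of i] by (simp add: algebra_simps)
  qed simp
  have D: "1 \<le> D" using q_less[of n] by (simp add: D_def)
  have "of_int D * \<beta> - of_int T = \<Delta>"
    unfolding D_def T_def \<Delta>_def d_def of_int_diff by algebra
  then have "c0 \<le> of_int D * \<bar>\<Delta>\<bar>"
    using badly_approximable[OF D, of T] by (simp only:)
  then have "real K * c0 \<le> real K * (of_int D * \<bar>\<Delta>\<bar>)" by (intro mult_left_mono) auto
  also have "\<dots> = of_int D * (real K * \<bar>\<Delta>\<bar>)" by simp
  also have "\<dots> \<le> of_int D * \<bar>d n\<bar>"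
  proof (intro mult_left_mono)
    show "real K * \<bar>\<Delta>\<bar> \<le> \<bar>d n\<bar>" using dabs[of K] by simp
  qed (use D in simp)
  also have "\<dots> \<le> 1" using gap_le[of n] by (simp add: D_def)
  finally have "real K \<le> 1 / c0" using c0 by (simp add: field_simps)
  moreover have "1 / c0 < real K" using c0 by (simp add: K_def) linarith
  ultimately show False by simp
qed

sublocale R: cf_recurrence mu sig B K
proof
  show "1 \<le> mu n" for n using m_ge[of n] by (simp add: mu_def)
  show "sig n = 1 \<or> sig n = - 1" for n using s_cases[of n] s_cases[of "Suc n"] by (auto simp: sig_def)
qed (rule mu_le_B window)+

lemma Q_eq: "R.H n 2 = of_int (q n)"
proof -
  have "R.H n 2 = of_int (q n) \<and> R.H (Suc n) 2 = of_int (q (Suc n))"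
  proof (induction n)
    case (Suc n)
    have "mu n * 2 * R.H (Suc n) 2 + sig n * R.H n 2
        = of_int (2 * \<bar>m (Suc n)\<bar> * q (Suc n) + s n * s (Suc n) * q n)"
      unfolding Suc[THEN conjunct1] Suc[THEN conjunct2] mu_def sig_def
      by (simp only: of_int_add of_int_mult of_int_numeral mult_ac)
    then show ?case using Suc unfolding q_rec R.H.simps(3) by blast
  qed simp
  then show ?thesis ..
qed

lemma occ_rec:
  "real (occ \<beta> (q (Suc (Suc n))) t) = mu n * (real (occ \<beta> (q (Suc n)) t)
    + real (occ \<beta> (q (Suc n)) (t - c (Suc n))))
    + sig n * real (occ \<beta> (q n) (if s n * s (Suc n) = 1 then t else t - c (Suc n)))"
proof -
  interpret C: convergents \<beta> "p n" "q n" "p (Suc n)" "q (Suc n)" "\<bar>m (Suc n)\<bar>" "s n * s (Suc n)" "d n" "d (Suc n)"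
    by (rule convergents)
  have c: "C.c = c (Suc n)" unfolding c_def C.c_def ..
  have "real_of_int (int (occ \<beta> (q (Suc (Suc n))) t)) = real_of_int (\<bar>m (Suc n)\<bar> * (int (occ \<beta> (q (Suc n)) t)
      + int (occ \<beta> (q (Suc n)) (t - c (Suc n))))
      + s n * s (Suc n) * int (occ \<beta> (q n) (if s n * s (Suc n) = 1 then t else t - c (Suc n))))"
    using C.occ_next[of t] unfolding Q2_eq c by (simp only:)
  then show ?thesis
    unfolding mu_def sig_def by (simp only: of_int_add of_int_mult of_int_of_nat_eq)
qed

text \<open>In the centred coordinate \<open>k = 2 t - \<tau>\<close> the levels \<open>t\<close>
  and \<open>t - c\<close> of \<open>occ_next\<close> become \<open>k + 1\<close> and
  \<open>k - 1\<close> in some order, which is the recurrence of \<open>coef\<close>.\<close>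

lemma occ_eq: "real (occ \<beta> (q n) t) = R.coef n (2 * t - \<tau> n)"
proof -
  have "(\<forall>t. real (occ \<beta> (q n) t) = R.coef n (2 * t - \<tau> n))
    \<and> (\<forall>t. real (occ \<beta> (q (Suc n)) t) = R.coef (Suc n) (2 * t - \<tau> (Suc n)))"
  proof (induction n)
    case 0
    then show ?case by (auto simp: \<tau>_def occ_1)
  next
    case (Suc n)
    interpret C: convergents \<beta> "p n" "q n" "p (Suc n)" "q (Suc n)" "\<bar>m (Suc n)\<bar>" "s n * s (Suc n)" "d n" "d (Suc n)"
      by (rule convergents)
    have "real (occ \<beta> (q (Suc (Suc n))) t) = R.coef (Suc (Suc n)) (2 * t - \<tau> (Suc (Suc n)))" for t
    proof -
      define k where "k = 2 * t - \<tau> (Suc (Suc n))"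
      have c1: "c (Suc n) = 1 \<or> c (Suc n) = -1" unfolding c_def by (rule sg_eq)
      have k: "2 * t - \<tau> (Suc n) = k + c (Suc n)" "2 * (t - c (Suc n)) - \<tau> (Suc n) = k - c (Suc n)"
        using \<tau>_Suc_Suc[of n] by (auto simp: k_def)
      note occ_rec[of n t]
      also have "real (occ \<beta> (q (Suc n)) t) + real (occ \<beta> (q (Suc n)) (t - c (Suc n)))
          = R.coef (Suc n) (k - 1) + R.coef (Suc n) (k + 1)"
        using c1 unfolding Suc[THEN conjunct2, rule_format] k by (elim disjE) simp_all
      \<comment> \<open>The centre moves by \<open>c n + c (Suc n)\<close> over two steps. This is 0
        for equal signs and \<open>2 * c (Suc n)\<close> for opposite ones, exactly what the shift
        of \<open>t\<close> compensates.\<close>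
      also have "real (occ \<beta> (q n) (if s n * s (Suc n) = 1 then t else t - c (Suc n))) = R.coef n k"
      proof (cases n)
        case 0
        then show ?thesis by simp
      next
        case (Suc i)
        have tn: "\<tau> (Suc n) = \<tau> n + c n" using \<tau>_Suc_Suc[of i] Suc by simp
        have cn: "c (Suc n) = - (s n * s (Suc n)) * c n"
          using c_eq[of n] c_eq[of i] s_square[of n] Suc by simp
        have "2 * (if s n * s (Suc n) = 1 then t else t - c (Suc n)) - \<tau> n = k"
          using C.sigma tn cn \<tau>_Suc_Suc[of n] by (auto simp: k_def)
        then show ?thesis using \<open>(\<forall>t. real (occ \<beta> (q n) t) = R.coef n (2 * t - \<tau> n)) \<and> _\<close> by (simp only:)
      qed
      finally show ?thesis unfolding k_def by simp
    qed
    then show ?case using Suc by blast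
  qed
  then show ?thesis by blast
qed

end

lemma tendsto_decay: "\<bar>r\<bar> < 1 \<Longrightarrow> (\<lambda>n. (real n + 1) * r ^ n) \<longlonglongrightarrow> 0"
  using tendsto_add[OF powser_times_n_limit_0[of r] LIMSEQ_power_zero[of r]]
  by (simp add: algebra_simps)

section \<open>Exponential decay away from the centre\<close>

context cf_recurrence
begin

lemma coef_decay:
  assumes "0 < \<eta>"
  shows "\<exists>\<kappa>. 0 < \<kappa> \<and> \<kappa> < 1 \<and> (\<forall>n k. \<eta> * real n \<le> of_int \<bar>k\<bar> \<longrightarrow> coef n k \<le> \<kappa> ^ n * Q n)"
proof -
  obtain C where C: "0 < C" "\<And>n x. 2 \<le> x \<Longrightarrow> H n x \<le> exp (C * (x - 2) * real n) * Q n"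
    using H_le_exp by blast
  \<comment> \<open>Chernoff bound at \<open>w = 1 + s\<close>: the gain per unit of
    \<open>n\<close> is \<open>s \<eta> / 2\<close>, the cost \<open>C s^2\<close>, and
    \<open>C s \<le> \<eta> / 4\<close> leaves half of the gain.\<close>
  define s where "s = min (1/2) (\<eta> / (4 * C))"
  have s: "0 < s" "s \<le> 1/2" "C * s \<le> \<eta> / 4" using assms C by (auto simp: s_def min_def field_simps)
  define w where "w = 1 + s"
  have l: "s / 2 \<le> ln w"
  proof -
    have "s - s\<^sup>2 \<le> ln (1 + s)" using ln_one_plus_pos_lower_bound[of s] s by auto
    moreover have "s\<^sup>2 \<le> s / 2" using s by (simp add: power2_eq_square)
    ultimately show ?thesis unfolding w_def by linarith
  qed
  have w0: "w + 1 / w - 2 = s\<^sup>2 / w" using s by (simp add: w_def field_simps power2_eq_square)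
  then have w2: "2 \<le> w + 1 / w" "w + 1 / w - 2 \<le> s\<^sup>2"
    using s by (auto simp: w_def field_simps)
  define \<kappa> where "\<kappa> = exp (- (\<eta> * s / 4))"
  have "coef n k \<le> \<kappa> ^ n * Q n" if k: "\<eta> * real n \<le> of_int \<bar>k\<bar>" for n k
  proof -
    have "exp (s / 2 * (\<eta> * n)) \<le> exp (ln w * of_int \<bar>k\<bar>)"
      using l k s assms by (intro iffD2[OF exp_le_cancel_iff] mult_mono) auto
    also have "\<dots> = w powi \<bar>k\<bar>"
      using s by (simp add: w_def powr_def mult.commute flip: powr_real_of_int')
    finally have "coef n k * exp (s / 2 * (\<eta> * n)) \<le> coef n k * w powi \<bar>k\<bar>"
      using coef_nonneg by (intro mult_left_mono)
    also have "\<dots> \<le> H n (w + 1 / w)" using s by (intro coef_chernoff) (simp add: w_def)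
    also have "\<dots> \<le> exp (C * (w + 1 / w - 2) * real n) * Q n" by (rule C(2)[OF w2(1)])
    also have "\<dots> \<le> exp (\<eta> * s / 4 * real n) * Q n"
    proof (intro mult_right_mono iffD2[OF exp_le_cancel_iff])
      have "C * (w + 1 / w - 2) \<le> C * s\<^sup>2" using w2 C by (intro mult_left_mono) auto
      also have "\<dots> = C * s * s" by (simp add: power2_eq_square)
      also have "\<dots> \<le> \<eta> / 4 * s" using s by (intro mult_right_mono) auto
      finally show "C * (w + 1 / w - 2) \<le> \<eta> * s / 4" by simp
    qed (use Q_nonneg in auto)
    finally have "coef n k \<le> exp (\<eta> * s / 4 * real n) / exp (s / 2 * (\<eta> * n)) * Q n"
      by (simp add: field_simps)
    also have "exp (\<eta> * s / 4 * real n) / exp (s / 2 * (\<eta> * n)) = \<kappa> ^ n"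
      by (simp add: \<kappa>_def algebra_simps flip: exp_of_nat_mult exp_diff)
    finally show ?thesis .
  qed
  then show ?thesis using assms s by (intro exI[of _ \<kappa>]) (auto simp: \<kappa>_def)
qed

lemma coef_eq_0: "int n < \<bar>k\<bar> \<Longrightarrow> coef n k = 0"
  by (induction n k rule: coef.induct) auto

end

section \<open>Flatness at all times and a frequently visited level\<close>

context even_expansion
begin

lemma occ_le: "real (occ \<beta> N t) \<le> real_of_int N" if "0 \<le> N"
proof -
  have "occ \<beta> N t \<le> card {0..<N}" unfolding occ_def by (intro card_mono) auto
  then show ?thesis using that by simp
qed

text \<open>Induction by \<open>flat_occ\<close>: the walk up to \<open>N\<close> consists of full
  blocks, governed by \<open>coef_flat\<close>, and a shorter remainder. Each scale adds an error of
  the same order, whence the factor \<open>n + 1\<close>.\<close>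

lemma walk_flat:
  assumes e: "0 < \<epsilon>" "\<epsilon> < 1"
  shows "\<exists>\<theta>. 0 < \<theta> \<and> \<theta> < 1 \<and> (\<exists>C>0. \<forall>n N. 0 \<le> N \<longrightarrow> N \<le> q (Suc n) \<longrightarrow>
    flat \<epsilon> (C * (real n + 1) * \<theta> ^ n * of_int (q (Suc n))) (\<lambda>t. occ \<beta> N t))"
proof -
  obtain \<theta>0 C where t0: "0 < \<theta>0" "\<theta>0 < 1" "0 < C"
    and fl: "\<And>n k. (1 - \<epsilon>) * R.coef n k \<le> R.coef n (k + 2) + C * \<theta>0 ^ n * R.H n 2
      \<and> (1 - \<epsilon>) * R.coef n k \<le> R.coef n (k - 2) + C * \<theta>0 ^ n * R.H n 2"
    using R.coef_flat[OF e] by blast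
  obtain \<rho> where rho: "1 < \<rho>" "\<And>n. \<rho> * R.H n 2 \<le> R.H (Suc n) 2" using R.Q_growth by blast
  \<comment> \<open>At least \<open>1 / \<rho>\<close>, so that
    \<open>q n \<le> \<theta> q (Suc n)\<close> and errors inherited from smaller scales decay at
    the same rate.\<close>
  define \<theta> where "\<theta> = max \<theta>0 (1 / \<rho>)"
  have th: "0 < \<theta>" "\<theta> < 1" "\<theta>0 \<le> \<theta>" using t0 rho by (auto simp: \<theta>_def less_max_iff_disj)
  have qt: "real_of_int (q n) \<le> \<theta> * of_int (q (Suc n))" for n
  proof -
    have "real_of_int (q n) \<le> 1 / \<rho> * of_int (q (Suc n))"
      using rho(2)[of n] rho(1) unfolding Q_eq by (simp add: field_simps)
    also have "\<dots> \<le> \<theta> * of_int (q (Suc n))"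
      using q_less[of n] by (intro mult_right_mono) (auto simp: \<theta>_def)
    finally show ?thesis .
  qed
  have base: "flat \<epsilon> (C * \<theta> ^ n * of_int (q n)) (\<lambda>t. occ \<beta> (q n) t)" for n
  proof -
    have le: "C * \<theta>0 ^ n * of_int (q n) \<le> C * \<theta> ^ n * of_int (q n)"
      using t0 th q_less[of n] by (intro mult_right_mono mult_left_mono power_mono) auto
    have e: "2 * (t + 1) - \<tau> n = 2 * t - \<tau> n + 2" "2 * (t - 1) - \<tau> n = 2 * t - \<tau> n - 2" for t by auto
    then have "flat \<epsilon> (C * \<theta>0 ^ n * of_int (q n)) (\<lambda>t. occ \<beta> (q n) t)"
      unfolding flat_def occ_eq e using fl[of n] unfolding Q_eq by blast
    then show ?thesis by (rule flat_mono[OF _ le])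
  qed
  define D where "D = max 1 (2 * B * C)"
  have D: "1 \<le> D" "2 * B * C \<le> D" by (auto simp: D_def)
  have "flat \<epsilon> (D * (real n + 1) * \<theta> ^ n * of_int (q (Suc n))) (\<lambda>t. occ \<beta> N t)"
    if "0 \<le> N" "N \<le> q (Suc n)" for n N
    using that
  proof (induction n arbitrary: N)
    case 0
    have "(1 - \<epsilon>) * real (occ \<beta> N t) \<le> 1 * 1" for t
      using occ_le[of N t] 0 e by (intro mult_mono) auto
    then have "flat \<epsilon> 1 (\<lambda>t. occ \<beta> N t)" unfolding flat_def
      by (metis add.commute add_increasing2 mult_1 of_nat_0_le_iff)
    then show ?case by (rule flat_mono) (use D in simp)
  next
    case (Suc n)
    interpret C: convergents \<beta> "p n" "q n" "p (Suc n)" "q (Suc n)" "\<bar>m (Suc n)\<bar>" "s n * s (Suc n)" "d n" "d (Suc n)"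
      by (rule convergents)
    define W where "W = D * (real n + 1) * \<theta> ^ n * of_int (q (Suc n))"
    have fl2: "flat \<epsilon> (of_int (2 * \<bar>m (Suc n)\<bar>) * (C * \<theta> ^ Suc n * of_int (q (Suc n))) + W) (\<lambda>t. occ \<beta> N t)"
    proof (rule C.flat_occ[OF base])
      show "0 \<le> C * \<theta> ^ Suc n * of_int (q (Suc n))" using t0 th q_less[of "Suc n"] by simp
      show "flat \<epsilon> W (\<lambda>t. real (occ \<beta> r t))" if "0 \<le> r" "r < q (Suc n)" for r
        unfolding W_def using that by (intro Suc.IH) auto
      show "N \<le> C.Q2" using Suc.prems unfolding Q2_eq by simp
    qed (use Suc.prems in simp)
    have 1: "of_int (2 * \<bar>m (Suc n)\<bar>) * (C * \<theta> ^ Suc n * of_int (q (Suc n)))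
        \<le> D * \<theta> ^ Suc n * of_int (q (Suc (Suc n)))"
    proof -
      have "of_int (2 * \<bar>m (Suc n)\<bar>) * (C * \<theta> ^ Suc n * of_int (q (Suc n)))
          = (2 * mu n * C) * (\<theta> ^ Suc n * of_int (q (Suc n)))" by (simp add: mu_def)
      also have "\<dots> \<le> (2 * B * C) * (\<theta> ^ Suc n * of_int (q (Suc (Suc n))))"
        using mu_le_B[of n] R.mu_ge[of n] t0 th q_less[of "Suc n"]
        by (intro mult_mono) (auto simp del: q.simps)
      also have "\<dots> \<le> D * (\<theta> ^ Suc n * of_int (q (Suc (Suc n))))"
        using D th q_less[of "Suc n"] by (intro mult_right_mono) (auto simp del: q.simps)
      finally show ?thesis by (simp only: mult.assoc)
    qed
    have "W \<le> D * (real n + 1) * \<theta> ^ n * (\<theta> * of_int (q (Suc (Suc n))))"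
      unfolding W_def using D th qt by (intro mult_left_mono) (auto simp del: q.simps)
    then have 2: "W \<le> D * (real n + 1) * \<theta> ^ Suc n * of_int (q (Suc (Suc n)))" by (simp only: power_Suc mult_ac)
    have "D * (real (Suc n) + 1) * \<theta> ^ Suc n * of_int (q (Suc (Suc n)))
       = D * (real n + 1) * \<theta> ^ Suc n * of_int (q (Suc (Suc n))) + D * \<theta> ^ Suc n * of_int (q (Suc (Suc n)))"
      unfolding of_nat_Suc by algebra
    then show ?case using flat_mono[OF fl2] 1 2 by simp
  qed
  then show ?thesis using th D by (intro exI[of _ \<theta>] conjI exI[of _ D]) auto
qed

text \<open>Pigeonhole: since \<open>coef n k\<close> vanishes for \<open>|k| > n\<close>, at most
  \<open>n + 1\<close> levels share the \<open>q n\<close> visits.\<close>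

lemma popular_level: "\<exists>t. real_of_int (q n) \<le> (real n + 1) * occ \<beta> (q n) t \<and> \<bar>2 * t - \<tau> n\<bar> \<le> int n"
proof -
  define S where "S = {r. 0 \<le> r \<and> r < q n}"
  define U where "U = {t. \<bar>2 * t - \<tau> n\<bar> \<le> int n}"
  have nz: "walk \<beta> ` S \<subseteq> U"
  proof
    fix t assume "t \<in> walk \<beta> ` S"
    then have "{r. 0 \<le> r \<and> r < q n \<and> walk \<beta> r = t} \<noteq> {}" by (auto simp: S_def)
    then have "occ \<beta> (q n) t \<noteq> 0" using occ_finite[of "q n" "\<lambda>r. walk \<beta> r = t"] by (simp add: occ_def)
    then have "R.coef n (2 * t - \<tau> n) \<noteq> 0" using occ_eq[of n t] by simp
    then show "t \<in> U" using R.coef_eq_0[of n "2 * t - \<tau> n"] unfolding U_def by fastforce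
  qed
  have inj: "inj_on (\<lambda>t. (2 * t - \<tau> n + int n) div 2) U"
    by (rule inj_onI) presburger
  have im: "(\<lambda>t. (2 * t - \<tau> n + int n) div 2) ` U \<subseteq> {0..int n}"
    by (auto simp: U_def)
  have U: "finite U" "card U \<le> n + 1"
    using inj_on_finite[OF inj im] card_inj_on_le[OF inj im] by auto
  have fS: "finite S" using occ_finite[of "q n" "\<lambda>_. True"] by (simp add: S_def)
  have "S = {0..<q n}" by (auto simp: S_def)
  then have "int (card S) = q n" using q_less[of n] by simp
  have "card S = (\<Sum>t\<in>U. card {r \<in> S. walk \<beta> r = t})"
    using sum.group[OF fS U(1) nz, of "\<lambda>_. 1::nat"] by simp
  also have "\<dots> = (\<Sum>t\<in>U. occ \<beta> (q n) t)" unfolding occ_def S_def by (intro sum.cong refl arg_cong[of _ _ card]) auto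
  finally have sum: "q n = (\<Sum>t\<in>U. int (occ \<beta> (q n) t))" using \<open>int (card S) = q n\<close> by simp
  show ?thesis
  proof (rule ccontr)
    assume neg: "\<not> ?thesis"
    have lt: "(real n + 1) * occ \<beta> (q n) t < real_of_int (q n)" if "t \<in> U" for t
      using neg that by (auto simp: U_def not_le)
    have "U \<noteq> {}"
    proof
      assume "U = {}"
      then have "q n = 0" using sum by simp
      then have "n = 0" using q_ge[of n] by simp
      then have "\<tau> n = 0" by (simp add: \<tau>_def walk_def)
      then have "0 \<in> U" by (simp add: U_def)
      then show False using \<open>U = {}\<close> by simp
    qed
    have "(real n + 1) * of_int (q n) = (\<Sum>t\<in>U. (real n + 1) * occ \<beta> (q n) t)"
      by (subst sum) (simp add: sum_distrib_left)
    also have "\<dots> < (\<Sum>t\<in>U. real_of_int (q n))" using U \<open>U \<noteq> {}\<close> lt by (intro sum_strict_mono) auto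
    also have "\<dots> = real (card U) * of_int (q n)" by simp
    also have "\<dots> \<le> (real n + 1) * of_int (q n)"
      using U(2) q_less[of n] by (intro mult_right_mono) auto
    finally show False by simp
  qed
qed

end

section \<open>Equidistribution\<close>

text \<open>The absolute errors form a geometric series bounded by \<open>2 * b\<close>.\<close>

lemma flat_iterate_right:
  assumes "flat (1/2) b f" "0 \<le> b"
  shows "(1/2) ^ j * f t - 2 * b \<le> f (t + int j)"
proof (induction j)
  case (Suc j)
  have "(1 - 1/2) * f (t + int j) \<le> f (t + int j + 1) + b" using assms unfolding flat_def by blast
  then show ?case using Suc by (simp add: algebra_simps)
qed (use assms in simp)

lemma flat_iterate:
  assumes "flat (1/2) b f" "0 \<le> b"
  shows "(1/2) ^ nat \<bar>t' - t\<bar> * f t - 2 * b \<le> f t'"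
proof (cases "t \<le> t'")
  case True
  then show ?thesis using flat_iterate_right[OF assms, of "nat (t' - t)" t] by simp
next
  case False
  have "flat (1/2) b (\<lambda>t. f (-1 * (t - 0)))" using assms(1) by (rule flat_reflect) simp
  from flat_iterate_right[OF this assms(2), of "nat (t - t')" "- t"] False show ?thesis by simp
qed

lemma ratio_tendsto_1:
  fixes f g :: "nat \<Rightarrow> real"
  assumes pos: "eventually (\<lambda>n. 0 < f n) sequentially" "eventually (\<lambda>n. 0 < g n) sequentially"
    and le: "\<And>\<epsilon>. 0 < \<epsilon> \<Longrightarrow> \<epsilon> < 1 \<Longrightarrow> eventually (\<lambda>n. (1 - \<epsilon>) * f n \<le> g n) sequentially"
      "\<And>\<epsilon>. 0 < \<epsilon> \<Longrightarrow> \<epsilon> < 1 \<Longrightarrow> eventually (\<lambda>n. (1 - \<epsilon>) * g n \<le> f n) sequentially"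
  shows "(\<lambda>n. f n / g n) \<longlonglongrightarrow> 1"
proof (rule order_tendstoI)
  fix a :: real assume a: "a < 1"
  define \<epsilon> where "\<epsilon> = min (1/2) ((1 - a) / 2)"
  have e: "0 < \<epsilon>" "\<epsilon> < 1" "a < 1 - \<epsilon>" using a by (auto simp: \<epsilon>_def min_def field_simps)
  show "eventually (\<lambda>n. a < f n / g n) sequentially"
    using le(2)[OF e(1,2)] pos(2)
  proof eventually_elim
    case (elim n)
    then have "1 - \<epsilon> \<le> f n / g n" by (simp add: field_simps)
    then show ?case using e by linarith
  qed
next
  fix a :: real assume a: "1 < a"
  define \<epsilon> where "\<epsilon> = (a - 1) / (2 * a)"
  have e: "0 < \<epsilon>" "\<epsilon> < 1" "1 < a * (1 - \<epsilon>)" using a by (auto simp: \<epsilon>_def field_simps)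
  show "eventually (\<lambda>n. f n / g n < a) sequentially"
    using le(1)[OF e(1,2)] pos
  proof eventually_elim
    case (elim n)
    have "1 * f n < a * (1 - \<epsilon>) * f n" using e(3) elim by (intro mult_strict_right_mono)
    also have "\<dots> \<le> a * g n" using elim a by (simp add: mult.assoc)
    finally show ?case using elim by (simp add: field_simps)
  qed
qed

lemma contraction_tendsto_0:
  fixes e x :: "nat \<Rightarrow> real"
  assumes e: "\<And>n. 0 \<le> e n" and a: "0 \<le> a" "a < 1" and x: "x \<longlonglongrightarrow> 0"
    and rec: "eventually (\<lambda>n. e (Suc n) \<le> x n + a * e n) sequentially"
  shows "e \<longlonglongrightarrow> 0"
proof (rule LIMSEQ_I)
  fix r :: real assume r: "0 < r"
  \<comment> \<open>Makes \<open>r / 2\<close> the fixed point of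
    \<open>z \<mapsto> y + a * z\<close>.\<close>
  define y where "y = r / 2 * (1 - a)"
  have y: "0 < y" using r a by (simp add: y_def)
  obtain n0 where n0: "\<And>n. n0 \<le> n \<Longrightarrow> e (Suc n) \<le> x n + a * e n" "\<And>n. n0 \<le> n \<Longrightarrow> x n < y"
    using rec order_tendstoD(2)[OF x y] unfolding eventually_sequentially by (metis linorder_linear order_trans)
  have it: "e (n0 + j) \<le> r / 2 + a ^ j * e n0" for j
  proof (induction j)
    case (Suc j)
    have "e (n0 + Suc j) \<le> y + a * e (n0 + j)" using n0[of "n0 + j"] by simp
    also have "\<dots> \<le> y + a * (r / 2 + a ^ j * e n0)" using Suc a by (intro add_left_mono mult_left_mono) auto
    also have "\<dots> = r / 2 + a ^ Suc j * e n0" by (simp add: y_def field_simps)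
    finally show ?case .
  qed (use r in simp)
  have "(\<lambda>j. a ^ j * e n0) \<longlonglongrightarrow> 0" using a by (intro tendsto_mult_left_zero LIMSEQ_power_zero) simp
  then have "eventually (\<lambda>j. a ^ j * e n0 < r / 2) sequentially" using r by (intro order_tendstoD(2)) auto
  then obtain j0 where j0: "\<And>j. j0 \<le> j \<Longrightarrow> a ^ j * e n0 < r / 2" unfolding eventually_sequentially by blast
  show "\<exists>no. \<forall>n\<ge>no. norm (e n - 0) < r"
  proof (intro exI allI impI)
    fix n assume n: "n0 + j0 \<le> n"
    then have "j0 \<le> n - n0" by simp
    then have "e n < r" using it[of "n - n0"] j0[of "n - n0"] n by fastforce
    then show "norm (e n - 0) < r" using e[of n] by simp
  qed
qed

section \<open>Sublinear centre and equidistribution of the walk\<close>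

context even_expansion
begin

lemma q_Suc_le: "0 < n \<Longrightarrow> real_of_int (q (Suc n)) \<le> (2 * B + 1) * of_int (q n)"
  using R.Q_Suc_le[of n] unfolding Q_eq by simp

text \<open>A popular level \<open>u\<close> lies within \<open>2 \<eta> n\<close> of
  \<open>t\<close>, because \<open>u\<close>, the centre and \<open>t\<close> are all close to 0 on
  the scale \<open>n\<close>. Flatness with factor 1/2 carries its visits over to \<open>t\<close>
  at a small exponential loss.\<close>

lemma occ_lower:
  assumes tau: "(\<lambda>n. real_of_int (\<tau> n) / real n) \<longlonglongrightarrow> 0" and l: "0 < \<kappa>" "\<kappa> < 1"
  shows "eventually (\<lambda>n. \<kappa> ^ n * real_of_int (q n) \<le> real (occ \<beta> (q n) t)) sequentially"
proof -
  obtain \<theta> C where th: "0 < \<theta>" "\<theta> < 1" "0 < C" and fl: "\<And>n N. 0 \<le> N \<Longrightarrow> N \<le> q (Suc n) \<Longrightarrow>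
      flat (1/2) (C * (real n + 1) * \<theta> ^ n * of_int (q (Suc n))) (\<lambda>t. occ \<beta> N t)"
    using walk_flat[of "1/2"] by auto
  \<comment> \<open>The fourth root separates the scales: the transfer to \<open>t\<close> loses
    \<open>(r ^ 2) ^ n\<close>, while the error and the required bound are of order
    \<open>(r ^ 4) ^ n\<close>.\<close>
  define r where "r = root 4 (max \<kappa> \<theta>)"
  have r: "0 < r" "r < 1" "r ^ 4 = max \<kappa> \<theta>" using l th by (auto simp: r_def less_max_iff_disj)
  \<comment> \<open>Chosen so that halving \<open>2 \<eta> n\<close> times costs exactly
    \<open>(r ^ 2) ^ n\<close>.\<close>
  define \<eta> where "\<eta> = log 2 (1 / r)"
  have eta: "0 < \<eta>" using r by (simp add: \<eta>_def)
  have eta2: "2 powr (- (2 * \<eta> * n)) = (r ^ 2) ^ n" for n :: nat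
  proof -
    have "2 powr (- \<eta>) = r" using r by (simp add: \<eta>_def log_divide)
    moreover have "2 powr (- (2 * \<eta> * n)) = (2 powr (- \<eta>)) powr (real (2 * n))"
      by (simp add: powr_powr algebra_simps)
    ultimately show ?thesis using r by (simp only: powr_realpow power_mult)
  qed
  obtain \<nu> where nu: "0 < \<nu>" "\<nu> < 1" and decay: "\<And>n k. \<eta> * real n \<le> of_int \<bar>k\<bar> \<Longrightarrow> R.coef n k \<le> \<nu> ^ n * R.H n 2"
    using R.coef_decay[OF eta] by blast
  \<comment> \<open>The first summand pays for the flatness errors, the summand 1 for the desired
    bound \<open>\<kappa> ^ n * q n\<close>.\<close>
  define D where "D = 2 * (C * (2 * B + 1)) + 1"
  have D: "0 < D" using th R.B_ge by (simp add: D_def add_pos_pos)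
  have 1: "eventually (\<lambda>n. (real n + 1) * \<nu> ^ n < 1) sequentially"
    by (rule order_tendstoD(2)[OF tendsto_decay]) (use nu in auto)
  have 2: "eventually (\<lambda>n. \<bar>of_int (\<tau> n) / real n\<bar> < \<eta>) sequentially"
    using tendsto_rabs[OF tau] eta by (intro order_tendstoD(2)) auto
  have 3: "eventually (\<lambda>n. \<bar>of_int t / real n\<bar> < \<eta>) sequentially"
    using tendsto_rabs[OF lim_const_over_n[of "of_int t"]] eta by (intro order_tendstoD(2)) auto
  have "(\<lambda>n. D * ((real n + 1) * r ^ n)\<^sup>2) \<longlonglongrightarrow> D * 0\<^sup>2"
    using r by (intro tendsto_intros tendsto_decay) auto
  then have 4: "eventually (\<lambda>n. D * ((real n + 1) * r ^ n)\<^sup>2 < 1) sequentially"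
    by (intro order_tendstoD(2)) auto
  show ?thesis using 1 2 3 4 eventually_gt_at_top[of 0]
  proof eventually_elim
    case (elim n)
    have qn: "0 < real_of_int (q n)" using q_ge[of n] elim by simp
    obtain u where u: "of_int (q n) \<le> (real n + 1) * occ \<beta> (q n) u" using popular_level by blast
    \<comment> \<open>Otherwise \<open>decay\<close> would leave \<open>u\<close> fewer than
      \<open>q n / (n + 1)\<close> visits.\<close>
    have close: "\<bar>real_of_int (2 * u - \<tau> n)\<bar> < \<eta> * n"
    proof (rule ccontr)
      assume "\<not> ?thesis"
      then have "real (occ \<beta> (q n) u) \<le> \<nu> ^ n * of_int (q n)"
        using decay[of n "2 * u - \<tau> n"] unfolding occ_eq Q_eq by simp
      then have "(real n + 1) * real (occ \<beta> (q n) u) \<le> (real n + 1) * (\<nu> ^ n * of_int (q n))"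
        by (intro mult_left_mono) auto
      also have "\<dots> = (real n + 1) * \<nu> ^ n * of_int (q n)" by simp
      also have "\<dots> < 1 * of_int (q n)" using elim(1) qn by (intro mult_strict_right_mono)
      finally show False using u by simp
    qed
    have "\<bar>real_of_int (\<tau> n)\<bar> < \<eta> * n" "\<bar>real_of_int t\<bar> < \<eta> * n"
      using elim by (simp_all add: field_simps)
    then have "\<bar>real_of_int (t - u)\<bar> \<le> 2 * \<eta> * n" using close by simp
    then have j: "real (nat \<bar>t - u\<bar>) \<le> 2 * \<eta> * n" by simp
    have "(r ^ 2) ^ n \<le> 2 powr (- real (nat \<bar>t - u\<bar>))"
      unfolding eta2[symmetric] using j by simp
    also have "2 powr (- real j) = (1/2) ^ j" for j :: nat
      by (simp add: powr_minus powr_realpow power_one_over inverse_eq_divide)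
    finally have j2: "(r ^ 2) ^ n \<le> (1/2) ^ nat \<bar>t - u\<bar>" .
    define W where "W = C * (real n + 1) * \<theta> ^ n * of_int (q (Suc n))"
    have W: "0 \<le> W" "2 * W \<le> (D - 1) * (real n + 1) * (r ^ 4) ^ n * of_int (q n)"
    proof -
      show "0 \<le> W" unfolding W_def using th q_less[of n] by (intro mult_nonneg_nonneg) auto
      have "W \<le> C * (real n + 1) * (r ^ 4) ^ n * ((2 * B + 1) * of_int (q n))"
        unfolding W_def using th q_Suc_le[of n] elim q_less[of n] r(3)
        by (intro mult_mono power_mono) (auto simp: less_max_iff_disj)
      then show "2 * W \<le> (D - 1) * (real n + 1) * (r ^ 4) ^ n * of_int (q n)" by (simp add: D_def algebra_simps)
    qed
    have "(1/2) ^ nat \<bar>t - u\<bar> * real (occ \<beta> (q n) u) - 2 * W \<le> real (occ \<beta> (q n) t)"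
      using flat_iterate[OF fl[of "q n" n], folded W_def, OF _ _ W(1), of t u] q_less[of n] by simp
    moreover have "(r ^ 2) ^ n * (of_int (q n) / (real n + 1)) \<le> (1/2) ^ nat \<bar>t - u\<bar> * real (occ \<beta> (q n) u)"
      using j2 u qn by (intro mult_mono) (auto simp: field_simps)
    moreover have "D * (real n + 1) * (r ^ 4) ^ n * of_int (q n) \<le> (r ^ 2) ^ n * (of_int (q n) / (real n + 1))"
    proof -
      have "D * (real n + 1) * (r ^ 4) ^ n * (real n + 1) = D * ((real n + 1) * r ^ n)\<^sup>2 * (r ^ 2) ^ n"
        by (simp add: power2_eq_square power_mult_distrib eval_nat_numeral)
      also have "\<dots> \<le> 1 * (r ^ 2) ^ n" using elim(4) r by (intro mult_right_mono) auto
      finally have "D * (real n + 1) * (r ^ 4) ^ n * (real n + 1) * of_int (q n) \<le> (r ^ 2) ^ n * of_int (q n)"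
        using qn by (intro mult_right_mono) auto
      then show ?thesis by (simp add: field_simps)
    qed
    moreover have "\<kappa> ^ n * of_int (q n) \<le> (real n + 1) * (r ^ 4) ^ n * of_int (q n)"
    proof (intro mult_right_mono)
      have "\<kappa> ^ n \<le> 1 * (r ^ 4) ^ n" unfolding r(3) using l by (simp add: power_mono)
      also have "\<dots> \<le> (real n + 1) * (r ^ 4) ^ n" using r(1) by (intro mult_right_mono zero_le_power) auto
      finally show "\<kappa> ^ n \<le> (real n + 1) * (r ^ 4) ^ n" .
    qed (use qn in simp)
    ultimately show ?case using W(2) by (simp add: algebra_simps)
  qed
qed

lemma q_bracket:
  assumes "q n0 \<le> N" shows "\<exists>n\<ge>n0. q n \<le> N \<and> N < q (Suc n)"
proof -
  define n where "n = (LEAST n. N < q (Suc n))"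
  have "N < q (Suc (nat N))" using q_ge[of "Suc (nat N)"] by linarith
  then have n: "N < q (Suc n)" unfolding n_def by (rule LeastI)
  have "n0 \<le> n"
  proof (rule ccontr)
    assume "\<not> n0 \<le> n"
    then have "q (Suc n) \<le> q n0" by (intro q_mono) simp
    then show False using n assms by simp
  qed
  moreover have "q n \<le> N"
  proof (cases n)
    case 0
    then show ?thesis using q_mono[of 0 n0] assms by simp
  next
    case (Suc i)
    have "\<not> N < q (Suc i)" using not_less_Least[of i "\<lambda>n. N < q (Suc n)"] Suc by (simp add: n_def)
    then show ?thesis using Suc by simp
  qed
  ultimately show ?thesis using n by blast
qed

text \<open>Between \<open>q n\<close> and \<open>q (Suc n)\<close> the count is at least
  \<open>r ^ n * q n\<close> with \<open>r ^ 2 = \<theta>\<close>, so the flatness error is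
  relatively of order \<open>(n + 1) r ^ n\<close>. Half of \<open>\<epsilon>\<close> pays for
  flatness, half for this error.\<close>

lemma occ_near:
  assumes tau: "(\<lambda>n. real_of_int (\<tau> n) / real n) \<longlonglongrightarrow> 0" and e: "0 < \<epsilon>" "\<epsilon> < 1"
  shows "eventually (\<lambda>N. 0 < real (occ \<beta> (int N) t)
    \<and> (1 - \<epsilon>) * real (occ \<beta> (int N) t) \<le> real (occ \<beta> (int N) (t + 1))
    \<and> (1 - \<epsilon>) * real (occ \<beta> (int N) t) \<le> real (occ \<beta> (int N) (t - 1))) sequentially"
proof -
  obtain \<theta> C where th: "0 < \<theta>" "\<theta> < 1" "0 < C" and fl: "\<And>n N. 0 \<le> N \<Longrightarrow> N \<le> q (Suc n) \<Longrightarrow>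
      flat (\<epsilon> / 2) (C * (real n + 1) * \<theta> ^ n * of_int (q (Suc n))) (\<lambda>t. occ \<beta> N t)"
    using walk_flat[of "\<epsilon> / 2"] e by auto
  define r where "r = sqrt \<theta>"
  have r: "0 < r" "r < 1" "r ^ 2 = \<theta>" using th by (auto simp: r_def)
  define D where "D = C * (2 * B + 1)"
  have D: "0 < D" using th R.B_ge by (simp add: D_def)
  have "(\<lambda>n. D * ((real n + 1) * r ^ n)) \<longlonglongrightarrow> D * 0"
    using r by (intro tendsto_intros tendsto_decay) auto
  then have "eventually (\<lambda>n. D * ((real n + 1) * r ^ n) < \<epsilon> / 2) sequentially"
    using e by (intro order_tendstoD(2)) auto
  with occ_lower[OF tau r(1,2), of t] eventually_gt_at_top[of 0]
  have "eventually (\<lambda>n. 0 < n \<and> r ^ n * of_int (q n) \<le> real (occ \<beta> (q n) t) \<and> D * ((real n + 1) * r ^ n) < \<epsilon> / 2) sequentially"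
    by eventually_elim auto
  then obtain n0 where n0: "\<And>n. n0 \<le> n \<Longrightarrow> 0 < n" "\<And>n. n0 \<le> n \<Longrightarrow> r ^ n * of_int (q n) \<le> real (occ \<beta> (q n) t)"
    "\<And>n. n0 \<le> n \<Longrightarrow> D * ((real n + 1) * r ^ n) < \<epsilon> / 2"
    unfolding eventually_sequentially by blast
  show ?thesis unfolding eventually_sequentially
  proof (intro exI allI impI)
    fix N :: nat assume "nat (q n0) \<le> N"
    then have "q n0 \<le> int N" by linarith
    then obtain n where n: "n0 \<le> n" "q n \<le> int N" "int N < q (Suc n)" using q_bracket by blast
    have qn: "0 < real_of_int (q n)" using q_ge[of n] n0(1)[OF n(1)] by simp
    define f where "f t = real (occ \<beta> (int N) t)" for t
    have ft: "r ^ n * of_int (q n) \<le> f t"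
      using n0(2)[OF n(1)] occ_mono[OF n(2), of \<beta> t] unfolding f_def by linarith
    have "C * (real n + 1) * \<theta> ^ n * of_int (q (Suc n)) \<le> C * (real n + 1) * \<theta> ^ n * ((2 * B + 1) * of_int (q n))"
      using th q_Suc_le[OF n0(1)[OF n(1)]] by (intro mult_left_mono) auto
    also have "\<dots> = (D * ((real n + 1) * r ^ n)) * (r ^ n * of_int (q n))"
      unfolding D_def r(3)[symmetric] by (simp add: power2_eq_square power_mult_distrib)
    also have "\<dots> \<le> \<epsilon> / 2 * f t"
      using n0(3)[OF n(1)] ft r e qn by (intro mult_mono) auto
    finally have W: "C * (real n + 1) * \<theta> ^ n * of_int (q (Suc n)) \<le> \<epsilon> / 2 * f t" .
    have "(1 - \<epsilon> / 2) * f t \<le> f (t + 1) + C * (real n + 1) * \<theta> ^ n * of_int (q (Suc n))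
      \<and> (1 - \<epsilon> / 2) * f t \<le> f (t - 1) + C * (real n + 1) * \<theta> ^ n * of_int (q (Suc n))"
      using fl[of "int N" n] n(3) unfolding flat_def f_def by simp
    moreover have "(1 - \<epsilon> / 2) * f t - \<epsilon> / 2 * f t = (1 - \<epsilon>) * f t" by (simp add: algebra_simps)
    ultimately have "(1 - \<epsilon>) * f t \<le> f (t + 1)" "(1 - \<epsilon>) * f t \<le> f (t - 1)" using W by linarith+
    moreover have "0 < r ^ n * of_int (q n)" using r qn by simp
    then have "0 < f t" using ft by linarith
    ultimately show "0 < real (occ \<beta> (int N) t)
        \<and> (1 - \<epsilon>) * real (occ \<beta> (int N) t) \<le> real (occ \<beta> (int N) (t + 1))
        \<and> (1 - \<epsilon>) * real (occ \<beta> (int N) t) \<le> real (occ \<beta> (int N) (t - 1))"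
      unfolding f_def by simp
  qed
qed

lemma occ_ratio:
  assumes tau: "(\<lambda>n. real_of_int (\<tau> n) / real n) \<longlonglongrightarrow> 0"
  shows "(\<lambda>N. real (occ \<beta> (int N) t) / real (occ \<beta> (int N) t')) \<longlonglongrightarrow> 1"
proof -
  define f where "f t N = real (occ \<beta> (int N) t)" for t N
  have pos: "eventually (\<lambda>N. 0 < f t N) sequentially" for t
    using occ_near[OF tau, of "1/2" t] unfolding f_def by (auto elim!: eventually_mono)
  have le: "eventually (\<lambda>N. (1 - \<epsilon>) * f t N \<le> f (t + 1) N) sequentially"
    "eventually (\<lambda>N. (1 - \<epsilon>) * f t N \<le> f (t - 1) N) sequentially" if "0 < \<epsilon>" "\<epsilon> < 1" for t \<epsilon>
    using occ_near[OF tau that, of t] unfolding f_def by (auto elim!: eventually_mono)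
  have adj: "(\<lambda>N. f (t + 1) N / f t N) \<longlonglongrightarrow> 1" "(\<lambda>N. f t N / f (t + 1) N) \<longlonglongrightarrow> 1" for t
    using le(1)[of _ t] le(2)[of _ "t + 1"] by (auto intro!: ratio_tendsto_1 pos)
  have comp: "(\<lambda>N. f t N / f t'' N) \<longlonglongrightarrow> 1" if "(\<lambda>N. f t N / f t' N) \<longlonglongrightarrow> 1" "(\<lambda>N. f t' N / f t'' N) \<longlonglongrightarrow> 1" for t t' t''
  proof (rule Lim_transform_eventually)
    show "(\<lambda>N. (f t N / f t' N) * (f t' N / f t'' N)) \<longlonglongrightarrow> 1" using tendsto_mult[OF that] by simp
    show "eventually (\<lambda>N. (f t N / f t' N) * (f t' N / f t'' N) = f t N / f t'' N) sequentially"
      using pos[of t'] by eventually_elim simp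
  qed
  have "(\<lambda>N. f (t' + int j) N / f t' N) \<longlonglongrightarrow> 1 \<and> (\<lambda>N. f t' N / f (t' + int j) N) \<longlonglongrightarrow> 1" for t' j
  proof (induction j)
    case 0
    have "(\<lambda>N. f t' N / f t' N) \<longlonglongrightarrow> 1"
      by (rule Lim_transform_eventually[OF tendsto_const]) (use pos[of t'] in \<open>eventually_elim, simp\<close>)
    then show ?case by simp
  next
    case (Suc j)
    then show ?case using comp[OF adj(1)[of "t' + int j"], of t'] comp[OF _ adj(2)[of "t' + int j"], of t']
      by (simp add: algebra_simps)
  qed
  from this[of t' "nat (t - t')"] this[of t "nat (t' - t)"]
  show ?thesis unfolding f_def by (cases "t' \<le> t") auto
qed

text \<open>Equal counts on neighbouring levels make the visits to 0 grow asymptotically like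
  \<open>q\<close>, hence faster than \<open>\<kappa> ^ n * q n\<close> for each
  \<open>\<kappa> < 1\<close>. If \<open>|\<tau> n| \<ge> \<eta> n\<close> held for large
  \<open>n\<close>, \<open>coef_decay\<close> would contradict this.\<close>

lemma \<tau>_small_of_ratio:
  assumes ratio: "\<And>t t'. (\<lambda>N. real (occ \<beta> (int N) t) / real (occ \<beta> (int N) t')) \<longlonglongrightarrow> 1"
  shows "(\<lambda>n. real_of_int (\<tau> n) / real n) \<longlonglongrightarrow> 0"
proof -
  define f where "f t n = real (occ \<beta> (q n) t)" for t n
  have qlim: "filterlim (\<lambda>n. nat (q n)) at_top sequentially"
  proof (rule filterlim_at_top_mono[OF filterlim_ident always_eventually], rule allI)
    show "n \<le> nat (q n)" for n using q_ge[of n] by linarith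
  qed
  have rq: "(\<lambda>n. f t n / f t' n) \<longlonglongrightarrow> 1" for t t'
    using filterlim_compose[OF ratio qlim, of t t'] q_less unfolding f_def by simp
  \<comment> \<open>Where \<open>f 0 n = 0\<close>, the quotient of \<open>f 0 n\<close> by itself
    is 0, so the limit 1 excludes this eventually.\<close>
  have pos: "eventually (\<lambda>n. 0 < f 0 n) sequentially"
  proof -
    have "eventually (\<lambda>n. 0 < f 0 n / f 0 n) sequentially" using rq[of 0 0] by (intro order_tendstoD(1)) auto
    then show ?thesis
    proof eventually_elim
      case (elim n)
      then have "f 0 n \<noteq> 0" by auto
      then show ?case by (simp add: f_def)
    qed
  qed
  have fmono: "f t n \<le> f t (Suc n)" for t n
    unfolding f_def using occ_mono[of "q n" "q (Suc n)" \<beta> t] q_less[of n] by simp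
  define dev where "dev n = \<bar>f 1 n / f 0 n - 1\<bar> + \<bar>f (-1) n / f 0 n - 1\<bar>" for n
  have "dev \<longlonglongrightarrow> \<bar>1 - 1\<bar> + \<bar>1 - 1\<bar>" unfolding dev_def by (intro tendsto_intros rq)
  then have dev: "dev \<longlonglongrightarrow> 0" by simp
  have dev_nn: "0 \<le> dev n" for n by (simp add: dev_def)
  have dev_le: "\<bar>f (0 - c (Suc i)) n / f 0 n - 1\<bar> \<le> dev n" for i n
    using sg_eq[of \<beta> "q (Suc i)"] unfolding dev_def c_def by auto
  define Q where "Q n = real_of_int (q n)" for n
  obtain \<rho>0 where rho0: "1 < \<rho>0" "\<And>n. \<rho>0 * Q n \<le> Q (Suc n)" using R.Q_growth unfolding Q_eq Q_def by blast
  have Qpos: "0 < Q (Suc n)" for n using q_ge[of "Suc n"] by (simp add: Q_def del: q.simps)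
  define e where "e n = \<bar>f 0 (Suc n) / f 0 n - Q (Suc n) / Q n\<bar>" for n
  \<comment> \<open>The ratios of \<open>f 0\<close> obey the recurrence of the ratios of
    \<open>Q\<close> up to terms in \<open>dev\<close>. The recurrence contracts differences by
    \<open>1 / \<rho>0\<close>, so \<open>contraction_tendsto_0\<close> applies.\<close>
  have e: "e \<longlonglongrightarrow> 0"
  proof (rule contraction_tendsto_0[where a = "1 / \<rho>0"])
    have "(\<lambda>n. B * dev (Suc n) + dev n) \<longlonglongrightarrow> B * 0 + 0"
      by (intro tendsto_intros dev LIMSEQ_Suc)
    then show "(\<lambda>n. B * dev (Suc n) + dev n) \<longlonglongrightarrow> 0" by simp
    show "eventually (\<lambda>n. e (Suc n) \<le> (B * dev (Suc n) + dev n) + 1 / \<rho>0 * e n) sequentially"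
      using pos eventually_gt_at_top[of 0]
    proof eventually_elim
      case (elim n)
      define F0 F1 where "F0 = f 0 n" and "F1 = f 0 (Suc n)"
      define \<rho> where "\<rho> = F1 / F0"
      define R where "R = Q (Suc n) / Q n"
      have Q0: "0 < Q n" using Qpos[of "n - 1"] elim by simp
      have F: "0 < F0" "F0 \<le> F1" using elim fmono[of 0 n] by (auto simp: F0_def F1_def)
      have rho: "1 \<le> \<rho>" using F by (simp add: \<rho>_def)
      have R: "\<rho>0 \<le> R" "0 < R" using rho0(2)[of n] Q0 Qpos[of n] by (auto simp: R_def field_simps)
      define A where "A = f (0 - c (Suc n)) (Suc n) / F1"
      define t0 where "t0 = (if s n * s (Suc n) = 1 then 0 else 0 - c (Suc n))"
      define E where "E = f t0 n / F0"
      have A: "\<bar>A - 1\<bar> \<le> dev (Suc n)" using dev_le[of n "Suc n"] by (simp add: A_def F1_def)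
      have E: "\<bar>E - 1\<bar> \<le> dev n"
        using dev_le[of n n] dev_nn[of n] F by (auto simp: E_def F0_def t0_def)
      have "f 0 (Suc (Suc n)) = mu n * (F1 + f (0 - c (Suc n)) (Suc n)) + sig n * f t0 n"
        using occ_rec[of n 0] unfolding f_def F1_def t0_def by simp
      also have "\<dots> = mu n * (F1 + A * F1) + sig n * (E * F0)" using F by (simp add: A_def E_def)
      also have "\<dots> = F1 * (mu n * (1 + A) + sig n * E / \<rho>)" using F by (simp add: \<rho>_def field_simps)
      finally have r1: "f 0 (Suc (Suc n)) / f 0 (Suc n) = mu n * (1 + A) + sig n * E / \<rho>"
        using F by (simp add: F1_def)
      have "Q (Suc (Suc n)) = mu n * 2 * Q (Suc n) + sig n * Q n"
        using R.H.simps(3)[of n 2] unfolding Q_eq Q_def by simp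
      also have "\<dots> = Q (Suc n) * (2 * mu n + sig n / R)" using Qpos[of n] Q0 by (simp add: R_def field_simps)
      finally have r2: "Q (Suc (Suc n)) / Q (Suc n) = 2 * mu n + sig n / R" using Qpos[of n] by simp
      have "e (Suc n) = \<bar>mu n * (A - 1) + sig n * ((E - 1) / \<rho>) - sig n * ((\<rho> - R) / (\<rho> * R))\<bar>"
        unfolding e_def r1 r2 using rho R by (intro arg_cong[of _ _ abs]) (simp add: field_simps)
      also have "\<dots> \<le> \<bar>mu n * (A - 1)\<bar> + \<bar>sig n * ((E - 1) / \<rho>)\<bar> + \<bar>sig n * ((\<rho> - R) / (\<rho> * R))\<bar>"
        by (intro order_trans[OF abs_triangle_ineq4] add_right_mono abs_triangle_ineq)
      also have "\<bar>mu n * (A - 1)\<bar> \<le> B * dev (Suc n)"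
        unfolding abs_mult using R.mu_ge[of n] mu_le_B[of n] A by (intro mult_mono) auto
      also have "\<bar>sig n * ((E - 1) / \<rho>)\<bar> \<le> dev n"
      proof -
        have "\<bar>sig n * ((E - 1) / \<rho>)\<bar> = \<bar>E - 1\<bar> / \<rho>" using R.sigma[of n] rho by (auto simp: abs_mult)
        also have "\<dots> \<le> \<bar>E - 1\<bar> / 1" using rho by (intro divide_left_mono) auto
        finally show ?thesis using E by simp
      qed
      also have "\<bar>sig n * ((\<rho> - R) / (\<rho> * R))\<bar> \<le> 1 / \<rho>0 * e n"
      proof -
        have "\<bar>sig n * ((\<rho> - R) / (\<rho> * R))\<bar> = \<bar>\<rho> - R\<bar> / (\<rho> * R)" using R.sigma[of n] rho R by (auto simp: abs_mult)
        also have "\<dots> \<le> \<bar>\<rho> - R\<bar> / (1 * \<rho>0)" using rho R rho0 by (intro divide_left_mono mult_mono) auto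
        finally show ?thesis by (simp add: e_def \<rho>_def R_def F0_def F1_def)
      qed
      finally show ?case by simp
    qed
  qed (use rho0 in \<open>auto simp: e_def\<close>)
  show ?thesis
  proof (rule LIMSEQ_I)
    fix \<eta> :: real assume eta: "0 < \<eta>"
    obtain \<nu> where nu: "0 < \<nu>" "\<nu> < 1" and decay: "\<And>n k. \<eta> * real n \<le> of_int \<bar>k\<bar> \<Longrightarrow> R.coef n k \<le> \<nu> ^ n * R.H n 2"
      using R.coef_decay[OF eta] by blast
    \<comment> \<open>As \<open>\<nu> = \<kappa> ^ 2\<close>, the upper bound
      \<open>\<nu> ^ n\<close> is smaller than the lower bound, of order
      \<open>\<kappa> ^ n\<close>, by another factor \<open>\<kappa> ^ n\<close>.\<close>
    define \<kappa> where "\<kappa> = sqrt \<nu>"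
    have k: "0 < \<kappa>" "\<kappa> < 1" "\<kappa> * \<kappa> = \<nu>" using nu by (auto simp: \<kappa>_def)
    have "eventually (\<lambda>n. e n < 1 - \<kappa>) sequentially" using e k by (intro order_tendstoD(2)) auto
    with pos eventually_gt_at_top[of 0]
    have "eventually (\<lambda>n. 0 < f 0 n \<and> 0 < n \<and> e n < 1 - \<kappa>) sequentially" by eventually_elim auto
    then obtain n0 where n0: "\<And>n. n0 \<le> n \<Longrightarrow> 0 < f 0 n" "\<And>n. n0 \<le> n \<Longrightarrow> 0 < n" "\<And>n. n0 \<le> n \<Longrightarrow> e n < 1 - \<kappa>"
      unfolding eventually_sequentially by blast
    have Q0: "0 < Q n" if "n0 \<le> n" for n using Qpos[of "n - 1"] n0(2)[OF that] by simp
    define C where "C = f 0 n0 / Q n0"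
    have C: "0 < C" using n0(1) Q0 by (simp add: C_def)
    have low: "C * \<kappa> ^ j * Q (n0 + j) \<le> f 0 (n0 + j)" for j
    proof (induction j)
      case 0
      then show ?case using Q0[of n0] by (simp add: C_def)
    next
      case (Suc j)
      define n where "n = n0 + j"
      have p: "0 < f 0 n" "0 < Q n" using n0(1)[of n] Q0[of n] by (auto simp: n_def)
      define R where "R = Q (Suc n) / Q n"
      have "Q n \<le> Q (Suc n)" using q_less[of n] by (simp add: Q_def)
      then have R: "1 \<le> R" using p by (simp add: R_def)
      have "R - (1 - \<kappa>) \<le> f 0 (Suc n) / f 0 n"
        using n0(3)[of n] unfolding e_def R_def by (simp add: n_def)
      moreover have "\<kappa> * R \<le> R - (1 - \<kappa>)"
        using mult_right_mono[of 1 R "1 - \<kappa>"] R k by (simp add: algebra_simps)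
      ultimately have "\<kappa> * R \<le> f 0 (Suc n) / f 0 n" by linarith
      then have "\<kappa> * R * f 0 n \<le> f 0 (Suc n)" using p by (simp add: field_simps)
      moreover have "\<kappa> * R * (C * \<kappa> ^ j * Q n) \<le> \<kappa> * R * f 0 n"
        using Suc k R unfolding n_def[symmetric] by (intro mult_left_mono) auto
      moreover have "\<kappa> * R * (C * \<kappa> ^ j * Q n) = C * \<kappa> ^ Suc j * Q (Suc n)"
        using p by (simp add: R_def)
      ultimately have "C * \<kappa> ^ Suc j * Q (Suc n) \<le> f 0 (Suc n)" by linarith
      then show ?case by (simp add: n_def)
    qed
    have "eventually (\<lambda>n. \<kappa> ^ n < C) sequentially"
      using LIMSEQ_power_zero[of \<kappa>] k C by (intro order_tendstoD(2)) auto
    then obtain n1 where n1: "\<And>n. n1 \<le> n \<Longrightarrow> \<kappa> ^ n < C" unfolding eventually_sequentially by blast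
    show "\<exists>no. \<forall>n\<ge>no. norm (of_int (\<tau> n) / real n - 0) < \<eta>"
    proof (intro exI allI impI)
      fix n assume n: "max n0 n1 \<le> n"
      then have np: "0 < real n" using n0(2)[of n] by simp
      show "norm (of_int (\<tau> n) / real n - 0) < \<eta>"
      proof (rule ccontr)
        assume "\<not> ?thesis"
        then have "\<eta> * real n \<le> of_int \<bar>- \<tau> n\<bar>" using np by (simp add: field_simps)
        from decay[OF this] have "f 0 n \<le> \<nu> ^ n * Q n" using occ_eq[of n 0] unfolding f_def Q_eq Q_def by simp
        also have "\<nu> ^ n * Q n = \<kappa> ^ n * (\<kappa> ^ n * Q n)" by (simp add: k(3)[symmetric] power_mult_distrib)
        also have "\<dots> < C * (\<kappa> ^ n * Q n)"
          using n1[of n] n Q0[of n] k by (intro mult_strict_right_mono) auto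
        also have "\<dots> \<le> C * (\<kappa> ^ (n - n0) * Q n)"
          using C k Q0[of n] n by (intro mult_left_mono mult_right_mono power_decreasing) auto
        also have "\<dots> \<le> f 0 n" using low[of "n - n0"] n by simp
        finally show False by simp
      qed
    qed
  qed
qed

end

section \<open>The discrepancy as a walk, and the limit of the centre\<close>

lemma sum_int_interval: "(\<Sum>j<Suc n. f (int j)) = f 0 + (\<Sum>j\<in>{1..int n}. f j)"
proof (induction n)
  case (Suc n)
  have "{1..int (Suc n)} = insert (int (Suc n)) {1..int n}" by auto
  then show ?case using Suc by (simp add: algebra_simps)
qed simp

lemma frac_less_half_iff: "frac x < 1/2 \<longleftrightarrow> even \<lfloor>2 * x\<rfloor>" for x :: real
proof -
  have x: "x = of_int \<lfloor>x\<rfloor> + frac x" by (simp add: frac_def)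
  show ?thesis
  proof (cases "frac x < 1/2")
    case True
    have "\<lfloor>2 * x\<rfloor> = 2 * \<lfloor>x\<rfloor>"
      using True frac_ge_0[of x] x by (intro floor_unique) auto
    then show ?thesis using True by simp
  next
    case False
    have "\<lfloor>2 * x\<rfloor> = 2 * \<lfloor>x\<rfloor> + 1"
      using False frac_lt_1[of x] x by (intro floor_unique) auto
    then show ?thesis using False by simp
  qed
qed

text \<open>Twice the discrepancy is the number of hits minus the number of misses. The index
  \<open>j = 0\<close> is always a hit and gives the 1, the others are the steps of the
  walk.\<close>

lemma discrepancy_eq_walk:
  assumes b: "\<beta> = 2 * \<alpha> - 1"
  shows "discrepancy \<alpha> (Suc n) = (1 + real_of_int (walk \<beta> (int n))) / 2"
proof -
  have sg: "sg \<beta> (int j) = (if frac (real j * \<alpha>) \<in> {0..<1/2} then 1 else -1)" for j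
  proof -
    have "\<lfloor>2 * (real j * \<alpha>)\<rfloor> = int j + \<lfloor>real_of_int (int j) * \<beta>\<rfloor>"
    proof -
      have "2 * (real j * \<alpha>) = real_of_int (int j) + real_of_int (int j) * \<beta>" by (simp add: b algebra_simps)
      then show ?thesis by (simp only: flip: int_add_floor)
    qed
    then show ?thesis using frac_less_half_iff[of "real j * \<alpha>"] by (auto simp: sg_def frac_ge_0)
  qed
  have card: "card {j. j < N \<and> P j} = (\<Sum>j<N. if P j then 1 else 0)" for N and P :: "nat \<Rightarrow> bool"
    by (simp add: sum.If_cases Int_def lessThan_def)
  have "2 * discrepancy \<alpha> N = real_of_int (\<Sum>j<N. sg \<beta> (int j))" for N
    unfolding discrepancy_def card sg
    by (induction N) (auto simp: algebra_simps)
  from this[of "Suc n"] show ?thesis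
    unfolding sum_int_interval walk_def by (simp add: sg_def)
qed

text \<open>\<open>N\<close> corresponds to the time \<open>N - 1\<close>; the level drops by 1 on
  account of the index \<open>j = 0\<close>.\<close>

lemma card_discrepancy:
  assumes b: "\<beta> = 2 * \<alpha> - 1"
  shows "card {N\<in>{1..n}. discrepancy \<alpha> N = of_int k / 2} = occ \<beta> (int n) (k - 1)"
proof -
  have iff: "discrepancy \<alpha> (Suc i) = of_int k / 2 \<longleftrightarrow> walk \<beta> (int i) = k - 1" for i
  proof -
    have "(1 + v) / 2 = w / 2 \<longleftrightarrow> v = w - 1" for v w :: real
      by (subst divide_cancel_right) auto
    moreover have "real_of_int v = of_int k - 1 \<longleftrightarrow> v = k - 1" for v by linarith
    ultimately show ?thesis unfolding discrepancy_eq_walk[OF b] by (simp only:)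
  qed
  define A where "A = {r. 0 \<le> r \<and> r < int n \<and> walk \<beta> r = k - 1}"
  have "{N\<in>{1..n}. discrepancy \<alpha> N = of_int k / 2} = (\<lambda>r. Suc (nat r)) ` A"
  proof (intro set_eqI iffI)
    fix N assume N: "N \<in> {N\<in>{1..n}. discrepancy \<alpha> N = of_int k / 2}"
    then obtain i where i: "N = Suc i" by (cases N) simp_all
    then have "int i \<in> A" using N iff[of i] unfolding A_def by simp
    then show "N \<in> (\<lambda>r. Suc (nat r)) ` A" by (rule rev_image_eqI) (simp add: i)
  next
    fix N assume "N \<in> (\<lambda>r. Suc (nat r)) ` A"
    then obtain r where r: "r \<in> A" "N = Suc (nat r)" by blast
    then show "N \<in> {N\<in>{1..n}. discrepancy \<alpha> N = of_int k / 2}"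
      using iff[of "nat r"] unfolding A_def by auto
  qed
  moreover have "inj_on (\<lambda>r. Suc (nat r)) A" by (auto simp: inj_on_def A_def)
  ultimately show ?thesis unfolding occ_def A_def[symmetric] by (simp only: card_image)
qed

lemma equidistributed_iff_occ:
  assumes b: "\<beta> = 2 * \<alpha> - 1"
  shows "equidistributed_half_ints (discrepancy \<alpha>) \<longleftrightarrow>
    (\<forall>t t'. (\<lambda>n. real (occ \<beta> (int n) t) / real (occ \<beta> (int n) t')) \<longlonglongrightarrow> 1)"
proof -
  have half: "discrepancy \<alpha> N \<in> half_ints" if N: "1 \<le> N" for N
  proof -
    obtain n where "N = Suc n" using N by (cases N) auto
    then show ?thesis unfolding discrepancy_eq_walk[OF b] half_ints_def \<open>N = Suc n\<close>
      by (intro range_eqI[of _ _ "1 + walk \<beta> (int n)"]) simp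
  qed
  show ?thesis
  proof (intro iffI allI)
    fix t t'
    assume E: "equidistributed_half_ints (discrepancy \<alpha>)"
    have "of_int (t + 1) / 2 \<in> half_ints" "of_int (t' + 1) / 2 \<in> half_ints"
      unfolding half_ints_def by blast+
    from E[unfolded equidistributed_half_ints_def, THEN conjunct2, rule_format, OF this]
    show "(\<lambda>n. real (occ \<beta> (int n) t) / real (occ \<beta> (int n) t')) \<longlonglongrightarrow> 1"
      unfolding card_discrepancy[OF b] by simp
  next
    assume R: "\<forall>t t'. (\<lambda>n. real (occ \<beta> (int n) t) / real (occ \<beta> (int n) t')) \<longlonglongrightarrow> 1"
    show "equidistributed_half_ints (discrepancy \<alpha>)"
      unfolding equidistributed_half_ints_def
    proof (intro conjI ballI allI impI half)
      fix \<xi> \<xi>' assume "\<xi> \<in> half_ints" "\<xi>' \<in> half_ints"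
      then obtain k k' where k: "\<xi> = of_int k / 2" "\<xi>' = of_int k' / 2"
        unfolding half_ints_def by blast
      show "(\<lambda>n. real (card {N\<in>{1..n}. discrepancy \<alpha> N = \<xi>})
          / real (card {N\<in>{1..n}. discrepancy \<alpha> N = \<xi>'})) \<longlonglongrightarrow> 1"
        unfolding k card_discrepancy[OF b] using R by blast
    qed
  qed
qed

text \<open>\<open>r \<beta> - t = 2 r \<alpha> - (r + t)\<close>, and the doubled denominator
  halves the constant.\<close>

lemma badly_approximable_double:
  assumes "bounded_type \<alpha>" "\<beta> = 2 * \<alpha> - 1"
  shows "\<exists>c>0. \<forall>r\<ge>1. \<forall>t. c \<le> of_int r * \<bar>of_int r * \<beta> - of_int t\<bar>"
proof -
  obtain c where c: "0 < c" "\<And>r t. 1 \<le> r \<Longrightarrow> c \<le> of_int r * \<bar>of_int r * \<alpha> - of_int t\<bar>"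
    using bounded_type_badly_approximable[OF assms(1)] by blast
  have "c / 2 \<le> of_int r * \<bar>of_int r * \<beta> - of_int t\<bar>" if "1 \<le> r" for r t
    using c(2)[of "2 * r" "r + t"] that by (simp add: assms(2) algebra_simps)
  then show ?thesis using c(1) by (intro exI[of _ "c / 2"]) auto
qed

text \<open>The sums are the centres at odd indices. The centre moves by 1 per step, so the even
  indices follow, and the factor 2 between the indices does not affect a zero limit.\<close>

lemma (in even_expansion) \<tau>_limit_iff:
  "(\<lambda>n. real_of_int (\<tau> n) / real n) \<longlonglongrightarrow> 0 \<longleftrightarrow>
   (\<lambda>n. 1 / real n * (\<Sum>j=1..n. real_of_int (s (2 * j) - s (2 * j - 1)))) \<longlonglongrightarrow> 0"
proof -
  define D where "D n = real_of_int (\<tau> (Suc (2 * n))) / real n" for n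
  have D: "1 / real n * (\<Sum>j=1..n. real_of_int (s (2 * j) - s (2 * j - 1))) = D n" for n
    unfolding D_def \<tau>_sum by simp
  have step: "\<bar>real_of_int (\<tau> (Suc (Suc n))) - \<tau> (Suc n)\<bar> = 1" for n
    using sg_eq[of \<beta> "q (Suc n)"] unfolding \<tau>_Suc_Suc c_def by auto
  show ?thesis unfolding D
  proof
    assume L: "(\<lambda>n. real_of_int (\<tau> n) / real n) \<longlonglongrightarrow> 0"
    have sm: "strict_mono (\<lambda>n. Suc (2 * n))" by (auto simp: strict_mono_def)
    have "(\<lambda>n. (2 + 1 / real n) * (real_of_int (\<tau> (Suc (2 * n))) / real (Suc (2 * n)))) \<longlonglongrightarrow> (2 + 0) * 0"
      using LIMSEQ_subseq_LIMSEQ[OF L sm] by (intro tendsto_intros lim_1_over_n) (simp add: o_def)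
    then have "(\<lambda>n. (2 + 1 / real n) * (real_of_int (\<tau> (Suc (2 * n))) / real (Suc (2 * n)))) \<longlonglongrightarrow> 0" by simp
    moreover have "eventually (\<lambda>n. (2 + 1 / real n) * (real_of_int (\<tau> (Suc (2 * n))) / real (Suc (2 * n))) = D n) sequentially"
      using eventually_gt_at_top[of 0]
    proof eventually_elim
      case (elim n)
      then have "2 + 1 / real n = real (Suc (2 * n)) / real n" by (simp add: field_simps)
      then show ?case unfolding D_def by (simp del: of_nat_Suc)
    qed
    ultimately show "D \<longlonglongrightarrow> 0" by (rule Lim_transform_eventually)
  next
    assume L: "D \<longlonglongrightarrow> 0"
    have half: "filterlim (\<lambda>n. (n - 1) div 2) at_top sequentially"
      unfolding filterlim_at_top
    proof
      fix Z :: nat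
      show "eventually (\<lambda>n. Z \<le> (n - 1) div 2) sequentially"
        using eventually_ge_at_top[of "2 * Z + 1"] by eventually_elim linarith
    qed
    have lim: "(\<lambda>n. \<bar>D ((n - 1) div 2)\<bar> + 1 / real n) \<longlonglongrightarrow> 0"
      using tendsto_add[OF tendsto_rabs[OF filterlim_compose[OF L half]] lim_1_over_n] by simp
    show "(\<lambda>n. real_of_int (\<tau> n) / real n) \<longlonglongrightarrow> 0"
    proof (rule Lim_null_comparison[OF _ lim])
      show "eventually (\<lambda>n. norm (real_of_int (\<tau> n) / real n) \<le> \<bar>D ((n - 1) div 2)\<bar> + 1 / real n) sequentially"
        using eventually_ge_at_top[of 3]
      proof eventually_elim
        case (elim n)
        define i where "i = (n - 1) div 2"
        have i: "1 \<le> i" "i \<le> n" "n = Suc (2 * i) \<or> n = Suc (Suc (2 * i))" using elim by (auto simp: i_def)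
        have "\<bar>real_of_int (\<tau> n)\<bar> \<le> \<bar>real_of_int (\<tau> (Suc (2 * i)))\<bar> + 1"
          using i(3) step[of "2 * i"] by auto
        then have "\<bar>real_of_int (\<tau> n)\<bar> / n \<le> (\<bar>real_of_int (\<tau> (Suc (2 * i)))\<bar> + 1) / n"
          by (intro divide_right_mono) auto
        also have "\<dots> = \<bar>real_of_int (\<tau> (Suc (2 * i)))\<bar> / n + 1 / n" by (simp add: add_divide_distrib)
        also have "\<bar>real_of_int (\<tau> (Suc (2 * i)))\<bar> / n \<le> \<bar>real_of_int (\<tau> (Suc (2 * i)))\<bar> / i"
          using i by (intro divide_left_mono) auto
        finally show ?case unfolding i_def[symmetric] by (simp add: D_def)
      qed
    qed
  qed
qed

theorem theorem1p2:
  fixes \<alpha> \<beta> :: real and m :: "nat \<Rightarrow> int"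
  assumes "\<alpha> \<notin> \<rat>"
    and "bounded_type \<alpha>"
    and "\<beta> = 2 * \<alpha> - 1"
    and "even_cf_expansion m \<beta>"
  shows "equidistributed_half_ints (discrepancy \<alpha>) \<longleftrightarrow>
    (\<lambda>n. 1 / real n * (\<Sum>j=1..n. real_of_int (sgn (m (2 * j)) - sgn (m (2 * j - 1)))))
      \<longlonglongrightarrow> 0"
proof -
  have irr: "\<beta> \<notin> \<rat>"
  proof
    assume "\<beta> \<in> \<rat>"
    then have "(\<beta> + 1) / 2 \<in> \<rat>" by (intro Rats_divide Rats_add Rats_1 Rats_number_of)
    then show False using assms(1) by (simp add: assms(3))
  qed
  obtain b where "expansion (\<lambda>i. 2 * m i) b \<beta>"
    using even_expansion_exists[OF assms(4) irr] by blast
  then interpret expansion "\<lambda>i. 2 * m i" b \<beta> .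
  obtain c where c: "0 < c" "\<And>r t. 1 \<le> r \<Longrightarrow> c \<le> of_int r * \<bar>of_int r * \<beta> - of_int t\<bar>"
    using badly_approximable_double[OF assms(2,3)] by blast
  interpret even_expansion m b \<beta> c
  proof
    show "0 < c" by (rule c(1))
    show "c \<le> of_int r * \<bar>of_int r * \<beta> - of_int t\<bar>" if "1 \<le> r" for r t
      using that by (rule c(2))
  qed
  \<comment> \<open>Restricted to positive indices because \<open>s 0 = 1\<close>; the sums only
    involve \<open>2 * j\<close> and \<open>2 * j - 1\<close> with \<open>j \<ge> 1\<close>.\<close>
  have s: "s i = sgn (m i)" if "0 < i" for i using that by (simp add: s_def sgn_mult)
  have sums: "(\<Sum>j=1..n. real_of_int (sgn (m (2 * j)) - sgn (m (2 * j - 1))))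
      = (\<Sum>j=1..n. real_of_int (s (2 * j) - s (2 * j - 1)))" for n
    by (intro sum.cong refl) (simp add: s)
  show ?thesis
    unfolding equidistributed_iff_occ[OF assms(3)] sums \<tau>_limit_iff[symmetric]
    using occ_ratio \<tau>_small_of_ratio by blast
qed

end
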